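(* Let $a\in\Omega_X$. Then $GR_X(a)$ is countably $d(N-1)$-rectifiable in $TX$, and its Hausdorff dimension satisfies $\dim_H GR_X(a)=d(N-1)$.
   Context: Let $E=\mathbb R^d$, $d\ge2$, $N$ bodies with masses $m_i>0$, mass inner product $\langle x,y\rangle=\sum_i m_i(x_i,y_i)$ on $E^N$ with norm $\|\cdot\|$, $U(x)=\sum_{i<j}\frac{m_im_j}{|x_i-x_j|}$, $\Omega=\{x\in E^N: x_i\ne x_j,\ i\ne j\}$, Newton's equation $\ddot x=\nabla U(x)$. Let $X=\{x\in E^N:\sum_i m_ix_i=0\}$ (a $d(N-1)$-dimensional space), $\Omega_X=\Omega\cap X$, $TX\simeq X\times X$, $T\Omega_X\simeq\Omega_X\times X$. With $L(x,v)=\frac12\|v\|^2+U(x)$, $A_h(\gamma)=\int(L(\gamma,\dot\gamma)+h)dt$ and $\phi_h(x,y)$ the infimum of $A_h$ over absolutely continuous curves from $x$ to $y$ defined on any compact interval, a geodesic ray of energy $h\ge0$ is a solution $\gamma:[0,\infty)\to\Omega$ with $A_h(\gamma|_{[s,t]})=\phi_h(\gamma(s),\gamma(t))$ for all $0\le s<t$. A motion $\gamma$ is hyperbolic with limit shape $a\in\Omega$ if $\gamma(t)=ta+o(t)$ as $t\to+\infty$. $GR_X(a)$ is the set of $(x,v)\in T\Omega_X$ such that the solution of Newton's equation with initial datum $(x,v)$ is a hyperbolic geodesic ray with limit shape $a$ (its energy is then $\frac12\|a\|^2$). *)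

theory Defs
  imports "HOL-Analysis.Analysis"
begin

text \<open>Contribution of one covering set to the (unnormalised) Hausdorff
  s-content; convention 0^0 = 1 for nonempty sets.\<close>
definition hcontrib :: "real \<Rightarrow> 'a::metric_space set \<Rightarrow> real" where
  "hcontrib s C = (if C = {} then 0 else if s = 0 then 1 else diameter C powr s)"

definition hausdorff_pre :: "real \<Rightarrow> real \<Rightarrow> 'a::metric_space set \<Rightarrow> ennreal" where
  "hausdorff_pre s \<delta> A =
     (INF C \<in> {C :: nat \<Rightarrow> 'a set. A \<subseteq> (\<Union>i. C i) \<and> (\<forall>i. bounded (C i) \<and> diameter (C i) \<le> \<delta>)}.
        (\<Sum>i. ennreal (hcontrib s (C i))))"

definition hausdorff_measure :: "real \<Rightarrow> 'a::metric_space set \<Rightarrow> ennreal" where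
  "hausdorff_measure s A = (SUP \<delta> \<in> {0<..}. hausdorff_pre s \<delta> A)"

definition hausdorff_dim :: "'a::metric_space set \<Rightarrow> ereal" where
  "hausdorff_dim A = Inf (ereal ` {s. s \<ge> 0 \<and> hausdorff_measure s A = 0})"

text \<open>R^k realised as functions nat => real vanishing from index k on, with Euclidean distance.\<close>
definition Rk :: "nat \<Rightarrow> (nat \<Rightarrow> real) set" where
  "Rk k = {u. \<forall>i\<ge>k. u i = 0}"

definition edist_k :: "nat \<Rightarrow> (nat \<Rightarrow> real) \<Rightarrow> (nat \<Rightarrow> real) \<Rightarrow> real" where
  "edist_k k u w = sqrt (\<Sum>i<k. (u i - w i)\<^sup>2)"

text \<open>Countably k-rectifiable (Federer 3.2.14): contained in a countable union of
  Lipschitz images of R^k.\<close>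
definition countably_rectifiable :: "nat \<Rightarrow> 'a::metric_space set \<Rightarrow> bool" where
  "countably_rectifiable k A \<longleftrightarrow>
     (\<exists>F :: nat \<Rightarrow> (nat \<Rightarrow> real) \<Rightarrow> 'a.
        A \<subseteq> (\<Union>i. F i ` Rk k) \<and>
        (\<forall>i. \<exists>L. \<forall>u\<in>Rk k. \<forall>w\<in>Rk k. dist (F i u) (F i w) \<le> L * edist_k k u w))"

definition abs_cont_on :: "(real \<Rightarrow> 'a::real_normed_vector) \<Rightarrow> real \<Rightarrow> real \<Rightarrow> bool" where
  "abs_cont_on g s t \<longleftrightarrow>
    (\<forall>\<epsilon>>0. \<exists>\<delta>>0. \<forall>(n::nat) (lo::nat \<Rightarrow> real) hi.
       (\<forall>k<n. s \<le> lo k \<and> lo k \<le> hi k \<and> hi k \<le> t) \<and>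
       (\<forall>j<n. \<forall>k<n. j \<noteq> k \<longrightarrow> hi j \<le> lo k \<or> hi k \<le> lo j) \<and>
       (\<Sum>k<n. hi k - lo k) < \<delta>
       \<longrightarrow> (\<Sum>k<n. norm (g (hi k) - g (lo k))) < \<epsilon>)"

section \<open>N-body problem in E = R^d; configurations are (real^'d)^'n\<close>

definition minner :: "('n::finite \<Rightarrow> real) \<Rightarrow> (real^'d)^'n \<Rightarrow> (real^'d)^'n \<Rightarrow> real" where
  "minner m x y = (\<Sum>i\<in>UNIV. m i * (x$i \<bullet> y$i))"

definition mnorm :: "('n::finite \<Rightarrow> real) \<Rightarrow> (real^'d)^'n \<Rightarrow> real" where
  "mnorm m x = sqrt (minner m x x)"

text \<open>U(x) = sum over i<j of m_i m_j / |x_i - x_j|, written as half of the sum over ordered pairs.\<close>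
definition Upot :: "('n::finite \<Rightarrow> real) \<Rightarrow> (real^'d)^'n \<Rightarrow> real" where
  "Upot m x = (\<Sum>i\<in>UNIV. \<Sum>j\<in>UNIV - {i}. m i * m j / norm (x$i - x$j)) / 2"

definition Omega :: "((real^'d)^'n::finite) set" where
  "Omega = {x. \<forall>i j. i \<noteq> j \<longrightarrow> x$i \<noteq> x$j}"

definition Xc :: "('n::finite \<Rightarrow> real) \<Rightarrow> ((real^'d)^'n) set" where
  "Xc m = {x. (\<Sum>i\<in>UNIV. m i *\<^sub>R x$i) = 0}"

definition Uext :: "('n::finite \<Rightarrow> real) \<Rightarrow> (real^'d)^'n \<Rightarrow> ennreal" where
  "Uext m x = (if x \<in> Omega then ennreal (Upot m x) else \<infinity>)"

definition action :: "('n::finite \<Rightarrow> real) \<Rightarrow> real \<Rightarrow> (real \<Rightarrow> (real^'d)^'n) \<Rightarrow> real \<Rightarrow> real \<Rightarrow> ennreal" where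
  "action m h g s t =
     (\<integral>\<^sup>+ \<tau>. indicator {s..t} \<tau> *
        (ennreal ((mnorm m (vector_derivative g (at \<tau>)))\<^sup>2 / 2) + Uext m (g \<tau>) + ennreal h) \<partial>lborel)"

definition phi :: "('n::finite \<Rightarrow> real) \<Rightarrow> real \<Rightarrow> (real^'d)^'n \<Rightarrow> (real^'d)^'n \<Rightarrow> ennreal" where
  "phi m h x y =
     (INF (g, s, t) \<in> {(g, s, t). s < t \<and> abs_cont_on g s t \<and> g s = x \<and> g t = y}. action m h g s t)"

text \<open>g is a solution of Newton's equation on [0,oo) in Omega with velocity vel;
  the acceleration acc t is the mass-gradient of U at g t.\<close>
definition newton_sol :: "('n::finite \<Rightarrow> real) \<Rightarrow> (real \<Rightarrow> (real^'d)^'n) \<Rightarrow> (real \<Rightarrow> (real^'d)^'n) \<Rightarrow> bool" where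
  "newton_sol m g vel \<longleftrightarrow>
     (\<exists>acc. \<forall>t\<ge>0. g t \<in> Omega \<and>
        (g has_vector_derivative vel t) (at t within {0..}) \<and>
        (vel has_vector_derivative acc t) (at t within {0..}) \<and>
        (Upot m has_derivative (\<lambda>w. minner m (acc t) w)) (at (g t)))"

definition geodesic_ray :: "('n::finite \<Rightarrow> real) \<Rightarrow> real \<Rightarrow> (real \<Rightarrow> (real^'d)^'n) \<Rightarrow> (real \<Rightarrow> (real^'d)^'n) \<Rightarrow> bool" where
  "geodesic_ray m h g vel \<longleftrightarrow> h \<ge> 0 \<and> newton_sol m g vel \<and>
     (\<forall>s t. 0 \<le> s \<longrightarrow> s < t \<longrightarrow> action m h g s t = phi m h (g s) (g t))"

definition hyperbolic_limit :: "(real \<Rightarrow> (real^'d)^'n::finite) \<Rightarrow> (real^'d)^'n \<Rightarrow> bool" where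
  "hyperbolic_limit g a \<longleftrightarrow> a \<in> Omega \<and> ((\<lambda>t. norm (g t - t *\<^sub>R a) / t) \<longlongrightarrow> 0) at_top"

text \<open>GR_X(a), as a subset of TX = X x X inside (E^N) x (E^N).\<close>
definition GR :: "('n::finite \<Rightarrow> real) \<Rightarrow> (real^'d)^'n \<Rightarrow> (((real^'d)^'n) \<times> ((real^'d)^'n)) set" where
  "GR m a = {(x, v). x \<in> Omega \<inter> Xc m \<and> v \<in> Xc m \<and>
     (\<exists>g vel h. g 0 = x \<and> vel 0 = v \<and> geodesic_ray m h g vel \<and> hyperbolic_limit g a)}"

end

theory Submission
  imports Defs
begin

text \<open>
  Rectifiability: the force is Lipschitz with constant \<open>C / \<rho>\<^sup>3\<close> on all configurations with mutual
  distances at least \<open>\<rho>\<close>. For two hyperbolic motions with limit shape \<open>a\<close>, the difference \<open>w\<close> satisfies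
  \<open>|w''| \<le> K |w| / t\<^sup>3\<close> and \<open>w = o(t)\<close>, which forces \<open>|w'(n)| \<le> c |w(n)|\<close> for large \<open>n\<close>; Gronwall's
  inequality on \<open>[0, n]\<close> then bounds the difference of the initial data by \<open>|w(n)|\<close>. So \<open>GR\<close> is a countable
  union of Lipschitz graphs over subsets of the \<open>d (N - 1)\<close>-dimensional space \<open>Xc\<close>.

  Lower bound of the dimension: for \<open>x \<in> Xc\<close> near \<open>R a\<close> with \<open>R\<close> large, a contraction argument gives a
  solution \<open>y\<close> with \<open>y(0) = x\<close> and velocity \<open>v\<close> tending to \<open>a\<close>. It is a geodesic ray: since
  \<open>1 / |z| \<ge> 1 / |p| - p \<bullet> (z - p) / |p|\<^sup>3 - |z - p|\<^sup>2 / (2 |p|\<^sup>3)\<close> for all \<open>z \<noteq> 0\<close>, the function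
  \<open>S(t) + \<langle>v(t), z - y(t)\<rangle> + K |z - y(t)|\<^sup>2 / (R + t)\<^sup>2\<close>, with \<open>S\<close> the action along \<open>y\<close>, grows along every
  absolutely continuous curve at most as fast as its action. Hence \<open>GR\<close> projects onto a neighbourhood
  in \<open>Xc\<close>, and \<open>d (N - 1)\<close>-dimensional Lebesgue measure bounds its Hausdorff measure from below.
\<close>

section \<open>Absolutely continuous curves\<close>

text \<open>The infimum \<open>phi\<close> ranges over all absolutely continuous curves, on
  intervals of any length and possibly through collisions. Competitors are differentiable only
  almost everywhere, so differentiability and the integral of the derivative are derived from the
  epsilon-delta definition \<open>abs_cont_on\<close>. The lower bound of the potential must hold
  for every collision-free \<open>z\<close>, however far from \<open>y t\<close>, which a local
  Taylor estimate cannot give. And a competitor may take another time than \<open>y\<close> does;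
  attraction gives a tangent inequality for \<open>S\<close> along \<open>y\<close> that settles
  this. The quadratic term of the comparison function pays for the error of the linear one. With w =
  z - y and r = R + t, the potential may fall below its linearisation by K |w|^2 / r^3, while
  differentiating K / r^2 yields - 2 K |w|^2 / r^3. The cross term with w' is absorbed by the
  kinetic energy once 2 K <= r. In the upper bound, the condition w = o(t) is what halves the
  dimension: it excludes the linearly growing part of a difference of solutions and leaves only its
  position free.\<close>

definition nonoverlapping :: "nat \<Rightarrow> (nat \<Rightarrow> real) \<Rightarrow> (nat \<Rightarrow> real) \<Rightarrow> real \<Rightarrow> real \<Rightarrow> bool" where
  "nonoverlapping n lo hi u v \<longleftrightarrow>
     (\<forall>k<n. u \<le> lo k \<and> lo k \<le> hi k \<and> hi k \<le> v) \<and>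
     (\<forall>j<n. \<forall>k<n. j \<noteq> k \<longrightarrow> hi j \<le> lo k \<or> hi k \<le> lo j)"

definition var_sum :: "(real \<Rightarrow> 'a::real_normed_vector) \<Rightarrow> nat \<Rightarrow> (nat \<Rightarrow> real) \<Rightarrow> (nat \<Rightarrow> real) \<Rightarrow> real" where
  "var_sum f n lo hi = (\<Sum>k<n. norm (f (hi k) - f (lo k)))"

lemma abs_cont_on_iff:
  "abs_cont_on f s t \<longleftrightarrow> (\<forall>\<epsilon>>0. \<exists>\<delta>>0. \<forall>n lo hi.
     nonoverlapping n lo hi s t \<and> (\<Sum>k<n. hi k - lo k) < \<delta> \<longrightarrow> var_sum f n lo hi < \<epsilon>)"
  unfolding abs_cont_on_def nonoverlapping_def var_sum_def by (simp add: conj_assoc)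

lemma abs_cont_onD:
  assumes "abs_cont_on f s t" "0 < \<epsilon>"
  obtains \<delta> where "0 < \<delta>"
    "\<And>n lo hi. nonoverlapping n lo hi s t \<Longrightarrow> (\<Sum>k<n. hi k - lo k) < \<delta> \<Longrightarrow> var_sum f n lo hi < \<epsilon>"
  using assms unfolding abs_cont_on_iff by meson

lemma nonoverlapping_subinterval:
  "nonoverlapping n lo hi u v \<Longrightarrow> s \<le> u \<Longrightarrow> v \<le> t \<Longrightarrow> nonoverlapping n lo hi s t"
  unfolding nonoverlapping_def by (meson order_trans)

text \<open>The open intervals are disjoint even where the closed ones share endpoints. In the
  fundamental theorem of calculus, \<open>T\<close> is a small neighbourhood of the exceptional null
  set.\<close>

lemma nonoverlapping_length_le_measure:
  assumes "nonoverlapping n lo hi u v" "T \<in> lmeasurable" "(\<Union>k<n. {lo k<..<hi k}) \<subseteq> T"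
  shows "(\<Sum>k<n. hi k - lo k) \<le> measure lebesgue T"
proof -
  let ?I = "\<lambda>k. {lo k<..<hi k}"
  have le: "lo k \<le> hi k" if "k < n" for k
    using assms(1) that unfolding nonoverlapping_def by auto
  have dj: "disjoint_family_on ?I {..<n}"
    unfolding disjoint_family_on_def
  proof (intro ballI impI)
    fix j k assume "j \<in> {..<n}" "k \<in> {..<n}" "j \<noteq> k"
    then have "hi j \<le> lo k \<or> hi k \<le> lo j" using assms(1) unfolding nonoverlapping_def by auto
    then show "?I j \<inter> ?I k = {}" by force
  qed
  have "(\<Sum>k<n. hi k - lo k) = (\<Sum>k<n. measure lebesgue (?I k))"
    using le by (intro sum.cong) auto
  also have "\<dots> = measure lebesgue (\<Union>k<n. ?I k)"
    using dj by (intro measure_finite_Union[symmetric]) (auto simp: le)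
  also have "\<dots> \<le> measure lebesgue T"
    using assms by (intro measure_mono_fmeasurable) auto
  finally show ?thesis .
qed

lemma nonoverlapping_length_le:
  assumes "nonoverlapping n lo hi u v" "u \<le> v"
  shows "(\<Sum>k<n. hi k - lo k) \<le> v - u"
proof -
  have le: "u \<le> lo k" "hi k \<le> v" if "k < n" for k
    using assms(1) that unfolding nonoverlapping_def by auto
  have "(\<Union>k<n. {lo k<..<hi k}) \<subseteq> {u..v}" using le by fastforce
  moreover have "{u..v} \<in> lmeasurable" using lmeasurable_cbox[of u v] by simp
  ultimately show ?thesis
    using nonoverlapping_length_le_measure[OF assms(1), of "{u..v}"] assms(2) by simp
qed

text \<open>Clipping with \<open>min\<close> and \<open>max\<close> splits a family at
  \<open>v\<close> without reindexing: an interval on the wrong side of \<open>v\<close> degenerates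
  to the point \<open>v\<close> and contributes nothing to \<open>var_sum\<close>.\<close>

lemma nonoverlapping_clip:
  assumes "nonoverlapping n lo hi u w" "u \<le> v" "v \<le> w"
  shows "nonoverlapping n (\<lambda>k. min (lo k) v) (\<lambda>k. min (hi k) v) u v"
    and "nonoverlapping n (\<lambda>k. max (lo k) v) (\<lambda>k. max (hi k) v) v w"
proof -
  have *: "hi j \<le> lo k \<or> hi k \<le> lo j" if "j < n" "k < n" "j \<noteq> k" for j k
    using assms(1) that unfolding nonoverlapping_def by blast
  have le: "u \<le> lo k" "lo k \<le> hi k" "hi k \<le> w" if "k < n" for k
    using assms(1) that unfolding nonoverlapping_def by blast+
  show "nonoverlapping n (\<lambda>k. min (lo k) v) (\<lambda>k. min (hi k) v) u v"
    unfolding nonoverlapping_def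
  proof (intro conjI allI impI)
    fix j k assume "j < n" "k < n" "j \<noteq> k"
    from *[OF this] show "min (hi j) v \<le> min (lo k) v \<or> min (hi k) v \<le> min (lo j) v"
      by (auto simp: min_def)
  next
    fix k assume "k < n"
    from le[OF this] show "u \<le> min (lo k) v" "min (lo k) v \<le> min (hi k) v" "min (hi k) v \<le> v"
      using assms by (auto simp: min_def)
  qed
  show "nonoverlapping n (\<lambda>k. max (lo k) v) (\<lambda>k. max (hi k) v) v w"
    unfolding nonoverlapping_def
  proof (intro conjI allI impI)
    fix j k assume "j < n" "k < n" "j \<noteq> k"
    from *[OF this] show "max (hi j) v \<le> max (lo k) v \<or> max (hi k) v \<le> max (lo j) v"
      by (auto simp: max_def)
  next
    fix k assume "k < n"
    from le[OF this] show "v \<le> max (lo k) v" "max (lo k) v \<le> max (hi k) v" "max (hi k) v \<le> w"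
      using assms by (auto simp: max_def)
  qed
qed

lemma var_sum_clip:
  assumes "nonoverlapping n lo hi u w"
  shows "var_sum f n lo hi \<le> var_sum f n (\<lambda>k. min (lo k) v) (\<lambda>k. min (hi k) v)
                           + var_sum f n (\<lambda>k. max (lo k) v) (\<lambda>k. max (hi k) v)"
  unfolding var_sum_def sum.distrib[symmetric]
proof (rule sum_mono)
  fix k assume "k \<in> {..<n}"
  then have le: "lo k \<le> hi k" using assms unfolding nonoverlapping_def by auto
  have "norm (f (hi k) - f (lo k)) \<le> norm (f v - f (lo k)) + norm (f (hi k) - f v)"
    using norm_triangle_ineq[of "f v - f (lo k)" "f (hi k) - f v"] by simp
  then show "norm (f (hi k) - f (lo k)) \<le> norm (f (min (hi k) v) - f (min (lo k) v))
      + norm (f (max (hi k) v) - f (max (lo k) v))"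
    using le by (cases "hi k \<le> v"; cases "v \<le> lo k") (auto simp: min_def max_def)
qed

text \<open>Bisection: finite variation passes from two adjacent intervals to their union, and it
  holds on every interval shorter than the \<delta> that belongs to \<epsilon> = 1.\<close>

lemma abs_cont_on_bounded_variation:
  assumes ac: "abs_cont_on f s t" and "s \<le> t"
  shows "\<exists>B. \<forall>n lo hi. nonoverlapping n lo hi s t \<longrightarrow> var_sum f n lo hi \<le> B"
proof -
  obtain \<delta> where d: "0 < \<delta>"
    "\<And>n lo hi. nonoverlapping n lo hi s t \<Longrightarrow> (\<Sum>k<n. hi k - lo k) < \<delta> \<Longrightarrow> var_sum f n lo hi < 1"
    using abs_cont_onD[OF ac, of 1] by auto
  have "s \<le> s \<and> t \<le> t \<longrightarrow> (\<exists>B. \<forall>n lo hi. nonoverlapping n lo hi s t \<longrightarrow> var_sum f n lo hi \<le> B)"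
  proof (rule Bolzano[where P="\<lambda>u v. s \<le> u \<and> v \<le> t \<longrightarrow> 
      (\<exists>B. \<forall>n lo hi. nonoverlapping n lo hi u v \<longrightarrow> var_sum f n lo hi \<le> B)", OF \<open>s \<le> t\<close>], goal_cases)
    case trans: (1 u v w)
    show ?case
    proof
      assume *: "s \<le> u \<and> w \<le> t"
      then obtain B1 where B1: "\<And>n lo hi. nonoverlapping n lo hi u v \<Longrightarrow> var_sum f n lo hi \<le> B1" using trans by auto
      obtain B2 where B2: "\<And>n lo hi. nonoverlapping n lo hi v w \<Longrightarrow> var_sum f n lo hi \<le> B2" using trans * by auto
      show "\<exists>B. \<forall>n lo hi. nonoverlapping n lo hi u w \<longrightarrow> var_sum f n lo hi \<le> B"
      proof (intro exI[of _ "B1 + B2"] allI impI)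
        fix n lo hi assume no: "nonoverlapping n lo hi u w"
        show "var_sum f n lo hi \<le> B1 + B2"
          using var_sum_clip[OF no, of f v] B1[OF nonoverlapping_clip(1)[OF no]] B2[OF nonoverlapping_clip(2)[OF no]] trans
          by fastforce
      qed
    qed
  next
    case (2 x)
    show ?case
    proof (rule exI[of _ \<delta>], intro conjI allI impI, rule d(1))
      fix u v assume 1: "u \<le> x \<and> x \<le> v \<and> v - u < \<delta>" and 2: "s \<le> u \<and> v \<le> t"
      show "\<exists>B. \<forall>n lo hi. nonoverlapping n lo hi u v \<longrightarrow> var_sum f n lo hi \<le> B"
      proof (intro exI[of _ 1] allI impI)
        fix n lo hi assume no: "nonoverlapping n lo hi u v"
        then show "var_sum f n lo hi \<le> 1"
          using d(2)[OF nonoverlapping_subinterval[OF no]] nonoverlapping_length_le[OF no] 1 2 by fastforce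
      qed
    qed
  qed
  then show ?thesis by simp
qed

text \<open>\<open>W v\<close> is the total variation of \<open>f\<close> on \<open>{s..v}\<close>.
  It is continuous because absolute continuity makes the variation over short intervals small. Both
  \<open>W\<close> and, for real \<open>f\<close>, \<open>W - f\<close> are monotone, which gives
  the Jordan decomposition below.\<close>

lemma abs_cont_on_continuous_majorant:
  assumes ac: "abs_cont_on f s t" and "s \<le> t"
  obtains W :: "real \<Rightarrow> real" where "continuous_on {s..t} W"
    "\<And>u v. s \<le> u \<Longrightarrow> u \<le> v \<Longrightarrow> v \<le> t \<Longrightarrow> norm (f v - f u) \<le> W v - W u"
proof -
  define S where "S v = {var_sum f n lo hi |n lo hi. nonoverlapping n lo hi s v}" for v
  define W where "W v = Sup (S v)" for v
  obtain B where B: "\<And>n lo hi. nonoverlapping n lo hi s t \<Longrightarrow> var_sum f n lo hi \<le> B"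
    using abs_cont_on_bounded_variation[OF assms] by auto
  have bdd: "bdd_above (S v)" if "v \<le> t" for v
    using B nonoverlapping_subinterval[of _ _ _ s v s t] that
    by (intro bdd_aboveI[of _ B]) (auto simp: S_def)
  have ne: "S v \<noteq> {}" for v
    unfolding S_def by (auto simp: nonoverlapping_def intro!: exI[of _ "0::nat"])
  have up: "var_sum f n lo hi \<le> W v" if "nonoverlapping n lo hi s v" "v \<le> t" for n lo hi v
    unfolding W_def by (rule cSup_upper) (use that bdd in \<open>auto simp: S_def\<close>)
  have inc: "norm (f v - f u) \<le> W v - W u" if "s \<le> u" "u \<le> v" "v \<le> t" for u v
  proof -
    have "W u \<le> W v - norm (f v - f u)"
      unfolding W_def[of u]
    proof (rule cSup_least[OF ne])
      fix x assume "x \<in> S u"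
      then obtain n lo hi where x: "x = var_sum f n lo hi" and no: "nonoverlapping n lo hi s u"
        by (auto simp: S_def)
      \<comment> \<open>Appending the interval from \<open>u\<close> to \<open>v\<close> to a family
        in \<open>{s..u}\<close> raises its variation by exactly
        \<open>norm (f v - f u)\<close>.\<close>
      have "nonoverlapping (Suc n) (lo(n:=u)) (hi(n:=v)) s v"
        using no that unfolding nonoverlapping_def by (auto simp: less_Suc_eq)
      then have "var_sum f (Suc n) (lo(n:=u)) (hi(n:=v)) \<le> W v" using up that by blast
      moreover have "var_sum f (Suc n) (lo(n:=u)) (hi(n:=v)) = x + norm (f v - f u)"
        unfolding x var_sum_def by simp
      ultimately show "x \<le> W v - norm (f v - f u)" by simp
    qed
    then show ?thesis by simp
  qed
  have cont: "continuous_on {s..t} W"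
    unfolding continuous_on_iff
  proof (intro ballI allI impI)
    fix x e :: real assume x: "x \<in> {s..t}" and "e > 0"
    then obtain \<delta> where d: "0 < \<delta>"
      "\<And>n lo hi. nonoverlapping n lo hi s t \<Longrightarrow> (\<Sum>k<n. hi k - lo k) < \<delta> \<Longrightarrow> var_sum f n lo hi < e/2"
      using abs_cont_onD[OF ac, of "e/2"] by auto
    have key: "\<bar>W v - W u\<bar> < e" if "s \<le> u" "u \<le> v" "v \<le> t" "v - u < \<delta>" for u v
    proof -
      have "W v \<le> W u + e/2"
        unfolding W_def[of v]
      proof (rule cSup_least[OF ne])
        fix y assume "y \<in> S v"
        then obtain n lo hi where y: "y = var_sum f n lo hi" and no: "nonoverlapping n lo hi s v"
          by (auto simp: S_def)
        note c = nonoverlapping_clip[OF no that(1,2)]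
        have "var_sum f n (\<lambda>k. max (lo k) u) (\<lambda>k. max (hi k) u) < e/2"
          using nonoverlapping_length_le[OF c(2)] that by (intro d(2) nonoverlapping_subinterval[OF c(2)]) auto
        then show "y \<le> W u + e/2"
          using var_sum_clip[OF no, of f u] up[OF c(1)] that unfolding y by simp
      qed
      moreover have "0 \<le> W v - W u" using inc[OF that(1-3)] norm_ge_zero order_trans by blast
      ultimately show ?thesis using \<open>e > 0\<close> by linarith
    qed
    show "\<exists>d>0. \<forall>y\<in>{s..t}. dist y x < d \<longrightarrow> dist (W y) (W x) < e"
    proof (intro exI[of _ \<delta>] conjI ballI impI, rule d(1))
      fix y assume "y \<in> {s..t}" "dist y x < \<delta>"
      then show "dist (W y) (W x) < e"
        using key[of x y] key[of y x] x by (cases "x \<le> y") (auto simp: dist_real_def abs_minus_commute)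
    qed
  qed
  show ?thesis using that cont inc by blast
qed

section \<open>Monotone functions are differentiable almost everywhere\<close>

text \<open>Intervals with \<open>x\<close> in their interior replace the one-sided quotients of the
  Dini derivatives. The set is then a countable intersection of unions of open intervals, hence
  Borel for every \<open>Q\<close>, and \<open>Q\<close> supplies a fine cover of it.\<close>

definition straddled :: "(real \<Rightarrow> real \<Rightarrow> bool) \<Rightarrow> real set" where
  "straddled Q = {x. \<forall>d>0. \<exists>u v. u < x \<and> x < v \<and> v - u < d \<and> Q u v}"

abbreviation lower_straddle :: "(real \<Rightarrow> real) \<Rightarrow> real \<Rightarrow> real set" where
  "lower_straddle F p \<equiv> straddled (\<lambda>u v. F v - F u < p * (v - u))"

abbreviation upper_straddle :: "(real \<Rightarrow> real) \<Rightarrow> real \<Rightarrow> real set" where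
  "upper_straddle F q \<equiv> straddled (\<lambda>u v. q * (v - u) < F v - F u)"

lemma straddled_mono: "(\<And>u v. u < v \<Longrightarrow> Q u v \<Longrightarrow> Q' u v) \<Longrightarrow> straddled Q \<subseteq> straddled Q'"
  unfolding straddled_def by (smt (verit) Collect_mono order_less_trans)

lemma upper_straddle_antimono: "q' \<le> q \<Longrightarrow> upper_straddle F q \<subseteq> upper_straddle F q'"
  by (rule straddled_mono) (meson diff_ge_0_iff_ge less_imp_le mult_right_mono order_le_less_trans)

lemma lower_straddle_mono: "p \<le> p' \<Longrightarrow> lower_straddle F p \<subseteq> lower_straddle F p'"
  by (rule straddled_mono) (meson diff_ge_0_iff_ge less_imp_le mult_right_mono order_less_le_trans)

lemma borel_straddle_set: "straddled Q \<in> sets borel"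
proof -
  have eq: "straddled Q =
    (\<Inter>n. \<Union>(u,v)\<in>{(u,v). v - u < inverse (real (Suc n)) \<and> Q u v}. {u<..<v})" (is "?L = ?R")
  proof (intro set_eqI iffI)
    fix x assume x: "x \<in> ?L"
    show "x \<in> ?R"
    proof
      fix n :: nat
      have "0 < inverse (real (Suc n))" by simp
      then obtain u v where "u < x" "x < v" "v - u < inverse (real (Suc n))" "Q u v" using x unfolding straddled_def by blast
      then show "x \<in> (\<Union>(u,v)\<in>{(u,v). v - u < inverse (real (Suc n)) \<and> Q u v}. {u<..<v})" by force
    qed
  next
    fix x assume x: "x \<in> ?R"
    show "x \<in> ?L" unfolding straddled_def
    proof (intro CollectI allI impI)
      fix d :: real assume "d > 0"
      then obtain n where n: "inverse (real (Suc n)) < d" using reals_Archimedean by blast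
      from x have "x \<in> (\<Union>(u,v)\<in>{(u,v). v - u < inverse (real (Suc n)) \<and> Q u v}. {u<..<v})" by blast
      then obtain u v where "u < x" "x < v" "v - u < inverse (real (Suc n))" "Q u v" by auto
      then show "\<exists>u v. u < x \<and> x < v \<and> v - u < d \<and> Q u v" using n by (intro exI[of _ u] exI[of _ v]) auto
    qed
  qed
  show ?thesis unfolding eq
    by (intro borel_open borel_closed sets.countable_INT'' ) (auto intro!: borel_open open_UN)
qed

lemma straddle_Vitali:
  fixes Q :: "real \<Rightarrow> real \<Rightarrow> bool"
  assumes "open G" "E \<subseteq> G"
    and E: "\<And>x d. x \<in> E \<Longrightarrow> 0 < d \<Longrightarrow> \<exists>u v. u < x \<and> x < v \<and> v - u < d \<and> Q u v"
  obtains C where "countable C" "\<And>u v. (u, v) \<in> C \<Longrightarrow> u < v \<and> {u<..<v} \<subseteq> G \<and> Q u v"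
    "disjoint_family_on (\<lambda>(u,v). {u<..<v}) C" "negligible (E - (\<Union>(u,v)\<in>C. {u<..<v}))"
proof -
  define K where "K = {(u,v). u < v \<and> {u<..<v} \<subseteq> G \<and> Q u v}"
  have ball: "ball ((fst i + snd i)/2) ((snd i - fst i)/2) = {fst i<..<snd i}" for i :: "real \<times> real"
    by (auto simp: ball_def dist_real_def abs_if field_simps split: if_splits)
  have *: "\<exists>i. i \<in> K \<and> x \<in> ball ((fst i + snd i)/2) ((snd i - fst i)/2) \<and> (snd i - fst i)/2 < d"
    if x: "x \<in> E" and "0 < d" for x d
  proof -
    obtain e where e: "e > 0" "ball x e \<subseteq> G" using assms x unfolding open_contains_ball by blast
    obtain u v where uv: "u < x" "x < v" "v - u < min d e" "Q u v" using E[OF x, of "min d e"] e \<open>0 < d\<close> by auto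
    have "{u<..<v} \<subseteq> ball x e" using uv by (auto simp: ball_def dist_real_def)
    then have "(u,v) \<in> K" unfolding K_def using uv e by auto
    then show ?thesis using uv ball[of "(u,v)"] by (intro exI[of _ "(u,v)"]) auto
  qed
  from Vitali_covering_theorem_balls[of E K, OF *]
  obtain C where C: "countable C" "C \<subseteq> K"
     "pairwise (\<lambda>i j. disjnt (ball ((fst i + snd i)/2) ((snd i - fst i)/2)) (ball ((fst j + snd j)/2) ((snd j - fst j)/2))) C"
     "negligible(E - (\<Union>i \<in> C. ball ((fst i + snd i)/2) ((snd i - fst i)/2)))" by blast
  show ?thesis
  proof (rule that[OF C(1)])
    show "\<And>u v. (u, v) \<in> C \<Longrightarrow> u < v \<and> {u<..<v} \<subseteq> G \<and> Q u v" using C(2) unfolding K_def by auto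
    show "disjoint_family_on (\<lambda>(u,v). {u<..<v}) C"
      using C(3) unfolding disjoint_family_on_def pairwise_def disjnt_def ball by (auto simp: case_prod_beta)
    show "negligible (E - (\<Union>(u,v)\<in>C. {u<..<v}))"
      using C(4) unfolding ball by (simp add: case_prod_beta)
  qed
qed

text \<open>Continuity leaves \<open>interval_measure F\<close> without atoms, so open and closed
  intervals both have measure equal to the increment of \<open>F\<close>. Differentiability of
  \<open>F\<close> becomes a comparison of this measure with Lebesgue measure.\<close>

locale mono_continuous =
  fixes F :: "real \<Rightarrow> real"
  assumes mono: "\<And>x y. x \<le> y \<Longrightarrow> F x \<le> F y" and cont: "continuous_on UNIV F"
begin

abbreviation "\<mu> \<equiv> interval_measure F"

lemma emeasure_Ioo: "u < v \<Longrightarrow> emeasure \<mu> {u<..<v} = ennreal (F v - F u)"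
proof -
  assume uv: "u < v"
  have pt: "emeasure \<mu> {x} = 0" for x
    using emeasure_interval_measure_Icc[of x x F] mono cont by simp
  have "{u..v} = {u<..<v} \<union> ({u} \<union> {v})" using uv by auto
  moreover have "emeasure \<mu> ({u<..<v} \<union> ({u} \<union> {v})) = emeasure \<mu> {u<..<v}"
    by (intro emeasure_Un_null_set null_sets.Un) (auto simp: null_sets_def pt)
  ultimately show ?thesis
    using emeasure_interval_measure_Icc[of u v F] mono cont uv by simp
qed

text \<open>The inequality q |I| <= \<open>\<mu>\<close> I is summed over the disjoint Vitali
  intervals, which cover \<open>E\<close> up to a Lebesgue null set.\<close>

lemma upper_straddle_measure:
  assumes "open G" "E \<subseteq> G" "E \<in> sets borel" "E \<subseteq> upper_straddle F q" "0 \<le> q"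
  shows "ennreal q * emeasure lborel E \<le> emeasure \<mu> G"
proof -
  obtain C where C: "countable C" "\<And>u v. (u, v) \<in> C \<Longrightarrow> u < v \<and> {u<..<v} \<subseteq> G \<and> q * (v - u) < F v - F u"
    "disjoint_family_on (\<lambda>(u,v). {u<..<v}) C" "negligible (E - (\<Union>(u,v)\<in>C. {u<..<v}))"
    by (rule straddle_Vitali[OF assms(1,2), where Q="\<lambda>u v. q * (v - u) < F v - F u"])
      (use assms(4) in \<open>auto simp: straddled_def\<close>)
  define H where "H = (\<Union>(u,v)\<in>C. {u<..<v})"
  have Hb: "H \<in> sets borel" unfolding H_def by (intro borel_open open_UN) auto
  have "emeasure lborel E \<le> emeasure lborel (H \<union> (E - H))"
    using Hb assms(3) by (intro emeasure_mono) auto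
  also have "\<dots> = emeasure lborel H"
  proof (rule emeasure_Un_null_set)
    have "E - H \<in> null_sets lebesgue" using C(4) unfolding negligible_iff_null_sets H_def .
    then show "E - H \<in> null_sets lborel" using Hb assms(3)
      by (auto simp: null_sets_def)
  qed (use Hb in auto)
  finally have "ennreal q * emeasure lborel E \<le> ennreal q * emeasure lborel H"
    by (intro mult_left_mono) auto
  also have "\<dots> = (\<integral>\<^sup>+i. ennreal q * emeasure lborel (case i of (u,v) \<Rightarrow> {u<..<v}) \<partial>count_space C)"
    unfolding H_def using C by (subst emeasure_UN_countable) (auto simp: nn_integral_cmult)
  also have "\<dots> \<le> (\<integral>\<^sup>+i. emeasure \<mu> (case i of (u,v) \<Rightarrow> {u<..<v}) \<partial>count_space C)"
  proof (intro nn_integral_mono)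
    fix i assume "i \<in> space (count_space C)"
    then show "ennreal q * emeasure lborel (case i of (u,v) \<Rightarrow> {u<..<v}) \<le> emeasure \<mu> (case i of (u,v) \<Rightarrow> {u<..<v})"
      using C(2)[of "fst i" "snd i"] \<open>0 \<le> q\<close>
      by (auto simp: emeasure_Ioo ennreal_mult[symmetric] intro!: ennreal_leI split: prod.splits)
  qed
  also have "\<dots> = emeasure \<mu> H"
    unfolding H_def using C by (subst emeasure_UN_countable) auto
  also have "\<dots> \<le> emeasure \<mu> G" 
    using C(2) assms(1) unfolding H_def by (intro emeasure_mono) auto
  finally show ?thesis .
qed

text \<open>The bound concerns \<open>H\<close>, the union of the Vitali intervals, and not
  \<open>E\<close>: the remainder \<open>E - H\<close> is null for Lebesgue measure but could carry
  mass of \<open>\<mu>\<close>.\<close>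

lemma lower_straddle_measure:
  assumes "open G" "E \<subseteq> G" "E \<in> sets borel" "E \<subseteq> lower_straddle F p" "0 \<le> p"
  obtains H where "open H" "H \<subseteq> G" "E - H \<in> null_sets lborel"
    "emeasure \<mu> H \<le> ennreal p * emeasure lborel G"
proof -
  obtain C where C: "countable C" "\<And>u v. (u, v) \<in> C \<Longrightarrow> u < v \<and> {u<..<v} \<subseteq> G \<and> F v - F u < p * (v - u)"
    "disjoint_family_on (\<lambda>(u,v). {u<..<v}) C" "negligible (E - (\<Union>(u,v)\<in>C. {u<..<v}))"
    by (rule straddle_Vitali[OF assms(1,2), where Q="\<lambda>u v. F v - F u < p * (v - u)"])
      (use assms(4) in \<open>auto simp: straddled_def\<close>)
  define H where "H = (\<Union>(u,v)\<in>C. {u<..<v})"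
  have Ho: "open H" unfolding H_def by (intro open_UN) auto
  have "emeasure \<mu> H = (\<integral>\<^sup>+i. emeasure \<mu> (case i of (u,v) \<Rightarrow> {u<..<v}) \<partial>count_space C)"
    unfolding H_def using C by (subst emeasure_UN_countable) auto
  also have "\<dots> \<le> (\<integral>\<^sup>+i. ennreal p * emeasure lborel (case i of (u,v) \<Rightarrow> {u<..<v}) \<partial>count_space C)"
  proof (intro nn_integral_mono)
    fix i assume "i \<in> space (count_space C)"
    then show "emeasure \<mu> (case i of (u,v) \<Rightarrow> {u<..<v}) \<le> ennreal p * emeasure lborel (case i of (u,v) \<Rightarrow> {u<..<v})"
      using C(2)[of "fst i" "snd i"] \<open>0 \<le> p\<close>
      by (auto simp: emeasure_Ioo ennreal_mult[symmetric] intro!: ennreal_leI split: prod.splits)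
  qed
  also have "\<dots> = ennreal p * emeasure lborel H"
    unfolding H_def using C by (subst emeasure_UN_countable) (auto simp: nn_integral_cmult)
  also have "\<dots> \<le> ennreal p * emeasure lborel G" 
    using C(2) assms(1) unfolding H_def by (intro mult_left_mono emeasure_mono) auto
  finally have 1: "emeasure \<mu> H \<le> ennreal p * emeasure lborel G" .
  have "E - H \<in> null_sets lebesgue" using C(4) unfolding negligible_iff_null_sets H_def .
  then have "E - H \<in> null_sets lborel" using Ho assms(3)
    by (auto simp: null_sets_def)
  moreover have "H \<subseteq> G" using C(2) unfolding H_def by auto
  ultimately show ?thesis using 1 Ho that by blast
qed

text \<open>With \<open>H\<close> from the lower estimate and the upper estimate applied to
  \<open>E \<inter> H\<close>, q |E| = q |E \<inter> H| <= \<open>\<mu>\<close> H <= p |G| <= p (|E|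
  + e) for every e > 0. Since p < q and the cut-off at \<open>n\<close> makes |E| finite, |E| =
  0.\<close>

lemma straddle_gap_null:
  assumes pq: "0 \<le> p" "p < q"
  shows "lower_straddle F p \<inter> upper_straddle F q \<inter> {- real n<..<real n} \<in> null_sets lborel"
proof -
  define E where "E = lower_straddle F p \<inter> upper_straddle F q \<inter> {- real n<..<real n}"
  have Eb: "E \<in> sets borel"
    unfolding E_def by (intro sets.Int borel_straddle_set) auto
  have fin: "emeasure lborel E < \<infinity>"
    by (rule le_less_trans[OF emeasure_mono[of E "{- real n..real n}"]]) (auto simp: E_def)
  have "ennreal q * emeasure lborel E \<le> ennreal p * (emeasure lborel E + ennreal e)" if "e > 0" for e
  proof -
    obtain G where G: "open G" "E \<subseteq> G" "emeasure lborel (G - E) < e"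
      using outer_regular_lborel[OF Eb \<open>e > 0\<close>] by blast
    obtain H where H: "open H" "H \<subseteq> G" "E - H \<in> null_sets lborel"
      "emeasure \<mu> H \<le> ennreal p * emeasure lborel G"
      by (rule lower_straddle_measure[OF G(1,2) Eb _ pq(1)]) (auto simp: E_def)
    have "emeasure lborel E \<le> emeasure lborel ((E \<inter> H) \<union> (E - H))"
      by (intro emeasure_mono) (use Eb H(1) in auto)
    also have "\<dots> = emeasure lborel (E \<inter> H)"
      by (rule emeasure_Un_null_set) (use H Eb in auto)
    finally have "ennreal q * emeasure lborel E \<le> ennreal q * emeasure lborel (E \<inter> H)"
      by (intro mult_left_mono) auto
    also have "\<dots> \<le> emeasure \<mu> H"
      by (rule upper_straddle_measure[OF H(1)]) (use H(1) Eb pq in \<open>auto simp: E_def\<close>)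
    also have "\<dots> \<le> ennreal p * emeasure lborel G" by fact
    also have "emeasure lborel G \<le> emeasure lborel (E \<union> (G - E))"
      using G(2) by (intro emeasure_mono) (use Eb G(1) in auto)
    also have "\<dots> \<le> emeasure lborel E + emeasure lborel (G - E)"
      by (intro emeasure_subadditive) (use Eb G(1) in auto)
    also have "\<dots> \<le> emeasure lborel E + ennreal e" using G(3) by (intro add_left_mono) auto
    finally show ?thesis by (simp add: mult_left_mono)
  qed
  moreover obtain x where x: "emeasure lborel E = ennreal x" "0 \<le> x"
    using fin by (metis ennreal_cases infinity_ennreal_def less_irrefl)
  ultimately have *: "q * x \<le> p * (x + e)" if "e > 0" for e
    using that[THEN less_imp_le] pq that by (simp add: ennreal_mult[symmetric] ennreal_plus[symmetric] del: ennreal_plus)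
  have "x = 0"
  proof (rule ccontr)
    assume "x \<noteq> 0"
    then have "0 < (q - p) * x" using x pq by simp
    \<comment> \<open>This \<open>e\<close> makes the error p e at most half of (q - p) x; the
      denominator p + 1 stays positive when p = 0.\<close>
    moreover have "(q - p) * x \<le> p * ((q - p) * x / (2 * (p + 1)))"
      using *[of "(q - p) * x / (2 * (p + 1))"] calculation pq by (simp add: algebra_simps)
    moreover have "p * ((q - p) * x / (2 * (p + 1))) = (p / (p + 1)) * ((q - p) * x / 2)" by simp
    moreover have "(p / (p + 1)) * ((q - p) * x / 2) \<le> 1 * ((q - p) * x / 2)"
      using calculation(1) pq by (intro mult_right_mono) auto
    ultimately show False by linarith
  qed
  then show ?thesis using x Eb unfolding E_def[symmetric] by (auto simp: null_sets_def)
qed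

text \<open>The upper estimate on the whole interval gives q |E| <= F n - F (- n) for every natural
  number q, which forces |E| = 0.\<close>

lemma upper_straddle_infinite_null:
  "(\<Inter>q\<in>{0..}. upper_straddle F q) \<inter> {- real n<..<real n} \<in> null_sets lborel"
proof -
  define E where "E = (\<Inter>q::nat. upper_straddle F q) \<inter> {- real n<..<real n}"
  have Eb: "E \<in> sets borel"
    unfolding E_def by (intro sets.Int sets.countable_INT'' borel_straddle_set) auto
  have "emeasure lborel E = 0"
  proof (cases "n = 0")
    case False
    define x where "x = measure lborel E"
    have "emeasure lborel E \<le> emeasure lborel {- real n..real n}"
      by (intro emeasure_mono) (auto simp: E_def)
    then have x: "emeasure lborel E = ennreal x" "0 \<le> x" unfolding x_def
      by (auto intro!: emeasure_eq_ennreal_measure simp: top_unique)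
    have "real q * x \<le> F n - F (-n)" for q :: nat
    proof -
      have "ennreal q * emeasure lborel E \<le> emeasure \<mu> {- real n<..<real n}"
        by (rule upper_straddle_measure) (use Eb in \<open>auto simp: E_def\<close>)
      then show ?thesis using x False mono[of "-real n" "real n"] by (simp add: emeasure_Ioo ennreal_mult[symmetric])
    qed
    then have "x = 0" using x(2) reals_Archimedean3[of x] by (metis less_eq_real_def linorder_not_less)
    then show ?thesis using x by simp
  qed (simp add: E_def)
  then have "E \<in> null_sets lborel" using Eb by auto
  moreover have "(\<Inter>q\<in>{0..}. upper_straddle F q) \<inter> {- real n<..<real n} \<in> sets lborel"
  proof -
    have "(\<Inter>q\<in>{0..}. upper_straddle F q) \<inter> {- real n<..<real n} = E"
    proof
      show "E \<subseteq> (\<Inter>q\<in>{0..}. upper_straddle F q) \<inter> {- real n<..<real n}"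
      proof
        fix x assume x: "x \<in> E"
        have "x \<in> upper_straddle F q" for q
        proof -
          obtain k :: nat where "q \<le> k" using real_arch_simple by blast
          then show ?thesis using upper_straddle_antimono[of q k F] x by (auto simp: E_def)
        qed
        then show "x \<in> (\<Inter>q\<in>{0..}. upper_straddle F q) \<inter> {- real n<..<real n}" using x by (auto simp: E_def)
      qed
    qed (auto simp: E_def)
    then show ?thesis using Eb by simp
  qed
  ultimately show ?thesis
    by (rule null_sets_subset) (auto simp: E_def)
qed

text \<open>The derivative is the infimum \<open>D\<close> of the slopes \<open>q\<close> with
  \<open>x\<close> outside \<open>upper_straddle F q\<close>. A slope below \<open>D\<close> that is
  straddled from below would leave room for two rationals violating \<open>gap\<close>. So quotients
  over short intervals around \<open>x\<close> are close to \<open>D\<close>; moving one endpoint to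
  \<open>x\<close>, by continuity of \<open>F\<close>, turns them into difference quotients at
  \<open>x\<close>.\<close>

lemma has_derivative_if_no_straddle:
  assumes fin: "x \<notin> (\<Inter>q\<in>{0..}. upper_straddle F q)"
    and gap: "\<And>p q. p \<in> \<rat> \<Longrightarrow> q \<in> \<rat> \<Longrightarrow> 0 \<le> p \<Longrightarrow> p < q \<Longrightarrow> x \<notin> lower_straddle F p \<inter> upper_straddle F q"
  shows "\<exists>D. (F has_real_derivative D) (at x)"
proof -
  define S where "S = {q. x \<notin> upper_straddle F q}"
  define D where "D = Inf S"
  have ne: "S \<noteq> {}" using fin unfolding S_def by auto
  have pos: "0 \<le> q" if "q \<in> S" for q
  proof (rule ccontr)
    assume "\<not> 0 \<le> q"
    have "x \<in> upper_straddle F q" unfolding straddled_def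
    proof (intro CollectI allI impI)
      fix d :: real assume "d > 0"
      then have "q * ((x + d/3) - (x - d/3)) < 0" "F (x - d/3) \<le> F (x + d/3)"
        using mono[of "x - d/3" "x + d/3"] \<open>\<not> 0 \<le> q\<close> by (intro mult_neg_pos, auto)
      then have "q * ((x + d/3) - (x - d/3)) < F (x + d/3) - F (x - d/3)" by linarith
      then show "\<exists>u v. u < x \<and> x < v \<and> v - u < d \<and> q * (v - u) < F v - F u"
        using \<open>d > 0\<close> by (intro exI[of _ "x - d/3"] exI[of _ "x + d/3"] conjI) linarith+
    qed
    then show False using that unfolding S_def by simp
  qed
  have bdd: "bdd_below S" using pos by (intro bdd_belowI[of _ 0])
  note upmono = upper_straddle_antimono[of _ _ F] and lomono = lower_straddle_mono[of _ _ F]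
  have up: "x \<notin> upper_straddle F q" if "D < q" for q
  proof -
    obtain q' where "q' \<in> S" "q' < q" using \<open>D < q\<close> ne bdd unfolding D_def by (meson cInf_lessD)
    then show ?thesis using upmono[of q' q] unfolding S_def by auto
  qed
  have lo: "x \<notin> lower_straddle F p" if "p < D" for p
  proof
    assume x: "x \<in> lower_straddle F p"
    have "0 \<le> p"
    proof (rule ccontr)
      assume "\<not> 0 \<le> p"
      obtain u v where "u < x" "x < v" "F v - F u < p * (v - u)"
        using x unfolding straddled_def by (auto dest: spec[of _ 1])
      then show False using mono[of u v] mult_neg_pos[of p "v - u"] \<open>\<not> 0 \<le> p\<close> by auto
    qed
    obtain p' where p': "p' \<in> \<rat>" "p < p'" "p' < D" using Rats_dense_in_real[OF \<open>p < D\<close>] by blast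
    obtain q' where q': "q' \<in> \<rat>" "p' < q'" "q' < D" using Rats_dense_in_real[OF p'(3)] by blast
    have "q' \<notin> S" using q'(3) cInf_lower[OF _ bdd, of q'] unfolding D_def by auto
    then show False using gap[OF p'(1) q'(1) _ q'(2)] lomono[of p p'] p' x \<open>0 \<le> p\<close> unfolding S_def by auto
  qed
  have key: "\<exists>d>0. \<forall>u v. u \<le> x \<and> x \<le> v \<and> v - u < d \<longrightarrow> \<bar>F v - F u - D * (v - u)\<bar> \<le> e * (v - u)" if "e > 0" for e
  proof -
    obtain d1 where d1: "d1 > 0" "\<And>u v. u < x \<Longrightarrow> x < v \<Longrightarrow> v - u < d1 \<Longrightarrow> F v - F u \<le> (D + e) * (v - u)"
      using up[of "D + e"] \<open>e > 0\<close> unfolding straddled_def mem_Collect_eq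
      by (metis less_add_same_cancel1 not_le)
    obtain d2 where d2: "d2 > 0" "\<And>u v. u < x \<Longrightarrow> x < v \<Longrightarrow> v - u < d2 \<Longrightarrow> (D - e) * (v - u) \<le> F v - F u"
      using lo[of "D - e"] \<open>e > 0\<close> unfolding straddled_def mem_Collect_eq
      by (metis diff_less_eq less_add_same_cancel1 not_le)
    define d where "d = min d1 d2"
    have A: "\<bar>F v - F u - D * (v - u)\<bar> \<le> e * (v - u)" if "u < x" "x < v" "v - u < d" for u v
      using d1(2)[of u v] d2(2)[of u v] that unfolding d_def by (auto simp: algebra_simps abs_le_iff)
    have cF: "(F \<longlongrightarrow> F x) (at x within T)" for T
      using cont by (meson UNIV_I continuous_on_def continuous_on_subset tendsto_within_subset subset_UNIV)
    have B: "\<bar>F v - F u - D * (v - u)\<bar> \<le> e * (v - u)" if "u \<le> x" "x < v" "v - u < d" for u v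
    proof (cases "u = x")
      case True
      have "((\<lambda>y. e * (v - y) - \<bar>F v - F y - D * (v - y)\<bar>) \<longlongrightarrow> e * (v - x) - \<bar>F v - F x - D * (v - x)\<bar>) (at_left x)"
        by (intro tendsto_intros cF)
      moreover have "eventually (\<lambda>y. 0 \<le> e * (v - y) - \<bar>F v - F y - D * (v - y)\<bar>) (at_left x)"
        unfolding eventually_at_left_field
        using that True by (intro exI[of _ "v - d"]) (auto intro!: A)
      ultimately have "0 \<le> e * (v - x) - \<bar>F v - F x - D * (v - x)\<bar>"
        by (rule tendsto_lowerbound) simp
      then show ?thesis using True by simp
    qed (use A that in auto)
    have C: "\<bar>F v - F u - D * (v - u)\<bar> \<le> e * (v - u)" if "u < x" "x \<le> v" "v - u < d" for u v
    proof (cases "v = x")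
      case True
      have "((\<lambda>y. e * (y - u) - \<bar>F y - F u - D * (y - u)\<bar>) \<longlongrightarrow> e * (x - u) - \<bar>F x - F u - D * (x - u)\<bar>) (at_right x)"
        by (intro tendsto_intros cF)
      moreover have "eventually (\<lambda>y. 0 \<le> e * (y - u) - \<bar>F y - F u - D * (y - u)\<bar>) (at_right x)"
        unfolding eventually_at_right_field
        using that True by (intro exI[of _ "u + d"]) (auto intro!: A)
      ultimately have "0 \<le> e * (x - u) - \<bar>F x - F u - D * (x - u)\<bar>"
        by (rule tendsto_lowerbound) simp
      then show ?thesis using True by simp
    qed (use A that in auto)
    have "d > 0" using d1 d2 unfolding d_def by auto
    moreover have "\<bar>F v - F u - D * (v - u)\<bar> \<le> e * (v - u)" if uv: "u \<le> x" "x \<le> v" "v - u < d" for u v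
    proof -
      consider "u < x" | "x < v" | "u = v" using uv by linarith
      then show ?thesis using B[of u v] C[of u v] uv by cases auto
    qed
    ultimately show ?thesis by blast
  qed
  have "(F has_derivative (*) D) (at x)"
    unfolding has_derivative_at_alt
  proof (intro conjI allI impI)
    fix e :: real assume "e > 0"
    then obtain d where d: "d > 0" "\<And>u v. u \<le> x \<Longrightarrow> x \<le> v \<Longrightarrow> v - u < d \<Longrightarrow> \<bar>F v - F u - D * (v - u)\<bar> \<le> e * (v - u)"
      using key by meson
    show "\<exists>d>0. \<forall>y. norm (y - x) < d \<longrightarrow> norm (F y - F x - D * (y - x)) \<le> e * norm (y - x)"
    proof (intro exI[of _ d] conjI allI impI, rule d(1))
      fix y assume "norm (y - x) < d"
      then show "norm (F y - F x - D * (y - x)) \<le> e * norm (y - x)"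
        using d(2)[of x y] d(2)[of y x] by (cases "x \<le> y") (auto simp: algebra_simps abs_if split: if_splits)
    qed
  qed (simp add: bounded_linear_mult_right)
  then show ?thesis unfolding has_field_derivative_def by blast
qed

lemma differentiable_ae: "negligible {x. \<not> (\<exists>D. (F has_real_derivative D) (at x))}"
proof -
  define A where "A n = (\<Inter>q\<in>{0..}. upper_straddle F q) \<inter> {- real n<..<real n}" for n
  define B where "B n = (\<Union>p\<in>\<rat> \<inter> {0..}. \<Union>q\<in>\<rat> \<inter> {p<..}.
     lower_straddle F p \<inter> upper_straddle F q \<inter> {- real n<..<real n})" for n
  have "(\<Union>n. A n \<union> B n) \<in> null_sets lborel"
    unfolding A_def B_def
    by (intro null_sets_UN null_sets.Un null_sets_UN' upper_straddle_infinite_null straddle_gap_null)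
      (auto intro: countable_subset[OF _ countable_rat])
  then have "negligible (\<Union>n. A n \<union> B n)"
    by (simp add: negligible_iff_null_sets null_sets_completionI)
  moreover have "{x. \<not> (\<exists>D. (F has_real_derivative D) (at x))} \<subseteq> (\<Union>n. A n \<union> B n)"
  proof
    fix x assume "x \<in> {x. \<not> (\<exists>D. (F has_real_derivative D) (at x))}"
    then have c: "x \<in> (\<Inter>q\<in>{0..}. upper_straddle F q) \<or>
       (\<exists>p q. p \<in> \<rat> \<and> q \<in> \<rat> \<and> 0 \<le> p \<and> p < q \<and> x \<in> lower_straddle F p \<inter> upper_straddle F q)"
      using has_derivative_if_no_straddle by blast
    obtain n :: nat where "\<bar>x\<bar> < n" using reals_Archimedean2 by blast
    then have n: "x \<in> {- real n<..<real n}" by auto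
    from c have "x \<in> A n \<union> B n"
    proof
      assume "\<exists>p q. p \<in> \<rat> \<and> q \<in> \<rat> \<and> 0 \<le> p \<and> p < q \<and> x \<in> lower_straddle F p \<inter> upper_straddle F q"
      then obtain p q where "p \<in> \<rat> \<inter> {0..}" "q \<in> \<rat> \<inter> {p<..}" "x \<in> lower_straddle F p \<inter> upper_straddle F q" by auto
      then have "x \<in> B n" unfolding B_def using n by blast
      then show ?thesis by blast
    qed (use n in \<open>auto simp: A_def\<close>)
    then show "x \<in> (\<Union>n. A n \<union> B n)" by blast
  qed
  ultimately show ?thesis using negligible_subset by blast
qed

end

section \<open>The fundamental theorem of calculus for absolutely continuous curves\<close>

text \<open>Jordan decomposition f = W - (W - f) with both terms monotone and continuous.
  Composition with the clamp \<open>c\<close> extends them to the whole line and changes nothing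
  inside the interval.\<close>

lemma abs_cont_on_real_differentiable_ae:
  fixes f :: "real \<Rightarrow> real"
  assumes ac: "abs_cont_on f s t" and st: "s < t"
  shows "negligible {x \<in> {s<..<t}. \<not> (\<exists>D. (f has_real_derivative D) (at x))}"
proof -
  obtain W where W: "continuous_on {s..t} W"
    "\<And>u v. s \<le> u \<Longrightarrow> u \<le> v \<Longrightarrow> v \<le> t \<Longrightarrow> norm (f v - f u) \<le> W v - W u"
    using abs_cont_on_continuous_majorant[OF ac] st by (metis less_imp_le)
  have cf: "continuous_on {s..t} f"
    unfolding continuous_on_iff
  proof (intro ballI allI impI)
    fix x e :: real assume x: "x \<in> {s..t}" and "e > 0"
    then obtain d where d: "d > 0" "\<And>y. y \<in> {s..t} \<Longrightarrow> dist y x < d \<Longrightarrow> dist (W y) (W x) < e"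
      using W(1) unfolding continuous_on_iff by metis
    have "dist (f y) (f x) < e" if y: "y \<in> {s..t}" "dist y x < d" for y
    proof (cases "x \<le> y")
      case True
      then show ?thesis using W(2)[of x y] d(2)[OF y] x y by (auto simp: dist_real_def)
    next
      case False
      then show ?thesis using W(2)[of y x] d(2)[OF y] x y by (auto simp: dist_real_def)
    qed
    then show "\<exists>d>0. \<forall>y\<in>{s..t}. dist y x < d \<longrightarrow> dist (f y) (f x) < e" using d(1) by blast
  qed
  define c where "c x = max s (min x t)" for x
  have c: "c x \<in> {s..t}" "x \<le> y \<Longrightarrow> c x \<le> c y" for x y using st by (auto simp: c_def)
  have cc: "continuous_on UNIV c" unfolding c_def by (intro continuous_intros)
  have comp: "continuous_on UNIV (\<lambda>x. h (c x))" if "continuous_on {s..t} h" for h :: "real \<Rightarrow> real"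
    by (rule continuous_on_compose2[OF that cc]) (use c in auto)
  interpret F1: mono_continuous "\<lambda>x. W (c x)"
  proof
    fix x y :: real assume "x \<le> y"
    then have "norm (f (c y) - f (c x)) \<le> W (c y) - W (c x)" using W(2)[of "c x" "c y"] c(1)[of x] c(1)[of y] c(2)[of x y]
      by auto
    then show "W (c x) \<le> W (c y)" using norm_ge_zero[of "f (c y) - f (c x)"] by linarith
  qed (rule comp[OF W(1)])
  interpret F2: mono_continuous "\<lambda>x. W (c x) - f (c x)"
  proof
    fix x y :: real assume "x \<le> y"
    then have "norm (f (c y) - f (c x)) \<le> W (c y) - W (c x)" using W(2)[of "c x" "c y"] c(1)[of x] c(1)[of y] c(2)[of x y]
      by auto
    then show "W (c x) - f (c x) \<le> W (c y) - f (c y)" by (simp add: abs_le_iff)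
  qed (intro continuous_intros comp W cf)
  have "{x \<in> {s<..<t}. \<not> (\<exists>D. (f has_real_derivative D) (at x))} \<subseteq>
      {x. \<not> (\<exists>D. ((\<lambda>x. W (c x)) has_real_derivative D) (at x))} \<union>
      {x. \<not> (\<exists>D. ((\<lambda>x. W (c x) - f (c x)) has_real_derivative D) (at x))}"
  proof (rule subsetI, rule ccontr)
    fix x assume x: "x \<in> {x \<in> {s<..<t}. \<not> (\<exists>D. (f has_real_derivative D) (at x))}"
      and "x \<notin> {x. \<not> (\<exists>D. ((\<lambda>x. W (c x)) has_real_derivative D) (at x))} \<union>
      {x. \<not> (\<exists>D. ((\<lambda>x. W (c x) - f (c x)) has_real_derivative D) (at x))}"
    then obtain D1 D2 where "((\<lambda>x. W (c x)) has_real_derivative D1) (at x)"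
      "((\<lambda>x. W (c x) - f (c x)) has_real_derivative D2) (at x)" by auto
    from DERIV_diff[OF this] have "((\<lambda>x. f (c x)) has_real_derivative (D1 - D2)) (at x)" by simp
    then have "(f has_real_derivative (D1 - D2)) (at x)"
      by (rule has_field_derivative_transform_within_open[of _ _ _ "{s<..<t}"]) (use x in \<open>auto simp: c_def\<close>)
    then show False using x by blast
  qed
  then show ?thesis
    using negligible_subset[OF negligible_Un[OF F1.differentiable_ae F2.differentiable_ae]] by blast
qed

text \<open>The common source of the closure properties: increments of \<open>g\<close> are
  controlled by those of \<open>f\<close>, and the extra term \<open>v - u\<close> admits Lipschitz
  contributions.\<close>

lemma abs_cont_on_dominated:
  assumes ac: "abs_cont_on f s t"
    and le: "\<And>u v. s \<le> u \<Longrightarrow> u \<le> v \<Longrightarrow> v \<le> t \<Longrightarrow> norm (g v - g u) \<le> C * ((v - u) + norm (f v - f u))"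
  shows "abs_cont_on g s t"
  unfolding abs_cont_on_iff
proof (intro allI impI)
  fix e :: real assume "e > 0"
  define C' where "C' = \<bar>C\<bar> + 1"
  have C': "C' > 0" "C \<le> C'" unfolding C'_def by auto
  obtain d where d: "d > 0" "\<And>n lo hi. nonoverlapping n lo hi s t \<Longrightarrow> (\<Sum>k<n. hi k - lo k) < d \<Longrightarrow> var_sum f n lo hi < e / (2 * C')"
    using abs_cont_onD[OF ac, of "e / (2*C')"] \<open>e > 0\<close> C' by auto
  show "\<exists>\<delta>>0. \<forall>n lo hi. nonoverlapping n lo hi s t \<and> (\<Sum>k<n. hi k - lo k) < \<delta> \<longrightarrow> var_sum g n lo hi < e"
  proof (rule exI[of _ "min d (e / (2*C'))"], intro conjI allI impI)
    show "0 < min d (e / (2*C'))" using d \<open>e > 0\<close> C' by auto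
    fix n lo hi assume *: "nonoverlapping n lo hi s t \<and> (\<Sum>k<n. hi k - lo k) < min d (e / (2*C'))"
    have "var_sum g n lo hi \<le> (\<Sum>k<n. C' * ((hi k - lo k) + norm (f (hi k) - f (lo k))))"
      unfolding var_sum_def
    proof (rule sum_mono)
      fix k assume "k \<in> {..<n}"
      then have k: "s \<le> lo k" "lo k \<le> hi k" "hi k \<le> t" using * unfolding nonoverlapping_def by auto
      have "C * ((hi k - lo k) + norm (f (hi k) - f (lo k))) \<le> C' * ((hi k - lo k) + norm (f (hi k) - f (lo k)))"
        using C' k by (intro mult_right_mono) auto
      then show "norm (g (hi k) - g (lo k)) \<le> C' * ((hi k - lo k) + norm (f (hi k) - f (lo k)))"
        using le[OF k] by linarith
    qed
    also have "\<dots> = C' * ((\<Sum>k<n. hi k - lo k) + var_sum f n lo hi)"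
      unfolding var_sum_def by (simp add: sum_distrib_left[symmetric] sum.distrib)
    also have "\<dots> < C' * (e / (2*C') + e / (2*C'))"
      using * d(2)[of n lo hi] C' by (intro mult_strict_left_mono add_strict_mono) auto
    also have "\<dots> = e" using C' by (simp add: field_simps)
    finally show "var_sum g n lo hi < e" .
  qed
qed

lemma lipschitz_abs_cont_on:
  assumes "\<And>u v. s \<le> u \<Longrightarrow> u \<le> v \<Longrightarrow> v \<le> t \<Longrightarrow> norm (g v - g u) \<le> C * (v - u)"
  shows "abs_cont_on g s t"
proof (rule abs_cont_on_dominated[where f="\<lambda>_. 0::real"])
  show "abs_cont_on (\<lambda>_. 0::real) s t" unfolding abs_cont_on_def by (auto intro: exI[of _ 1])
qed (use assms in auto)

lemma abs_cont_on_differentiable_ae: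
  fixes f :: "real \<Rightarrow> 'a::euclidean_space"
  assumes ac: "abs_cont_on f s t" and st: "s < t"
  shows "negligible {x \<in> {s<..<t}. \<not> f differentiable (at x)}"
proof -
  have sub: "{x \<in> {s<..<t}. \<not> f differentiable (at x)} \<subseteq>
     (\<Union>b\<in>Basis. {x \<in> {s<..<t}. \<not> (\<exists>D. ((\<lambda>x. f x \<bullet> b) has_real_derivative D) (at x))})"
  proof (rule subsetI, rule ccontr)
    fix x assume x: "x \<in> {x \<in> {s<..<t}. \<not> f differentiable (at x)}"
      and "x \<notin> (\<Union>b\<in>Basis. {x \<in> {s<..<t}. \<not> (\<exists>D. ((\<lambda>x. f x \<bullet> b) has_real_derivative D) (at x))})"
    then have "\<forall>b\<in>Basis. (\<lambda>x. f x \<bullet> b) differentiable (at x)"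
      using real_differentiable_def by blast
    then have "f differentiable (at x)" using differentiable_componentwise_within[of f x UNIV] by simp
    then show False using x by blast
  qed
  have neg: "negligible {x \<in> {s<..<t}. \<not> (\<exists>D. ((\<lambda>x. f x \<bullet> b) has_real_derivative D) (at x))}" if "b \<in> Basis" for b
  proof (rule abs_cont_on_real_differentiable_ae[OF abs_cont_on_dominated[OF ac, where C=1] st])
    fix u v assume "s \<le> u" "u \<le> v" "v \<le> t"
    then show "norm (f v \<bullet> b - f u \<bullet> b) \<le> 1 * (v - u + norm (f v - f u))"
      using Basis_le_norm[OF that, of "f v - f u"] by (simp add: inner_diff_left)
  qed
  show ?thesis
    by (rule negligible_subset[OF negligible_Union sub]) (use neg in auto)
qed

text \<open>A gauge argument that needs no prior integrability of \<open>f'\<close>. A tag outside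
  \<open>N\<close> is handled by differentiability there. A tag in \<open>N\<close> has integrand 0
  and leaves an increment of \<open>f\<close>; the sum of these increments is small by absolute
  continuity.\<close>

lemma abs_cont_on_has_integral:
  fixes f :: "real \<Rightarrow> real"
  assumes ac: "abs_cont_on f s t" and st: "s < t" and N: "negligible N"
    and der: "\<And>x. x \<in> {s..t} - N \<Longrightarrow> (f has_real_derivative f' x) (at x)"
  shows "((\<lambda>x. if x \<in> N then 0 else f' x) has_integral (f t - f s)) {s..t}"
  unfolding has_integral_factor_content_real
proof (intro allI impI)
  let ?g = "\<lambda>x. if x \<in> N then 0 else f' x"
  fix e :: real assume "e > 0"
  \<comment> \<open>The admissible error e (t - s) is split evenly: one half for the tags in
    \<open>N\<close>, the other, as e/2 per unit length, for the remaining tags.\<close>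
  then have "e * (t - s) / 2 > 0" using st by simp
  from abs_cont_onD[OF ac this]
  obtain \<delta> where d: "\<delta> > 0" "\<And>n lo hi. nonoverlapping n lo hi s t \<Longrightarrow> (\<Sum>k<n. hi k - lo k) < \<delta> \<Longrightarrow> var_sum f n lo hi < e * (t - s) / 2"
    by auto
  obtain T where T: "open T" "N \<subseteq> T" "(T - N) \<in> lmeasurable" "emeasure lebesgue (T - N) < ennreal \<delta>"
    using sets_lebesgue_outer_open[OF negligible_imp_sets[OF N] d(1)] by blast
  have Tm: "T \<in> lmeasurable"
    using fmeasurable.Un[OF T(3) negligible_imp_measurable[OF N]] T(2) by (simp add: Un_absorb2)
  have "measure lebesgue T = measure lebesgue (T - N)"
    using N by (simp add: measure_Diff_null_set negligible_iff_null_sets Tm fmeasurableD)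
  also have "\<dots> < \<delta>" using T(3,4) d(1) by (simp add: emeasure_eq_measure2 ennreal_less_iff)
  finally have Tmeas: "measure lebesgue T < \<delta>" .
  have "\<exists>r>0. (x \<in> N \<longrightarrow> ball x r \<subseteq> T) \<and> (x \<in> {s..t} - N \<longrightarrow>
     (\<forall>y. norm (y - x) < r \<longrightarrow> norm (f y - f x - (y - x) * f' x) \<le> e/2 * norm (y - x)))" for x
  proof (cases "x \<in> N")
    case True
    then show ?thesis using T(1,2) open_contains_ball by (metis DiffD2 subsetD)
  next
    case False
    show ?thesis
    proof (cases "x \<in> {s..t}")
      case True
      then have "(f has_derivative (\<lambda>h. h * f' x)) (at x)"
        using der[of x] False by (auto simp: has_field_derivative_def mult_commute_abs)
      then have "\<exists>r>0. \<forall>y. norm (y - x) < r \<longrightarrow> norm (f y - f x - (y - x) * f' x) \<le> e/2 * norm (y - x)"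
        unfolding has_derivative_at_alt using \<open>e > 0\<close> by (meson half_gt_zero)
      then show ?thesis using False by blast
    qed (use False in \<open>auto intro!: exI[of _ 1]\<close>)
  qed
  then obtain r where r: "\<And>x. r x > 0" "\<And>x. x \<in> N \<Longrightarrow> ball x (r x) \<subseteq> T"
    "\<And>x y. x \<in> {s..t} - N \<Longrightarrow> norm (y - x) < r x \<Longrightarrow> norm (f y - f x - (y - x) * f' x) \<le> e/2 * norm (y - x)"
    by metis
  show "\<exists>d. gauge d \<and> (\<forall>p. p tagged_division_of {s..t} \<and> d fine p \<longrightarrow>
    norm ((\<Sum>(x, k)\<in>p. measure lborel k *\<^sub>R ?g x) - (f t - f s)) \<le> e * measure lborel {s..t})"
  proof (rule exI[of _ "\<lambda>x. ball x (r x)"], intro conjI allI impI)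
    show "gauge (\<lambda>x. ball x (r x))" using r(1) gauge_ball_dependent by blast
    fix p assume p: "p tagged_division_of {s..t} \<and> (\<lambda>x. ball x (r x)) fine p"
    have fin: "finite p" using p by auto
    have K: "\<exists>u v. K = {u..v} \<and> u \<le> v \<and> x \<in> {u..v} \<and> s \<le> u \<and> v \<le> t \<and> {u..v} \<subseteq> ball x (r x)" if xK: "(x, K) \<in> p" for x K
    proof -
      have "x \<in> K" "K \<subseteq> {s..t}" "K \<subseteq> ball x (r x)" using p xK by (auto simp: fine_def)
      moreover obtain u v where "K = cbox u v" using p xK by blast
      ultimately show ?thesis by (intro exI[of _ u] exI[of _ v]) auto
    qed
    \<comment> \<open>Degenerate intervals are left out: disjoint interiors do not prevent a single
      point from lying inside another interval, which would break \<open>nonoverlapping\<close>.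
      Their increments vanish anyway.\<close>
    define pN where "pN = {(x,K)\<in>p. x \<in> N \<and> Inf K < Sup K}"
    have finN: "finite pN" unfolding pN_def by (rule finite_subset[OF _ fin]) auto
    have sums: "t - s = (\<Sum>(x,K)\<in>p. Sup K - Inf K)" "f t - f s = (\<Sum>(x,K)\<in>p. f (Sup K) - f (Inf K))"
      using additive_tagged_division_1[of s t p "\<lambda>x. x"] additive_tagged_division_1[of s t p f] st p by auto
    have "norm ((\<Sum>(x, K)\<in>p. measure lborel K *\<^sub>R ?g x) - (f t - f s)) =
      norm (\<Sum>(x,K)\<in>p. measure lborel K *\<^sub>R ?g x - (f (Sup K) - f (Inf K)))"
      unfolding sums(2) by (simp add: sum_subtractf[symmetric] split_def)
    also have "\<dots> \<le> (\<Sum>(x,K)\<in>p. e/2 * (Sup K - Inf K) + (if (x,K) \<in> pN then norm (f (Sup K) - f (Inf K)) else 0))"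
    proof (rule sum_norm_le, safe)
      fix x K assume xK: "(x, K) \<in> p"
      obtain u v where uv: "K = {u..v}" "u \<le> v" "x \<in> {u..v}" "s \<le> u" "v \<le> t" "{u..v} \<subseteq> ball x (r x)" using K[OF xK] by blast
      then have SI: "Sup K = v" "Inf K = u" "measure lborel K = v - u" by auto
      show "norm (measure lborel K *\<^sub>R ?g x - (f (Sup K) - f (Inf K))) \<le> e/2 * (Sup K - Inf K) + (if (x,K) \<in> pN then norm (f (Sup K) - f (Inf K)) else 0)"
      proof (cases "x \<in> N")
        case True
        have "0 \<le> e/2 * (v - u)" using \<open>e > 0\<close> uv by simp
        moreover have "u < v \<or> u = v" using uv by auto
        ultimately show ?thesis using True uv xK unfolding pN_def SI by auto
      next
        case False
        have uvb: "norm (u - x) < r x" "norm (v - x) < r x" using uv subsetD[OF uv(6), of u] subsetD[OF uv(6), of v] by (auto simp: dist_real_def abs_minus_commute)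
        have "norm (f u - f x - (u - x) * f' x) \<le> e/2 * norm (u - x)" "norm (f v - f x - (v - x) * f' x) \<le> e/2 * norm (v - x)"
          using r(3)[OF _ uvb(1)] r(3)[OF _ uvb(2)] False uv by auto
        moreover have "norm ((v - u) * f' x - (f v - f u)) \<le> norm (f u - f x - (u - x) * f' x) + norm (f v - f x - (v - x) * f' x)"
          using norm_triangle_ineq4[of "f u - f x - (u - x) * f' x" "f v - f x - (v - x) * f' x"] by (simp add: algebra_simps)
        moreover have "e/2 * norm (u - x) + e/2 * norm (v - x) = e/2 * (v - u)" using uv by (auto simp: field_simps)
        ultimately show ?thesis using False unfolding SI pN_def by auto
      qed
    qed
    also have "\<dots> = e/2 * (t - s) + (\<Sum>(x,K)\<in>pN. norm (f (Sup K) - f (Inf K)))"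
    proof -
      have "(\<Sum>(x,K)\<in>p. (if (x,K) \<in> pN then norm (f (Sup K) - f (Inf K)) else 0)) = (\<Sum>(x,K)\<in>pN. norm (f (Sup K) - f (Inf K)))"
        by (rule sum.mono_neutral_cong_right) (use fin in \<open>auto simp: pN_def split: if_splits\<close>)
      then show ?thesis unfolding sums(1) by (simp add: split_def sum.distrib sum_distrib_left)
    qed
    also have "(\<Sum>(x,K)\<in>pN. norm (f (Sup K) - f (Inf K))) \<le> e * (t - s) / 2"
    proof -
      obtain h n where h: "bij_betw h {..<n::nat} pN"
        using finN ex_bij_betw_nat_finite by (metis atLeast0LessThan)
      define lo where "lo i = Inf (snd (h i))" for i
      define hi where "hi i = Sup (snd (h i))" for i
      have hp: "h i \<in> pN" if "i < n" for i using h that by (auto simp: bij_betw_def)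
      have hK: "snd (h i) = {lo i..hi i}" "lo i < hi i" "s \<le> lo i" "hi i \<le> t" "snd (h i) \<subseteq> T" if "i < n" for i
      proof -
        obtain x K where xK: "h i = (x, K)" by fastforce
        then have *: "(x, K) \<in> p" "x \<in> N" "Inf K < Sup K" using hp[OF that] unfolding pN_def by auto
        obtain u v where uv: "K = {u..v}" "u \<le> v" "x \<in> {u..v}" "s \<le> u" "v \<le> t" "{u..v} \<subseteq> ball x (r x)" using K[OF *(1)] by blast
        show "snd (h i) = {lo i..hi i}" "lo i < hi i" "s \<le> lo i" "hi i \<le> t" "snd (h i) \<subseteq> T"
          using uv * r(2)[OF *(2)] unfolding lo_def hi_def xK by auto
      qed
      have no: "nonoverlapping n lo hi s t"
        unfolding nonoverlapping_def
      proof (intro conjI allI impI)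
        fix j k assume jk: "j < n" "k < n" "j \<noteq> k"
        then have "h j \<noteq> h k" using h by (auto simp: bij_betw_def inj_on_def)
        moreover have "h j \<in> p" "h k \<in> p" using hp[OF jk(1)] hp[OF jk(2)] unfolding pN_def by (auto simp: split_beta)
        ultimately have "interior (snd (h j)) \<inter> interior (snd (h k)) = {}"
          using p by (metis prod.collapse tagged_division_ofD(5))
        then have emp: "{lo j<..<hi j} \<inter> {lo k<..<hi k} = {}" using hK jk by simp
        show "hi j \<le> lo k \<or> hi k \<le> lo j"
        proof (rule ccontr)
          assume "\<not> ?thesis"
          then have "(max (lo j) (lo k) + min (hi j) (hi k)) / 2 \<in> {lo j<..<hi j} \<inter> {lo k<..<hi k}"
            using hK(2)[OF jk(1)] hK(2)[OF jk(2)] by (auto simp: min_def max_def field_simps)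
          then show False using emp by blast
        qed
      next
        fix k assume "k < n"
        from hK(2-4)[OF this] show "s \<le> lo k" "lo k \<le> hi k" "hi k \<le> t" by auto
      qed
      have "(\<Sum>k<n. hi k - lo k) \<le> measure lebesgue T"
      proof (rule nonoverlapping_length_le_measure[OF no Tm])
        show "(\<Union>k<n. {lo k<..<hi k}) \<subseteq> T" using hK(1,5) by fastforce
      qed
      then have "var_sum f n lo hi < e * (t - s) / 2" using d(2)[OF no] Tmeas by auto
      moreover have "var_sum f n lo hi = (\<Sum>(x,K)\<in>pN. norm (f (Sup K) - f (Inf K)))"
        unfolding var_sum_def lo_def hi_def using sum.reindex_bij_betw[OF h, of "\<lambda>(x,K). norm (f (Sup K) - f (Inf K))"]
        by (simp add: split_def)
      ultimately show ?thesis by simp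
    qed
    finally show "norm ((\<Sum>(x, k)\<in>p. measure lborel k *\<^sub>R ?g x) - (f t - f s)) \<le> e * measure lborel {s..t}"
      using st by simp
  qed
qed

text \<open>\<open>G\<close> is arbitrary, as the integrand of an action may be. The comparison goes
  through the positive part of the derivative, whose measurability comes from the gauge integral,
  and then uses only monotonicity of \<open>nn_integral\<close>. An infinite right-hand side is
  trivial.\<close>

lemma abs_cont_on_le_nn_integral:
  fixes f :: "real \<Rightarrow> real" and G :: "real \<Rightarrow> ennreal"
  assumes ac: "abs_cont_on f s t" and st: "s < t" and N: "negligible N"
    and der: "\<And>x. x \<in> {s<..<t} - N \<Longrightarrow> \<exists>D. (f has_real_derivative D) (at x) \<and> ennreal D \<le> G x"
  shows "ennreal (f t - f s) \<le> (\<integral>\<^sup>+ x. indicator {s..t} x * G x \<partial>lborel)"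
proof (cases "(\<integral>\<^sup>+ x. indicator {s..t} x * G x \<partial>lborel) = \<infinity>")
  case False
  define N' where "N' = N \<union> {s, t}"
  have N': "negligible N'" unfolding N'_def using N by (simp add: negligible_insert)
  obtain f' where f': "\<And>x. x \<in> {s<..<t} - N \<Longrightarrow> (f has_real_derivative f' x) (at x) \<and> ennreal (f' x) \<le> G x"
    using der by metis
  define g where "g x = (if x \<in> N' then 0 else f' x)" for x
  have gi: "(g has_integral (f t - f s)) {s..t}"
    unfolding g_def by (rule abs_cont_on_has_integral[OF ac st N']) (use f' in \<open>auto simp: N'_def\<close>)
  define h where "h x = indicator {s..t} x * max 0 (g x)" for x
  have hm: "h \<in> borel_measurable lebesgue"
  proof -
    have "(\<lambda>x. max 0 (indicator {s..t} x *\<^sub>R g x)) \<in> borel_measurable lebesgue"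
      using has_integral_implies_lebesgue_measurable[OF gi] by simp
    also have "(\<lambda>x. max 0 (indicator {s..t} x *\<^sub>R g x)) = h" by (auto simp: h_def fun_eq_iff indicator_def)
    finally show ?thesis .
  qed
  have le: "(\<integral>\<^sup>+ x. h x \<partial>lebesgue) \<le> (\<integral>\<^sup>+ x. indicator {s..t} x * G x \<partial>lborel)"
    unfolding nn_integral_completion
  proof (rule nn_integral_mono)
    fix x
    show "ennreal (h x) \<le> indicator {s..t} x * G x"
    proof (cases "x \<in> {s..t} - N'")
      case True
      then have "x \<in> {s<..<t} - N" by (auto simp: N'_def)
      then show ?thesis using f' True by (auto simp: h_def g_def ennreal_max_0)
    qed (auto simp: h_def g_def indicator_def)
  qed
  then obtain I where I: "(\<integral>\<^sup>+ x. h x \<partial>lebesgue) = ennreal I" "0 \<le> I"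
    using False by (cases "\<integral>\<^sup>+ x. h x \<partial>lebesgue" rule: ennreal_cases) (auto simp: top_unique)
  have B: "(h has_integral I) UNIV"
    using has_integral_iff_nn_integral_lebesgue[of h I] I hm by (auto simp: h_def)
  have A: "((\<lambda>x. if x \<in> {s..t} then g x else 0) has_integral (f t - f s)) UNIV"
    using gi has_integral_restrict_UNIV by blast
  have "f t - f s \<le> I"
    by (rule has_integral_le[OF A B]) (auto simp: h_def)
  then have "ennreal (f t - f s) \<le> ennreal I" by (rule ennreal_leI)
  then show ?thesis using le unfolding I(1) by (rule order_trans)
qed auto

text \<open>Lets \<open>abs_cont_on_dominated\<close>, which takes a single dominating curve, treat
  functions of two curves.\<close>

lemma abs_cont_on_Pair:
  assumes p: "abs_cont_on p s t" and q: "abs_cont_on q s t"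
  shows "abs_cont_on (\<lambda>u. (p u, q u)) s t"
  unfolding abs_cont_on_iff
proof (intro allI impI)
  fix e :: real assume "e > 0"
  then have e: "e / 2 > 0" by simp
  obtain d1 where d1: "0 < d1" "\<And>n lo hi. nonoverlapping n lo hi s t \<Longrightarrow> (\<Sum>k<n. hi k - lo k) < d1 \<Longrightarrow> var_sum p n lo hi < e / 2"
    using abs_cont_onD[OF p e] by blast
  obtain d2 where d2: "0 < d2" "\<And>n lo hi. nonoverlapping n lo hi s t \<Longrightarrow> (\<Sum>k<n. hi k - lo k) < d2 \<Longrightarrow> var_sum q n lo hi < e / 2"
    using abs_cont_onD[OF q e] by blast
  show "\<exists>\<delta>>0. \<forall>n lo hi. nonoverlapping n lo hi s t \<and> (\<Sum>k<n. hi k - lo k) < \<delta> \<longrightarrow> var_sum (\<lambda>u. (p u, q u)) n lo hi < e"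
  proof (rule exI[of _ "min d1 d2"], intro conjI allI impI)
    fix n lo hi assume *: "nonoverlapping n lo hi s t \<and> (\<Sum>k<n. hi k - lo k) < min d1 d2"
    have "var_sum (\<lambda>u. (p u, q u)) n lo hi \<le> var_sum p n lo hi + var_sum q n lo hi"
      unfolding var_sum_def sum.distrib[symmetric] by (intro sum_mono) (simp add: norm_Pair_le)
    then show "var_sum (\<lambda>u. (p u, q u)) n lo hi < e" using d1(2)[of n lo hi] d2(2)[of n lo hi] * by simp
  qed (use d1 d2 in auto)
qed

lemma abs_cont_on_bounded:
  assumes p: "abs_cont_on p s t" and "s \<le> t"
  shows "\<exists>B\<ge>0. \<forall>u\<in>{s..t}. norm (p u) \<le> B"
proof -
  obtain B where B: "\<And>n lo hi. nonoverlapping n lo hi s t \<Longrightarrow> var_sum p n lo hi \<le> B"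
    using abs_cont_on_bounded_variation[OF assms] by blast
  have "norm (p u) \<le> norm (p s) + \<bar>B\<bar>" if "u \<in> {s..t}" for u
  proof -
    have "norm (p u - p s) \<le> B"
      using B[of 1 "\<lambda>_. s" "\<lambda>_. u"] that unfolding nonoverlapping_def var_sum_def by auto
    then show ?thesis using norm_triangle_sub[of "p u" "p s"] by linarith
  qed
  then show ?thesis by (intro exI[of _ "norm (p s) + \<bar>B\<bar>"]) auto
qed

lemma abs_cont_on_bilinear:
  assumes "bounded_bilinear B" and p: "abs_cont_on p s t" and q: "abs_cont_on q s t" and "s \<le> t"
  shows "abs_cont_on (\<lambda>u. B (p u) (q u)) s t"
proof -
  interpret bounded_bilinear B by fact
  obtain K where K: "0 \<le> K" "\<And>a b. norm (B a b) \<le> norm a * norm b * K" using nonneg_bounded by blast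
  obtain Bp where Bp: "Bp \<ge> 0" "\<And>u. u \<in> {s..t} \<Longrightarrow> norm (p u) \<le> Bp" using abs_cont_on_bounded[OF p \<open>s \<le> t\<close>] by blast
  obtain Bq where Bq: "Bq \<ge> 0" "\<And>u. u \<in> {s..t} \<Longrightarrow> norm (q u) \<le> Bq" using abs_cont_on_bounded[OF q \<open>s \<le> t\<close>] by blast
  show ?thesis
  proof (rule abs_cont_on_dominated[OF abs_cont_on_Pair[OF p q], where C="Bp * K + Bq * K"])
    fix u v assume uv: "s \<le> u" "u \<le> v" "v \<le> t"
    define D where "D = norm ((p v, q v) - (p u, q u))"
    have D: "norm (p v - p u) \<le> D" "norm (q v - q u) \<le> D"
      unfolding D_def using norm_fst_le[of "p v - p u" "q v - q u"] norm_snd_le[of "q v - q u" "p v - p u"] by auto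
    have "B (p v) (q v) - B (p u) (q u) = B (p v) (q v - q u) + B (p v - p u) (q u)"
      by (simp add: diff_left diff_right)
    also have "norm \<dots> \<le> norm (p v) * norm (q v - q u) * K + norm (p v - p u) * norm (q u) * K"
      by (intro norm_triangle_le add_mono K)
    also have "\<dots> \<le> Bp * D * K + D * Bq * K"
      using Bp Bq D K uv by (intro add_mono mult_right_mono mult_mono) (auto intro: order_trans[OF norm_ge_zero])
    also have "\<dots> = (Bp * K + Bq * K) * D" by (simp add: algebra_simps)
    also have "\<dots> \<le> (Bp * K + Bq * K) * (v - u + D)"
      using Bp Bq K uv by (intro mult_left_mono) auto
    finally show "norm (B (p v) (q v) - B (p u) (q u)) \<le> (Bp * K + Bq * K) * (v - u + norm ((p v, q v) - (p u, q u)))"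
      unfolding D_def .
  qed
qed

lemma abs_cont_on_add:
  assumes p: "abs_cont_on p s t" and q: "abs_cont_on q s t"
  shows "abs_cont_on (\<lambda>u. p u + q u) s t"
proof (rule abs_cont_on_dominated[OF abs_cont_on_Pair[OF p q], where C=2])
  fix u v assume uv: "s \<le> u" "u \<le> v" "v \<le> t"
  have "norm (p v + q v - (p u + q u)) \<le> norm (p v - p u) + norm (q v - q u)"
    using norm_triangle_ineq[of "p v - p u" "q v - q u"] by (simp add: algebra_simps)
  then show "norm (p v + q v - (p u + q u)) \<le> 2 * (v - u + norm ((p v, q v) - (p u, q u)))"
    using norm_fst_le[of "p v - p u" "q v - q u"] norm_snd_le[of "q v - q u" "p v - p u"] uv by simp
qed

lemma abs_cont_on_uminus:
  assumes p: "abs_cont_on p s t"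
  shows "abs_cont_on (\<lambda>u. - p u) s t"
  by (rule abs_cont_on_dominated[OF p, where C=1]) (auto simp: norm_minus_commute)

lemma abs_cont_on_C1:
  assumes d: "\<And>u. u \<in> {s..t} \<Longrightarrow> (f has_vector_derivative f' u) (at u within {s..t})"
    and c: "continuous_on {s..t} f'"
  shows "abs_cont_on f s t"
proof -
  have "bounded (f' ` {s..t})" using c by (intro compact_imp_bounded compact_continuous_image) auto
  then obtain B where B: "\<And>u. u \<in> {s..t} \<Longrightarrow> norm (f' u) \<le> B" unfolding bounded_iff by blast
  have cf: "continuous_on {s..t} f" by (rule continuous_on_vector_derivative[OF d])
  show ?thesis
  proof (rule lipschitz_abs_cont_on[where C=B])
    fix u v assume uv: "s \<le> u" "u \<le> v" "v \<le> t"
    show "norm (f v - f u) \<le> B * (v - u)"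
    proof (cases "u < v")
      case True
      have "norm (f v - f u) \<le> B * v - B * u"
      proof (rule differentiable_bound_general[OF True])
        show "continuous_on {u..v} f" by (rule continuous_on_subset[OF cf]) (use uv in auto)
        show "continuous_on {u..v} (\<lambda>x. B * x)" by (intro continuous_intros)
        fix x assume x: "u < x" "x < v"
        have "at x within {s..t} = at x" by (rule at_within_interior) (use x uv in auto)
        then show "(f has_vector_derivative f' x) (at x)" using d[of x] x uv by auto
        have "((\<lambda>x. B * x) has_real_derivative B) (at x)" by (rule DERIV_cmult_Id)
        then show "((\<lambda>x. B * x) has_vector_derivative B) (at x)" unfolding has_real_derivative_iff_has_vector_derivative .
        show "norm (f' x) \<le> B" using B x uv by auto
      qed
      then show ?thesis by (simp add: algebra_simps)
    qed (use uv in auto)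
  qed
qed

section \<open>Hausdorff measure and rectifiability\<close>

text \<open>Measure zero in terms of explicit covers, so that the covers of countably many sets can
  be merged with errors e / 2^(n+1).\<close>

definition hausdorff_null :: "real \<Rightarrow> 'a::metric_space set \<Rightarrow> bool" where
  "hausdorff_null s A \<longleftrightarrow> (\<forall>\<delta>>0. \<forall>e>0. \<exists>C::nat \<Rightarrow> 'a set. A \<subseteq> (\<Union>i. C i) \<and>
     (\<forall>i. bounded (C i) \<and> diameter (C i) \<le> \<delta>) \<and> (\<Sum>i. ennreal (hcontrib s (C i))) \<le> ennreal e)"

lemma hausdorff_null_imp_measure_zero:
  assumes "hausdorff_null s A"
  shows "hausdorff_measure s A = 0"
proof -
  have "hausdorff_pre s \<delta> A \<le> 0" if "\<delta> > 0" for \<delta>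
  proof (rule ennreal_le_epsilon)
    fix e :: real assume "e > 0"
    then obtain C :: "nat \<Rightarrow> 'a set" where C: "A \<subseteq> (\<Union>i. C i)" "\<forall>i. bounded (C i) \<and> diameter (C i) \<le> \<delta>"
      "(\<Sum>i. ennreal (hcontrib s (C i))) \<le> ennreal e"
      using assms \<open>\<delta> > 0\<close> unfolding hausdorff_null_def by meson
    have "hausdorff_pre s \<delta> A \<le> (\<Sum>i. ennreal (hcontrib s (C i)))"
      unfolding hausdorff_pre_def by (rule INF_lower) (use C in auto)
    then show "hausdorff_pre s \<delta> A \<le> 0 + ennreal e" using C(3) by simp
  qed
  then have "hausdorff_measure s A \<le> 0"
    unfolding hausdorff_measure_def by (intro SUP_least) auto
  then show ?thesis by simp
qed

lemma hausdorff_null_UN: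
  assumes "\<And>n::nat. hausdorff_null s (B n)" "A \<subseteq> (\<Union>n. B n)"
  shows "hausdorff_null s A"
  unfolding hausdorff_null_def
proof (intro allI impI)
  fix \<delta> e :: real assume \<delta>: "\<delta> > 0" and e: "e > 0"
  have "\<forall>n. \<exists>C::nat \<Rightarrow> 'a set. B n \<subseteq> (\<Union>i. C i) \<and>
     (\<forall>i. bounded (C i) \<and> diameter (C i) \<le> \<delta>) \<and> (\<Sum>i. ennreal (hcontrib s (C i))) \<le> ennreal (e * (1/2)^Suc n)"
  proof
    fix n
    have "e * (1/2)^Suc n > 0" using e by simp
    then show "\<exists>C::nat \<Rightarrow> 'a set. B n \<subseteq> (\<Union>i. C i) \<and>
     (\<forall>i. bounded (C i) \<and> diameter (C i) \<le> \<delta>) \<and> (\<Sum>i. ennreal (hcontrib s (C i))) \<le> ennreal (e * (1/2)^Suc n)"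
      using assms(1)[of n] \<delta> unfolding hausdorff_null_def by blast
  qed
  from choice[OF this]
  obtain C :: "nat \<Rightarrow> nat \<Rightarrow> 'a set" where C: "\<And>n. B n \<subseteq> (\<Union>i. C n i)" "\<And>n i. bounded (C n i) \<and> diameter (C n i) \<le> \<delta>"
    "\<And>n. (\<Sum>i. ennreal (hcontrib s (C n i))) \<le> ennreal (e * (1/2)^Suc n)" by blast
  define D where "D k = C (fst (prod_decode k)) (snd (prod_decode k))" for k
  show "\<exists>C::nat \<Rightarrow> 'a set. A \<subseteq> (\<Union>i. C i) \<and>
     (\<forall>i. bounded (C i) \<and> diameter (C i) \<le> \<delta>) \<and> (\<Sum>i. ennreal (hcontrib s (C i))) \<le> ennreal e"
  proof (intro exI[of _ D] conjI)
    show "A \<subseteq> (\<Union>k. D k)"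
    proof
      fix x assume "x \<in> A"
      then obtain n i where "x \<in> C n i" using assms(2) C(1) by blast
      then have "x \<in> D (prod_encode (n, i))" unfolding D_def by simp
      then show "x \<in> (\<Union>k. D k)" by blast
    qed
    show "\<forall>i. bounded (D i) \<and> diameter (D i) \<le> \<delta>" using C(2) unfolding D_def by blast
    have "(\<Sum>k. ennreal (hcontrib s (D k))) = (\<Sum>n. \<Sum>i. ennreal (hcontrib s (C n i)))"
      unfolding D_def
      using suminf_ennreal_2dimen[where g="\<lambda>n. \<Sum>i. ennreal (hcontrib s (C n i))" and f="\<lambda>(n,i). ennreal (hcontrib s (C n i))"]
      by (simp add: o_def split_def)
    also have "\<dots> \<le> (\<Sum>n. ennreal (e * (1/2)^Suc n))"
      by (intro suminf_le C(3)) auto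
    also have "\<dots> = ennreal e"
    proof -
      have "(\<lambda>n. e * (1/2)^Suc n) sums (e * 1)" by (intro sums_mult power_half_series)
      then show ?thesis using e by (intro suminf_ennreal_eq) auto
    qed
    finally show "(\<Sum>k. ennreal (hcontrib s (D k))) \<le> ennreal e" .
  qed
qed

lemma edist_k_eq_L2_set: "edist_k k u w = L2_set (\<lambda>i. u i - w i) {..<k}"
  unfolding edist_k_def L2_set_def ..

lemma edist_k_nonneg: "0 \<le> edist_k k u w"
  unfolding edist_k_eq_L2_set by (rule L2_set_nonneg)

lemma edist_k_triangle: "edist_k k u w \<le> edist_k k u z + edist_k k z w"
  unfolding edist_k_eq_L2_set using L2_set_triangle_ineq[of "\<lambda>i. u i - z i" "\<lambda>i. z i - w i" "{..<k}"] by simp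

lemma edist_k_commute: "edist_k k u w = edist_k k w u"
  unfolding edist_k_def by (simp add: power2_commute)

lemma edist_k_self [simp]: "edist_k k u u = 0"
  unfolding edist_k_def by simp

lemma grid_interval:
  fixes x R :: real and n :: nat
  assumes "0 < R" "0 < n" "\<bar>x\<bar> \<le> R"
  shows "\<exists>j<n. - R + 2 * R * real j / real n \<le> x \<and> x \<le> - R + 2 * R * (real j + 1) / real n"
proof -
  define y where "y = (x + R) * n / (2 * R)"
  have x: "x = - R + 2 * R * y / n" using assms unfolding y_def by (simp add: field_simps)
  have y: "0 \<le> y" "y \<le> n"
  proof -
    show "0 \<le> y" using assms unfolding y_def by (intro divide_nonneg_pos mult_nonneg_nonneg) auto
    have "(x + R) * n \<le> (2 * R) * n" using assms by (intro mult_right_mono) auto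
    then show "y \<le> n" using assms unfolding y_def by (simp add: field_simps)
  qed
  obtain j where j: "j < n" "real j \<le> y" "y \<le> real j + 1"
  proof (cases "y = n")
    case True
    then show ?thesis using that[of "n - 1"] assms by auto
  next
    case False
    then have "nat \<lfloor>y\<rfloor> < n" using y by linarith
    then show ?thesis using that[of "nat \<lfloor>y\<rfloor>"] y by (simp add: of_nat_nat)
  qed
  have "2 * R * real j / n \<le> 2 * R * y / n" "2 * R * y / n \<le> 2 * R * (real j + 1) / n"
    using j assms by (intro divide_right_mono mult_left_mono; simp)+
  then show ?thesis using j(1) x by (intro exI[of _ j]) auto
qed

text \<open>Cutting the cube into n^k equal cubes gives images of diameter at most M / n. Their
  total contribution n^k (M / n)^s = M^s n^(k-s) tends to 0 because k < s.\<close>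

lemma lipschitz_cube_image_hausdorff_null:
  fixes F :: "(nat \<Rightarrow> real) \<Rightarrow> 'a::real_normed_vector"
  assumes lip: "\<And>u w. u \<in> Rk k \<Longrightarrow> w \<in> Rk k \<Longrightarrow> dist (F u) (F w) \<le> L * edist_k k u w"
    and L: "0 < L" and R: "0 < R" and s: "real k < s"
  shows "hausdorff_null s (F ` {u \<in> Rk k. \<forall>i<k. \<bar>u i\<bar> \<le> R})"
  unfolding hausdorff_null_def
proof (intro allI impI)
  fix \<delta> e :: real assume \<delta>: "\<delta> > 0" and e: "e > 0"
  \<comment> \<open>The summand 1 keeps \<open>M\<close> positive also when
    \<open>k = 0\<close>.\<close>
  define M where "M = L * (sqrt (real k) * (2 * R)) + 1"
  have M: "M > 0" "L * (sqrt (real k) * (2 * R)) \<le> M" using L R unfolding M_def by (auto intro!: add_nonneg_pos)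
  have lim1: "(\<lambda>n. M / real n) \<longlonglongrightarrow> 0" by (rule lim_const_over_n)
  have "(\<lambda>n. M powr s * real n powr (real k - s)) \<longlonglongrightarrow> M powr s * 0"
    using s by (intro tendsto_mult tendsto_const tendsto_neg_powr filterlim_real_sequentially) auto
  then have "eventually (\<lambda>n. M powr s * real n powr (real k - s) < e) sequentially"
    using e by (auto dest: order_tendstoD(2))
  moreover have "eventually (\<lambda>n. M / real n < \<delta>) sequentially" using lim1 \<delta> by (rule order_tendstoD(2))
  ultimately have "eventually (\<lambda>n. M powr s * real n powr (real k - s) < e \<and> M / real n < \<delta> \<and> 0 < n) sequentially"
    using eventually_gt_at_top[of 0] by eventually_elim auto
  then obtain n where n: "M powr s * real n powr (real k - s) < e" "M / real n < \<delta>" "0 < n"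
    using eventually_happens[of _ sequentially] by auto
  define J where "J = PiE {..<k} (\<lambda>_. {..<n})"
  have J: "finite J" "card J = n ^ k" unfolding J_def by (auto simp: finite_PiE card_PiE)
  define Q where "Q j = F ` {u \<in> Rk k. \<forall>i<k. - R + 2 * R * real (j i) / n \<le> u i \<and> u i \<le> - R + 2 * R * (real (j i) + 1) / n}" for j :: "nat \<Rightarrow> nat"
  have Qd: "dist x y \<le> M / n" if xy: "x \<in> Q j" "y \<in> Q j" for x y j
  proof -
    obtain u w where u: "u \<in> Rk k" "x = F u" "\<And>i. i < k \<Longrightarrow> - R + 2 * R * real (j i) / n \<le> u i \<and> u i \<le> - R + 2 * R * (real (j i) + 1) / n"
      and w: "w \<in> Rk k" "y = F w" "\<And>i. i < k \<Longrightarrow> - R + 2 * R * real (j i) / n \<le> w i \<and> w i \<le> - R + 2 * R * (real (j i) + 1) / n"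
      using xy unfolding Q_def by blast
    have "\<bar>u i - w i\<bar> \<le> 2 * R / n" if "i < k" for i
      using u(3)[OF that] w(3)[OF that] by (simp add: algebra_simps add_divide_distrib abs_le_iff)
    then have "(u i - w i)\<^sup>2 \<le> (2 * R / n)\<^sup>2" if "i < k" for i
      using that R by (intro abs_le_square_iff[THEN iffD1]) auto
    then have "(\<Sum>i<k. (u i - w i)\<^sup>2) \<le> (\<Sum>i<k. (2 * R / n)\<^sup>2)" by (intro sum_mono) auto
    then have "edist_k k u w \<le> sqrt (real k * (2 * R / n)\<^sup>2)" unfolding edist_k_def by simp
    also have "\<dots> = sqrt (real k) * (2 * R / n)" using R by (simp add: real_sqrt_mult)
    finally have "L * edist_k k u w \<le> L * (sqrt (real k) * (2 * R / n))" using L by (intro mult_left_mono) auto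
    also have "\<dots> = L * (sqrt (real k) * (2 * R)) / n" by simp
    also have "\<dots> \<le> M / n" using M by (intro divide_right_mono) auto
    finally show ?thesis using lip[OF u(1) w(1)] u(2) w(2) by simp
  qed
  have Mn: "0 \<le> M / n" using M by simp
  have Qb: "bounded (Q j)" for j unfolding bounded_def using Qd by blast
  have Qdiam: "diameter (Q j) \<le> M / n" for j
    by (rule diameter_le) (use Qd Mn in \<open>auto simp: dist_norm\<close>)
  obtain h where h: "bij_betw h {..<n^k} J"
    using ex_bij_betw_nat_finite[OF J(1)] J(2) by (metis atLeast0LessThan)
  define C where "C i = (if i < n^k then Q (h i) else {})" for i
  show "\<exists>C::nat \<Rightarrow> 'a set. F ` {u \<in> Rk k. \<forall>i<k. \<bar>u i\<bar> \<le> R} \<subseteq> (\<Union>i. C i) \<and>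
     (\<forall>i. bounded (C i) \<and> diameter (C i) \<le> \<delta>) \<and> (\<Sum>i. ennreal (hcontrib s (C i))) \<le> ennreal e"
  proof (intro exI[of _ C] conjI)
    show "F ` {u \<in> Rk k. \<forall>i<k. \<bar>u i\<bar> \<le> R} \<subseteq> (\<Union>i. C i)"
    proof safe
      fix u assume u: "u \<in> Rk k" "\<forall>i<k. \<bar>u i\<bar> \<le> R"
      have "\<forall>i. \<exists>j. i < k \<longrightarrow> j < n \<and> - R + 2 * R * real j / real n \<le> u i \<and> u i \<le> - R + 2 * R * (real j + 1) / real n"
        using grid_interval[OF R n(3)] u(2) by meson
      then obtain j where j: "\<And>i. i < k \<Longrightarrow> j i < n \<and> - R + 2 * R * real (j i) / real n \<le> u i \<and> u i \<le> - R + 2 * R * (real (j i) + 1) / real n"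
        by metis
      define j' where "j' = restrict j {..<k}"
      have "j' \<in> J" unfolding J_def j'_def using j by auto
      then obtain i where i: "i < n^k" "h i = j'" using h by (auto simp: bij_betw_def)
      have "F u \<in> Q j'" unfolding Q_def j'_def using u(1) j by auto
      then have "F u \<in> C i" using i unfolding C_def by simp
      then show "F u \<in> (\<Union>i. C i)" by blast
    qed
    show "\<forall>i. bounded (C i) \<and> diameter (C i) \<le> \<delta>"
      using Qb order_trans[OF Qdiam less_imp_le[OF n(2)]] \<delta> unfolding C_def by auto
    have hc: "hcontrib s (C i) \<le> (M / n) powr s" if "i < n^k" for i
    proof (cases "C i = {}")
      case False
      have "0 \<le> diameter (C i)" "diameter (C i) \<le> M / n" using Qb Qdiam that by (auto simp: C_def diameter_ge_0)
      then show ?thesis using s False by (auto simp: hcontrib_def intro!: powr_mono2)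
    qed (simp add: hcontrib_def)
    have "(\<Sum>i. ennreal (hcontrib s (C i))) = (\<Sum>i<n^k. ennreal (hcontrib s (C i)))"
      by (rule suminf_finite) (auto simp: C_def hcontrib_def)
    also have "\<dots> \<le> (\<Sum>i<n^k. ennreal ((M / n) powr s))"
      by (intro sum_mono ennreal_leI hc) auto
    also have "\<dots> = ennreal (real (n^k) * (M / n) powr s)"
      by (simp add: ennreal_of_nat_eq_real_of_nat ennreal_mult)
    also have "real (n^k) * (M / n) powr s = M powr s * real n powr (real k - s)"
      using n(3) M by (simp add: powr_divide powr_diff powr_realpow)
    also have "ennreal \<dots> \<le> ennreal e" using n(1) by (intro ennreal_leI) simp
    finally show "(\<Sum>i. ennreal (hcontrib s (C i))) \<le> ennreal e" .
  qed
qed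

lemma countably_rectifiable_hausdorff_null:
  fixes A :: "'a::real_normed_vector set"
  assumes "countably_rectifiable k A" and s: "real k < s"
  shows "hausdorff_null s A"
proof -
  obtain F :: "nat \<Rightarrow> (nat \<Rightarrow> real) \<Rightarrow> 'a" where F: "A \<subseteq> (\<Union>i. F i ` Rk k)"
     "\<forall>i. \<exists>L. \<forall>u\<in>Rk k. \<forall>w\<in>Rk k. dist (F i u) (F i w) \<le> L * edist_k k u w"
    using assms(1) unfolding countably_rectifiable_def by blast
  have F': "hausdorff_null s (F i ` Rk k)" for i
  proof -
    obtain L where L: "\<And>u w. u \<in> Rk k \<Longrightarrow> w \<in> Rk k \<Longrightarrow> dist (F i u) (F i w) \<le> L * edist_k k u w" using F(2) by blast
    have L': "dist (F i u) (F i w) \<le> (\<bar>L\<bar> + 1) * edist_k k u w" if "u \<in> Rk k" "w \<in> Rk k" for u w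
      by (rule order_trans[OF L[OF that]]) (auto intro!: mult_right_mono edist_k_nonneg)
    show ?thesis
    proof (rule hausdorff_null_UN)
      fix n :: nat
      show "hausdorff_null s (F i ` {u \<in> Rk k. \<forall>i<k. \<bar>u i\<bar> \<le> real (Suc n)})"
        by (rule lipschitz_cube_image_hausdorff_null[OF L']) (use s in auto)
    next
      show "F i ` Rk k \<subseteq> (\<Union>n. F i ` {u \<in> Rk k. \<forall>i<k. \<bar>u i\<bar> \<le> real (Suc n)})"
      proof safe
        fix u assume u: "u \<in> Rk k"
        obtain n :: nat where n: "(\<Sum>i<k. \<bar>u i\<bar>) \<le> n" using real_arch_simple by blast
        have "\<bar>u i\<bar> \<le> real (Suc n)" if "i < k" for i
          using member_le_sum[of i "{..<k}" "\<lambda>i. \<bar>u i\<bar>"] that n by auto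
        then show "F i u \<in> (\<Union>n. F i ` {u \<in> Rk k. \<forall>i<k. \<bar>u i\<bar> \<le> real (Suc n)})" using u by blast
      qed
    qed
  qed
  show ?thesis by (rule hausdorff_null_UN[OF F' F(1)])
qed

lemma hausdorff_dim_eqI:
  assumes up: "\<And>s. s > d \<Longrightarrow> hausdorff_measure s A = 0" and lo: "\<And>s. 0 \<le> s \<Longrightarrow> s < d \<Longrightarrow> hausdorff_measure s A \<noteq> 0"
    and d: "0 \<le> d"
  shows "hausdorff_dim A = ereal d"
  unfolding hausdorff_dim_def
proof (rule antisym)
  show "Inf (ereal ` {s. s \<ge> 0 \<and> hausdorff_measure s A = 0}) \<le> ereal d"
  proof (rule ccontr)
    assume "\<not> ?thesis"
    then have "ereal d < Inf (ereal ` {s. s \<ge> 0 \<and> hausdorff_measure s A = 0})" by simp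
    then obtain s where s: "ereal d < ereal s" "ereal s < Inf (ereal ` {s. s \<ge> 0 \<and> hausdorff_measure s A = 0})"
      using ereal_dense2 by blast
    then have "s \<in> {s. s \<ge> 0 \<and> hausdorff_measure s A = 0}" using up d by auto
    then have "Inf (ereal ` {s. s \<ge> 0 \<and> hausdorff_measure s A = 0}) \<le> ereal s" by (intro Inf_lower imageI)
    then show False using s(2) by simp
  qed
  show "ereal d \<le> Inf (ereal ` {s. s \<ge> 0 \<and> hausdorff_measure s A = 0})"
    using lo by (intro Inf_greatest) (auto simp: not_less[symmetric])
qed

section \<open>Lower bounds for Hausdorff measure by comparison with Lebesgue measure\<close>

lemma emeasure_lborel_cube:
  fixes c :: "real^'d"
  assumes "0 \<le> r"
  shows "emeasure lborel (cbox (c - vec r) (c + vec r)) = ennreal ((2 * r) ^ CARD('d))"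
proof -
  have "(vec r :: real^'d) \<bullet> b = r" if "b \<in> Basis" for b :: "real^'d"
    using that by (auto simp: Basis_vec_def inner_axis)
  then have *: "((c + vec r) - (c - vec r)) \<bullet> b = 2 * r" "(c - vec r) \<bullet> b \<le> (c + vec r) \<bullet> b" if "b \<in> Basis" for b :: "real^'d"
    using that assms by (simp_all only: inner_add_left inner_diff_left)
  have "(\<Prod>b\<in>Basis. ((c + vec r) - (c - vec r)) \<bullet> b) = (\<Prod>b\<in>(Basis::(real^'d) set). 2 * r)"
    by (intro prod.cong refl *)
  then show ?thesis using *(2) by (subst emeasure_lborel_cbox) auto
qed

text \<open>Mass distribution argument. A covering set of diameter D is sent by \<open>q\<close>
  into a product of cubes of half-side D, of volume (2 D)^k, and D^k <= D^s since D <= 1 and s < k.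
  So every cover at scale 1 has content at least r^k. The product measure over \<open>I\<close>
  serves as Lebesgue measure of dimension d |I|, since \<open>I\<close> is a set of bodies and not a
  type.\<close>

lemma hausdorff_measure_nonzero:
  fixes A :: "'a::real_normed_vector set" and q :: "'a \<Rightarrow> 'n::finite \<Rightarrow> real^'d" and I :: "'n set"
  assumes lip: "\<And>z w i. i \<in> I \<Longrightarrow> dist (q z i) (q w i) \<le> dist z w"
    and box: "PiE I (\<lambda>i. cbox (c i - vec r) (c i + vec r)) \<subseteq> (\<lambda>z. restrict (q z) I) ` A" and r: "0 < r"
    and s: "0 \<le> s" "s < real (CARD('d) * card I)"
  shows "hausdorff_measure s A \<noteq> 0"
proof -
  define k where "k = CARD('d) * card I"
  have k: "k > 0" using s unfolding k_def by linarith
  interpret product_sigma_finite "\<lambda>_::'n. lborel :: (real^'d) measure" ..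
  let ?M = "PiM I (\<lambda>_. lborel :: (real^'d) measure)"
  have cube: "emeasure ?M (PiE I (\<lambda>i. cbox (c i - vec r) (c i + vec r))) = ennreal ((2 * r) ^ k)"
    if "0 \<le> r" for c :: "'n \<Rightarrow> real^'d" and r
    using that by (subst emeasure_PiM) (auto simp: emeasure_lborel_cube ennreal_power k_def power_mult)
  have "ennreal ((2 * r) ^ k) \<le> ennreal (2 ^ k) * hausdorff_pre s 1 A"
  proof -
    have "ennreal ((2 * r) ^ k / 2 ^ k) \<le> hausdorff_pre s 1 A"
      unfolding hausdorff_pre_def
    proof (rule INF_greatest)
      fix C :: "nat \<Rightarrow> 'a set"
      assume "C \<in> {C. A \<subseteq> (\<Union>i. C i) \<and> (\<forall>i. bounded (C i) \<and> diameter (C i) \<le> 1)}"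
      then have C: "A \<subseteq> (\<Union>i. C i)" "\<And>i. bounded (C i)" "\<And>i. diameter (C i) \<le> 1" by auto
      define z where "z i = (SOME z. z \<in> C i)" for i
      \<comment> \<open>Any point of \<open>C i\<close> serves as centre: all others differ from it
        by at most the diameter in every coordinate.\<close>
      define B where "B i = (if C i = {} then {} else PiE I (\<lambda>j. cbox (q (z i) j - vec (diameter (C i))) (q (z i) j + vec (diameter (C i)))))" for i
      have dm: "0 \<le> diameter (C i)" for i using C(2) by (rule diameter_ge_0)
      have Bs: "B i \<in> sets ?M" for i unfolding B_def by (auto intro!: sets_PiM_I_finite)
      have Be: "emeasure ?M (B i) \<le> ennreal (2 ^ k) * ennreal (hcontrib s (C i))" for i
      proof (cases "C i = {}")
        case False
        have "diameter (C i) ^ k \<le> hcontrib s (C i)"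
        proof (cases "s = 0")
          case True
          then show ?thesis using False dm C(3) by (auto simp: hcontrib_def power_le_one)
        next
          case s0: False
          show ?thesis
          proof (cases "diameter (C i) = 0")
            case True
            then show ?thesis using k False by (simp add: hcontrib_def power_0_left)
          next
            case d0: False
            then have "diameter (C i) ^ k = diameter (C i) powr k" using dm[of i] by (simp add: powr_realpow)
            also have "\<dots> \<le> diameter (C i) powr s"
              using s d0 dm[of i] C(3)[of i] unfolding k_def by (intro powr_mono') auto
            finally show ?thesis using False s0 by (simp add: hcontrib_def)
          qed
        qed
        then have "(2 * diameter (C i)) ^ k \<le> 2 ^ k * hcontrib s (C i)" by (simp add: power_mult_distrib)
        moreover have "emeasure ?M (B i) = ennreal ((2 * diameter (C i)) ^ k)"
          using False cube[OF dm] unfolding B_def by simp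
        moreover have "0 \<le> hcontrib s (C i)" unfolding hcontrib_def by auto
        ultimately show ?thesis by (simp add: ennreal_mult[symmetric] ennreal_leI)
      qed (simp add: B_def)
      have sub: "PiE I (\<lambda>i. cbox (c i - vec r) (c i + vec r)) \<subseteq> (\<Union>i. B i)"
      proof
        fix y assume "y \<in> PiE I (\<lambda>i. cbox (c i - vec r) (c i + vec r))"
        then obtain x where x: "x \<in> A" "y = restrict (q x) I" using box by blast
        then obtain i where i: "x \<in> C i" using C(1) by blast
        then have zi: "z i \<in> C i" unfolding z_def by (metis someI)
        have "q x j \<in> cbox (q (z i) j - vec (diameter (C i))) (q (z i) j + vec (diameter (C i)))" if j: "j \<in> I" for j
        proof -
          have "dist (q x j) (q (z i) j) \<le> diameter (C i)"
            using lip[OF j, of x "z i"] diameter_bounded_bound[OF C(2) i zi] by linarith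
          then have "\<bar>q x j $ l - q (z i) j $ l\<bar> \<le> diameter (C i)" for l
            using dist_vec_nth_le[of "q x j" l "q (z i) j"] unfolding dist_real_def by linarith
          then show ?thesis unfolding mem_box_cart by (simp add: abs_le_iff) (metis add.commute diff_le_eq le_diff_eq)
        qed
        then have "y \<in> B i" unfolding B_def x(2) using i by auto
        then show "y \<in> (\<Union>i. B i)" by blast
      qed
      have "(\<Union>i. B i) \<in> sets ?M" using Bs by auto
      from emeasure_mono[OF sub this] have "ennreal ((2 * r) ^ k) \<le> emeasure ?M (\<Union>i. B i)"
        using cube[of r c] r by simp
      also have "\<dots> \<le> (\<Sum>i. emeasure ?M (B i))"
        using Bs by (intro emeasure_subadditive_countably) auto
      also have "\<dots> \<le> (\<Sum>i. ennreal (2 ^ k) * ennreal (hcontrib s (C i)))"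
        using Be by (intro suminf_le) auto
      also have "\<dots> = ennreal (2 ^ k) * (\<Sum>i. ennreal (hcontrib s (C i)))" by simp
      finally have *: "ennreal ((2 * r) ^ k) \<le> ennreal (2 ^ k) * (\<Sum>i. ennreal (hcontrib s (C i)))" .
      have "ennreal ((2 * r) ^ k / 2 ^ k) = ennreal (1 / 2 ^ k) * ennreal ((2 * r) ^ k)"
        using r by (simp add: ennreal_mult[symmetric])
      also have "\<dots> \<le> ennreal (1 / 2 ^ k) * (ennreal (2 ^ k) * (\<Sum>i. ennreal (hcontrib s (C i))))"
        by (intro mult_left_mono *) auto
      also have "\<dots> = (\<Sum>i. ennreal (hcontrib s (C i)))"
        by (simp add: mult.assoc[symmetric] ennreal_mult[symmetric])
      finally show "ennreal ((2 * r) ^ k / 2 ^ k) \<le> (\<Sum>i. ennreal (hcontrib s (C i)))" .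
    qed
    then have "ennreal (2 ^ k) * ennreal ((2 * r) ^ k / 2 ^ k) \<le> ennreal (2 ^ k) * hausdorff_pre s 1 A"
      by (intro mult_left_mono) auto
    then show ?thesis using r by (simp add: ennreal_mult[symmetric])
  qed
  moreover have "0 < ennreal ((2 * r) ^ k)" using r by simp
  ultimately have "hausdorff_pre s 1 A \<noteq> 0" by (metis mult_zero_right not_le)
  moreover have "hausdorff_pre s 1 A \<le> hausdorff_measure s A"
    unfolding hausdorff_measure_def by (intro SUP_upper) auto
  ultimately show ?thesis by auto
qed

text \<open>The hypothesis says that \<pi> is injective on \<open>Z\<close> with a Lipschitz
  inverse. This inverse, extended coordinate by coordinate to all of \<open>Rk k\<close>, is the
  parametrisation; passing from coordinates to the norm costs the factor
  \<open>DIM('b)\<close>.\<close>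

lemma lipschitz_inverse_extension:
  fixes Z :: "'b::euclidean_space set" and \<pi> :: "'b \<Rightarrow> nat \<Rightarrow> real"
  assumes \<pi>: "\<And>z. z \<in> Z \<Longrightarrow> \<pi> z \<in> Rk k"
    and lip: "\<And>z w. z \<in> Z \<Longrightarrow> w \<in> Z \<Longrightarrow> dist z w \<le> L * edist_k k (\<pi> z) (\<pi> w)"
  shows "\<exists>F. Z \<subseteq> F ` Rk k \<and> (\<exists>L. \<forall>u\<in>Rk k. \<forall>w\<in>Rk k. dist (F u) (F w) \<le> L * edist_k k u w)"
proof (cases "Z = {}")
  case True
  then show ?thesis by (intro exI[of _ "\<lambda>_. 0"]) (auto intro: exI[of _ 0])
next
  case False
  define K where "K = \<bar>L\<bar>"
  have K: "0 \<le> K" "\<And>z w. z \<in> Z \<Longrightarrow> w \<in> Z \<Longrightarrow> dist z w \<le> K * edist_k k (\<pi> z) (\<pi> w)"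
  proof -
    fix z w assume "z \<in> Z" "w \<in> Z"
    then have "dist z w \<le> L * edist_k k (\<pi> z) (\<pi> w)" by (rule lip)
    also have "\<dots> \<le> K * edist_k k (\<pi> z) (\<pi> w)" unfolding K_def by (intro mult_right_mono edist_k_nonneg) auto
    finally show "dist z w \<le> K * edist_k k (\<pi> z) (\<pi> w)" .
  qed (simp add: K_def)
  \<comment> \<open>McShane's extension in each coordinate\<close>
  define f where "f b u = (INF z\<in>Z. z \<bullet> b + K * edist_k k u (\<pi> z))" for b :: 'b and u
  have comp: "\<bar>z \<bullet> b - w \<bullet> b\<bar> \<le> K * edist_k k (\<pi> z) (\<pi> w)" if "b \<in> Basis" "z \<in> Z" "w \<in> Z" for b z w
    using Basis_le_norm[OF that(1), of "z - w"] K(2)[OF that(2,3)] by (simp add: inner_diff_left dist_norm)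
  have lower: "w \<bullet> b - K * edist_k k u (\<pi> w) \<le> z \<bullet> b + K * edist_k k u (\<pi> z)" if "b \<in> Basis" "z \<in> Z" "w \<in> Z" for b z w u
  proof -
    have "K * edist_k k (\<pi> w) (\<pi> z) \<le> K * (edist_k k u (\<pi> w) + edist_k k u (\<pi> z))"
      using edist_k_triangle[of k "\<pi> w" "\<pi> z" u] K(1) by (intro mult_left_mono) (auto simp: edist_k_commute)
    then show ?thesis using comp[OF that(1,3,2)] by (simp add: distrib_left)
  qed
  have bdd: "bdd_below ((\<lambda>z. z \<bullet> b + K * edist_k k u (\<pi> z)) ` Z)" if "b \<in> Basis" for b u
    using lower[OF that] False by (metis (mono_tags, lifting) bdd_belowI2 ex_in_conv)
  have f_eq: "f b (\<pi> z) = z \<bullet> b" if "b \<in> Basis" "z \<in> Z" for b z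
  proof (rule antisym)
    show "f b (\<pi> z) \<le> z \<bullet> b" unfolding f_def
      using cINF_lower[OF bdd[OF that(1), of "\<pi> z"] that(2)] by simp
    show "z \<bullet> b \<le> f b (\<pi> z)" unfolding f_def
      using lower[OF that(1) _ that(2), of _ "\<pi> z"] False by (intro cINF_greatest) auto
  qed
  have f_le: "f b u \<le> f b w + K * edist_k k u w" if "b \<in> Basis" for b u w
  proof -
    have "f b u - K * edist_k k u w \<le> f b w"
      unfolding f_def[of b w]
    proof (rule cINF_greatest[OF False])
      fix z assume z: "z \<in> Z"
      have "f b u \<le> z \<bullet> b + K * edist_k k u (\<pi> z)" unfolding f_def by (rule cINF_lower[OF bdd[OF that] z])
      also have "\<dots> \<le> z \<bullet> b + K * (edist_k k u w + edist_k k w (\<pi> z))"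
        using edist_k_triangle[of k u "\<pi> z" w] K(1) by (intro add_left_mono mult_left_mono) auto
      finally show "f b u - K * edist_k k u w \<le> z \<bullet> b + K * edist_k k w (\<pi> z)" by (simp add: distrib_left)
    qed
    then show ?thesis by simp
  qed
  have f_lip: "\<bar>f b u - f b w\<bar> \<le> K * edist_k k u w" if "b \<in> Basis" for b u w
    using f_le[OF that, of u w] f_le[OF that, of w u] edist_k_commute[of k u w] by (simp add: abs_le_iff)
  define F where "F u = (\<Sum>b\<in>Basis. f b u *\<^sub>R b)" for u
  show ?thesis
  proof (intro exI[of _ F] conjI exI[of _ "real DIM('b) * K"] ballI)
    show "Z \<subseteq> F ` Rk k"
    proof
      fix z assume z: "z \<in> Z"
      have "F (\<pi> z) = z" unfolding F_def using f_eq[OF _ z] by (simp add: euclidean_representation)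
      then show "z \<in> F ` Rk k" using \<pi>[OF z] by (metis image_eqI)
    qed
    fix u w
    have "dist (F u) (F w) = norm (\<Sum>b\<in>Basis. (f b u - f b w) *\<^sub>R b)"
      unfolding F_def dist_norm by (simp add: sum_subtractf scaleR_diff_left)
    also have "\<dots> \<le> (\<Sum>b\<in>(Basis::'b set). K * edist_k k u w)"
      by (rule sum_norm_le) (use f_lip in auto)
    finally show "dist (F u) (F w) \<le> real DIM('b) * K * edist_k k u w" by simp
  qed
qed

lemma countably_rectifiableI:
  fixes A :: "'b::euclidean_space set"
  assumes A: "A \<subseteq> (\<Union>n::nat. Z n)"
    and Z: "\<And>n. \<exists>\<pi> L. (\<forall>z\<in>Z n. \<pi> z \<in> Rk k) \<and> (\<forall>z\<in>Z n. \<forall>w\<in>Z n. dist z w \<le> L * edist_k k (\<pi> z) (\<pi> w))"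
  shows "countably_rectifiable k A"
proof -
  have "\<forall>n. \<exists>F. Z n \<subseteq> F ` Rk k \<and> (\<exists>L. \<forall>u\<in>Rk k. \<forall>w\<in>Rk k. dist (F u) (F w) \<le> L * edist_k k u w)"
  proof
    fix n
    obtain \<pi> L where "\<And>z. z \<in> Z n \<Longrightarrow> \<pi> z \<in> Rk k" "\<And>z w. z \<in> Z n \<Longrightarrow> w \<in> Z n \<Longrightarrow> dist z w \<le> L * edist_k k (\<pi> z) (\<pi> w)"
      using Z[of n] by blast
    then show "\<exists>F. Z n \<subseteq> F ` Rk k \<and> (\<exists>L. \<forall>u\<in>Rk k. \<forall>w\<in>Rk k. dist (F u) (F w) \<le> L * edist_k k u w)"
      by (rule lipschitz_inverse_extension)
  qed
  from choice[OF this] obtain F where F: "\<And>n. Z n \<subseteq> F n ` Rk k"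
    "\<And>n. \<exists>L. \<forall>u\<in>Rk k. \<forall>w\<in>Rk k. dist (F n u) (F n w) \<le> L * edist_k k u w" by blast
  show ?thesis unfolding countably_rectifiable_def
  proof (intro exI[of _ F] conjI allI)
    show "A \<subseteq> (\<Union>i. F i ` Rk k)" by (rule order_trans[OF A UN_mono]) (use F(1) in auto)
  qed (rule F(2))
qed

section \<open>The Newtonian force\<close>

text \<open>The gradient of \<open>Upot\<close> with respect to \<open>minner\<close>: the factor
  m_i of the Euclidean gradient is divided out, so Newton's equation says that the acceleration
  equals \<open>force\<close>.\<close>

definition force :: "('n::finite \<Rightarrow> real) \<Rightarrow> (real^'d)^'n \<Rightarrow> (real^'d)^'n" where
  "force m x = (\<chi> i. \<Sum>j\<in>UNIV - {i}. (m j / norm (x$j - x$i)^3) *\<^sub>R (x$j - x$i))"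

lemma sum_pairs_swap:
  fixes g :: "'n::finite \<Rightarrow> 'n \<Rightarrow> 'a::comm_monoid_add"
  shows "(\<Sum>i\<in>UNIV. \<Sum>j\<in>UNIV - {i}. g i j) = (\<Sum>i\<in>UNIV. \<Sum>j\<in>UNIV - {i}. g j i)"
proof -
  have *: "(\<Sum>j\<in>UNIV - {i}. h j) = (\<Sum>j\<in>UNIV. if i \<noteq> j then h j else 0)" for i :: 'n and h :: "'n \<Rightarrow> 'a"
    by (rule sum.mono_neutral_cong_left) auto
  have "(\<Sum>i\<in>UNIV. \<Sum>j\<in>UNIV - {i}. g i j) = (\<Sum>i\<in>UNIV. \<Sum>j\<in>UNIV. if i \<noteq> j then g i j else 0)"
    by (simp only: *)
  also have "\<dots> = (\<Sum>j\<in>UNIV. \<Sum>i\<in>UNIV. if i \<noteq> j then g i j else 0)" by (rule sum.swap)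
  also have "\<dots> = (\<Sum>j\<in>UNIV. \<Sum>i\<in>UNIV. if j \<noteq> i then g i j else 0)" by (simp only: eq_commute)
  also have "\<dots> = (\<Sum>i\<in>UNIV. \<Sum>j\<in>UNIV - {i}. g j i)" by (simp only: *)
  finally show ?thesis .
qed

text \<open>Symmetrisation over i and j. Only differences of bodies remain, which exhibits both the
  translation invariance and, through the minus sign, the attraction.\<close>

lemma minner_force:
  "minner m (force m x) w = 
   - (\<Sum>i\<in>UNIV. \<Sum>j\<in>UNIV - {i}. m i * m j * ((x$i - x$j) \<bullet> (w$i - w$j)) / norm (x$i - x$j)^3) / 2"
proof -
  define T where "T i j = m i * m j * ((x$j - x$i) \<bullet> w$i) / norm (x$j - x$i)^3" for i j
  have "minner m (force m x) w = (\<Sum>i\<in>UNIV. \<Sum>j\<in>UNIV - {i}. T i j)"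
    unfolding minner_def force_def T_def
    by (intro sum.cong refl) (simp add: inner_sum_left sum_distrib_left mult.assoc)
  also have "\<dots> = ((\<Sum>i\<in>UNIV. \<Sum>j\<in>UNIV - {i}. T i j) + (\<Sum>i\<in>UNIV. \<Sum>j\<in>UNIV - {i}. T j i)) / 2"
    unfolding sum_pairs_swap[of "\<lambda>i j. T j i"] by simp
  also have "\<dots> = (\<Sum>i\<in>UNIV. \<Sum>j\<in>UNIV - {i}. T i j + T j i) / 2"
    by (simp add: sum.distrib)
  also have "(\<lambda>i j. T i j + T j i) = (\<lambda>i j. - (m i * m j * ((x$i - x$j) \<bullet> (w$i - w$j)) / norm (x$i - x$j)^3))"
  proof (intro ext)
    fix i j
    have "T i j = - (m i * m j * ((x$i - x$j) \<bullet> w$i) / norm (x$i - x$j)^3)"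
      unfolding T_def by (simp add: norm_minus_commute inner_diff_left algebra_simps diff_divide_distrib)
    moreover have "T j i = m i * m j * ((x$i - x$j) \<bullet> w$j) / norm (x$i - x$j)^3"
      unfolding T_def by (simp add: mult.commute)
    ultimately show "T i j + T j i = - (m i * m j * ((x$i - x$j) \<bullet> (w$i - w$j)) / norm (x$i - x$j)^3)"
      by (simp add: inner_diff_right algebra_simps diff_divide_distrib add_divide_distrib)
  qed
  finally show ?thesis by (simp add: sum_negf)
qed

lemma has_derivative_inverse_norm:
  fixes y :: "'a::real_inner"
  assumes "y \<noteq> 0"
  shows "((\<lambda>y. c / norm y) has_derivative (\<lambda>h. - c * (y \<bullet> h) / norm y ^ 3)) (at y)"
proof -
  have n: "(norm has_derivative (\<lambda>h. h \<bullet> sgn y)) (at y)"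
    using GDERIV_norm[OF assms] unfolding gderiv_def .
  have "((\<lambda>y. c / norm y) has_derivative (\<lambda>h. - (c * (sgn y \<bullet> h)) / (norm y * norm y))) (at y)"
    by (rule has_derivative_eq_rhs[OF has_derivative_divide'[OF has_derivative_const n]])
      (use assms in \<open>auto simp: fun_eq_iff inner_commute\<close>)
  moreover have "- (c * (sgn y \<bullet> h)) / (norm y * norm y) = - c * (y \<bullet> h) / norm y ^ 3" for h
    using assms by (simp add: sgn_div_norm power3_eq_cube divide_inverse)
  ultimately show ?thesis by simp
qed

lemma Upot_has_derivative:
  assumes "x \<in> Omega"
  shows "(Upot m has_derivative minner m (force m x)) (at x)"
proof -
  have d: "((\<lambda>x. m i * m j / norm (x$i - x$j)) has_derivative
       (\<lambda>h. - (m i * m j) * ((x$i - x$j) \<bullet> (h$i - h$j)) / norm (x$i - x$j)^3)) (at x)" if "j \<noteq> i" for i j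
  proof -
    have ne: "x$i - x$j \<noteq> 0" using assms that unfolding Omega_def by auto
    have 1: "((\<lambda>x. x$i - x$j) has_derivative (\<lambda>h. h$i - h$j)) (at x)"
      by (intro has_derivative_diff bounded_linear.has_derivative[OF bounded_linear_vec_nth] has_derivative_ident)
    show ?thesis
      using has_derivative_compose[OF 1 has_derivative_inverse_norm[OF ne, of "m i * m j"]] by simp
  qed
  have "(Upot m has_derivative (\<lambda>h. (\<Sum>i\<in>UNIV. \<Sum>j\<in>UNIV - {i}. - (m i * m j) * ((x$i - x$j) \<bullet> (h$i - h$j)) / norm (x$i - x$j)^3) / 2)) (at x)"
    unfolding Upot_def[abs_def] divide_inverse[of _ 2]
    by (intro has_derivative_mult_left has_derivative_sum d) auto
  moreover have "(\<lambda>h. (\<Sum>i\<in>UNIV. \<Sum>j\<in>UNIV - {i}. - (m i * m j) * ((x$i - x$j) \<bullet> (h$i - h$j)) / norm (x$i - x$j)^3) / 2) = minner m (force m x)"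
    by (simp add: fun_eq_iff minner_force sum_negf)
  ultimately show ?thesis by simp
qed

lemma bounded_bilinear_minner:
  fixes m :: "'n::finite \<Rightarrow> real"
  shows "bounded_bilinear (minner m :: (real^'d)^'n \<Rightarrow> _)"
proof -
  have "bounded_bilinear (\<lambda>x y :: (real^'d)^'n. \<Sum>i\<in>UNIV. m i * (x$i \<bullet> y$i))"
  proof
    show "\<exists>K. \<forall>x y :: (real^'d)^'n. norm (\<Sum>i\<in>UNIV. m i * (x$i \<bullet> y$i)) \<le> norm x * norm y * K"
    proof (intro exI[of _ "\<Sum>i\<in>UNIV. \<bar>m i\<bar>"] allI)
      fix x y :: "(real^'d)^'n"
      have "norm (\<Sum>i\<in>UNIV. m i * (x$i \<bullet> y$i)) \<le> (\<Sum>i\<in>UNIV. \<bar>m i\<bar> * (norm x * norm y))"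
      proof (rule sum_norm_le)
        fix i
        have "\<bar>x$i \<bullet> y$i\<bar> \<le> norm (x$i) * norm (y$i)" by (rule Cauchy_Schwarz_ineq2)
        also have "\<dots> \<le> norm x * norm y" by (intro mult_mono Finite_Cartesian_Product.norm_nth_le) auto
        finally show "norm (m i * (x$i \<bullet> y$i)) \<le> \<bar>m i\<bar> * (norm x * norm y)" by (simp add: abs_mult mult_left_mono)
      qed
      then show "norm (\<Sum>i\<in>UNIV. m i * (x$i \<bullet> y$i)) \<le> norm x * norm y * (\<Sum>i\<in>UNIV. \<bar>m i\<bar>)"
        by (simp add: sum_distrib_right[symmetric] mult.commute)
    qed
  qed (auto simp: inner_add_left inner_add_right algebra_simps sum.distrib sum_distrib_left)
  then show ?thesis unfolding minner_def[abs_def] .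
qed

lemmas minner_diff_left = bounded_bilinear.diff_left[OF bounded_bilinear_minner]
  and minner_diff_right = bounded_bilinear.diff_right[OF bounded_bilinear_minner]
  and minner_zero_right [simp] = bounded_bilinear.zero_right[OF bounded_bilinear_minner]

lemma minner_commute: "minner m x y = minner m y x"
  unfolding minner_def by (simp add: inner_commute)

lemma minner_nonneg: "\<forall>i. m i > 0 \<Longrightarrow> 0 \<le> minner m x x"
  unfolding minner_def by (intro sum_nonneg mult_nonneg_nonneg) (auto simp: less_imp_le)

lemma minner_eq_zeroD:
  assumes "\<forall>i. m i > 0" "minner m x x = 0"
  shows "x = 0"
proof -
  have "(\<Sum>i\<in>UNIV. m i * (x$i \<bullet> x$i)) = 0" using assms unfolding minner_def by simp
  then have "\<forall>i\<in>UNIV. m i * (x$i \<bullet> x$i) = 0"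
    using assms(1) by (subst (asm) sum_nonneg_eq_0_iff) (auto intro!: mult_nonneg_nonneg simp: less_imp_le)
  then have "x$i = 0" for i using assms(1) by (metis UNIV_I inner_eq_zero_iff less_irrefl mult_eq_0_iff)
  then show ?thesis by (simp add: vec_eq_iff)
qed

text \<open>The acceleration in \<open>newton_sol\<close> is given only through the derivative of
  \<open>Upot\<close>; nondegeneracy of \<open>minner\<close> identifies it with
  \<open>force\<close>.\<close>

lemma newton_solD:
  assumes "newton_sol m g vel" "\<forall>i. m i > 0" "0 \<le> t"
  shows "g t \<in> Omega" "(g has_vector_derivative vel t) (at t within {0..})"
    "(vel has_vector_derivative force m (g t)) (at t within {0..})"
proof -
  obtain acc where acc: "\<forall>t\<ge>0. g t \<in> Omega \<and>
        (g has_vector_derivative vel t) (at t within {0..}) \<and>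
        (vel has_vector_derivative acc t) (at t within {0..}) \<and>
        (Upot m has_derivative (\<lambda>w. minner m (acc t) w)) (at (g t))"
    using assms(1) unfolding newton_sol_def by blast
  then show g: "g t \<in> Omega" "(g has_vector_derivative vel t) (at t within {0..})" using assms(3) by auto
  have "minner m (acc t) = minner m (force m (g t))"
    using acc assms(3) Upot_has_derivative[OF g(1), of m] by (auto intro: has_derivative_unique)
  then have "minner m (acc t - force m (g t)) (acc t - force m (g t)) = 0"
    by (metis minner_diff_left diff_self)
  then have "acc t = force m (g t)" using minner_eq_zeroD[OF assms(2)] by fastforce
  then show "(vel has_vector_derivative force m (g t)) (at t within {0..})" using acc assms(3) by auto
qed

lemma newton_solI:
  assumes "\<And>t. 0 \<le> t \<Longrightarrow> g t \<in> Omega"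
    "\<And>t. 0 \<le> t \<Longrightarrow> (g has_vector_derivative vel t) (at t within {0..})"
    "\<And>t. 0 \<le> t \<Longrightarrow> (vel has_vector_derivative force m (g t)) (at t within {0..})"
  shows "newton_sol m g vel"
  unfolding newton_sol_def using assms
  by (intro exI[of _ "\<lambda>t. force m (g t)"]) (auto intro: Upot_has_derivative)

section \<open>The centre of mass and the vanishing total force\<close>

definition mass_sum :: "('n::finite \<Rightarrow> real) \<Rightarrow> (real^'d)^'n \<Rightarrow> real^'d" where
  "mass_sum m x = (\<Sum>i\<in>UNIV. m i *\<^sub>R x$i)"

lemma Xc_iff: "x \<in> Xc m \<longleftrightarrow> mass_sum m x = 0"
  unfolding Xc_def mass_sum_def by simp

lemma bounded_linear_mass_sum: "bounded_linear (mass_sum m)"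
  unfolding mass_sum_def[abs_def]
  by (intro bounded_linear_sum bounded_linear_const_scaleR bounded_linear_vec_nth)

text \<open>Pairing with a common displacement \<open>e\<close> of all bodies makes every difference
  in \<open>minner_force\<close> vanish.\<close>

lemma mass_sum_force: "mass_sum m (force m x) = 0"
proof -
  have "mass_sum m (force m x) \<bullet> e = minner m (force m x) (\<chi> i. e)" for e
    unfolding mass_sum_def minner_def by (simp add: inner_sum_left)
  also have "minner m (force m x) (\<chi> i. e) = 0" for e
    unfolding minner_force by simp
  finally show ?thesis by (metis inner_eq_zero_iff)
qed

section \<open>Estimates of force and potential on separated configurations\<close>

definition separated :: "real \<Rightarrow> (real^'d)^'n::finite \<Rightarrow> bool" where
  "separated \<rho> x \<longleftrightarrow> (\<forall>i j. i \<noteq> j \<longrightarrow> \<rho> \<le> norm (x$i - x$j))"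

lemma separated_Omega: "separated \<rho> x \<Longrightarrow> 0 < \<rho> \<Longrightarrow> x \<in> Omega"
  unfolding separated_def Omega_def by force

text \<open>The 8 is 4 from \<open>kernel_lipschitz\<close> times 2 for the difference of two
  bodies; \<open>CARD('n)\<close> comes from adding the components. The same constant is used,
  generously, for the size of the force.\<close>

definition force_const :: "('n::finite \<Rightarrow> real) \<Rightarrow> real" where
  "force_const m = 8 * real CARD('n) * (\<Sum>i\<in>UNIV. m i)"

lemma force_const_nonneg: "\<forall>i. m i > 0 \<Longrightarrow> 0 \<le> force_const m"
  unfolding force_const_def by (intro mult_nonneg_nonneg sum_nonneg) (auto intro: less_imp_le)

lemma norm_le_sum_nth: "norm (x :: 'a::real_normed_vector^'n) \<le> (\<Sum>i\<in>UNIV. norm (x$i))"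
  unfolding norm_vec_def by (rule L2_set_le_sum) auto

lemma norm_le_card_mult:
  fixes x :: "'a::real_normed_vector^'n"
  assumes "\<And>i. norm (x$i) \<le> b"
  shows "norm x \<le> real CARD('n) * b"
  using norm_le_sum_nth[of x] sum_mono[of UNIV "\<lambda>i. norm (x$i)" "\<lambda>_. b"] assms by simp

text \<open>The vectors of norm at least \<rho> do not form a convex set, so the mean value
  inequality along a segment is not at hand. An algebraic identity for the difference of the inverse
  cubes produces four terms, each at most 1 / \<rho>^3.\<close>

lemma kernel_lipschitz:
  fixes z y :: "'a::real_inner"
  assumes "0 < \<rho>" "\<rho> \<le> norm z" "\<rho> \<le> norm y"
  shows "norm ((1 / norm z ^ 3) *\<^sub>R z - (1 / norm y ^ 3) *\<^sub>R y) \<le> 4 / \<rho>^3 * norm (z - y)"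
proof -
  define a b where "a = norm z" and "b = norm y"
  have ab: "0 < a" "0 < b" "\<rho> \<le> a" "\<rho> \<le> b" using assms unfolding a_def b_def by auto
  have d: "\<bar>b - a\<bar> \<le> norm (z - y)" unfolding a_def b_def by (metis norm_minus_commute norm_triangle_ineq3)
  have "\<rho> * (\<rho> * \<rho>) \<le> a * (a * a)" "\<rho> * (\<rho> * \<rho>) \<le> a * (b * b)" "\<rho> * (\<rho> * \<rho>) \<le> a * (a * b)"
    using assms(1) ab by (intro mult_mono; simp)+
  then have p3: "\<rho>^3 \<le> a^3" "\<rho>^3 \<le> a * b^2" "\<rho>^3 \<le> a^2 * b"
    by (simp_all add: power3_eq_cube power2_eq_square mult.assoc)
  have "norm ((1 / a ^ 3) *\<^sub>R z - (1 / b ^ 3) *\<^sub>R y) = norm ((1 / a^3) *\<^sub>R (z - y) + (1 / a^3 - 1 / b^3) *\<^sub>R y)"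
    by (simp add: algebra_simps)
  also have "\<dots> \<le> (1 / a^3) * norm (z - y) + \<bar>1 / a^3 - 1 / b^3\<bar> * b"
    using ab unfolding b_def by (intro norm_triangle_le) simp
  also have "\<bar>1 / a^3 - 1 / b^3\<bar> * b = \<bar>b - a\<bar> * (1 / (a * b^2) + 1 / (a^2 * b) + 1 / a^3)"
  proof -
    have "(1 / a^3 - 1 / b^3) * b = (b - a) * (1 / (a * b^2) + 1 / (a^2 * b) + 1 / a^3)"
      using ab by (simp add: field_simps power3_eq_cube power2_eq_square)
    then have "\<bar>(1 / a^3 - 1 / b^3) * b\<bar> = \<bar>(b - a) * (1 / (a * b^2) + 1 / (a^2 * b) + 1 / a^3)\<bar>" by simp
    then show ?thesis using ab by (simp add: abs_mult)
  qed
  also have "\<dots> \<le> norm (z - y) * (1 / \<rho>^3 + 1 / \<rho>^3 + 1 / \<rho>^3)"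
    using ab p3 d assms(1) by (intro mult_mono add_mono divide_left_mono) auto
  also have "(1 / a^3) * norm (z - y) \<le> (1 / \<rho>^3) * norm (z - y)"
    using ab p3 assms(1) by (intro mult_right_mono divide_left_mono) auto
  finally show ?thesis unfolding a_def b_def by (simp add: algebra_simps)
qed

lemma force_lipschitz:
  fixes x y :: "(real^'d)^'n::finite"
  assumes m: "\<forall>i. m i > 0" and \<rho>: "0 < \<rho>" and x: "separated \<rho> x" and y: "separated \<rho> y"
  shows "norm (force m x - force m y) \<le> force_const m / \<rho>^3 * norm (x - y)"
proof -
  have "norm (force m x $ i - force m y $ i) \<le> (\<Sum>j\<in>UNIV. m j) * (8 / \<rho>^3 * norm (x - y))" for i
  proof -
    have "force m x $ i - force m y $ i = (\<Sum>j\<in>UNIV - {i}. m j *\<^sub>R ((1 / norm (x$j - x$i)^3) *\<^sub>R (x$j - x$i) - (1 / norm (y$j - y$i)^3) *\<^sub>R (y$j - y$i)))"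
      unfolding force_def by (simp add: sum_subtractf scaleR_diff_right)
    also have "norm \<dots> \<le> (\<Sum>j\<in>UNIV - {i}. m j * (8 / \<rho>^3 * norm (x - y)))"
    proof (rule sum_norm_le)
      fix j assume "j \<in> UNIV - {i}"
      then have s: "\<rho> \<le> norm (x$j - x$i)" "\<rho> \<le> norm (y$j - y$i)" using x y unfolding separated_def by auto
      have "norm ((1 / norm (x$j - x$i)^3) *\<^sub>R (x$j - x$i) - (1 / norm (y$j - y$i)^3) *\<^sub>R (y$j - y$i)) \<le>
         4 / \<rho>^3 * norm ((x$j - x$i) - (y$j - y$i))" by (rule kernel_lipschitz[OF \<rho> s])
      also have "norm ((x$j - x$i) - (y$j - y$i)) \<le> norm ((x - y)$j) + norm ((x - y)$i)"
        using norm_triangle_ineq4[of "(x - y)$j" "(x - y)$i"] by (simp add: algebra_simps)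
      also have "\<dots> \<le> 2 * norm (x - y)" using Finite_Cartesian_Product.norm_nth_le[of "x - y" j] Finite_Cartesian_Product.norm_nth_le[of "x - y" i] by simp
      finally have "norm ((1 / norm (x$j - x$i)^3) *\<^sub>R (x$j - x$i) - (1 / norm (y$j - y$i)^3) *\<^sub>R (y$j - y$i)) \<le> 8 / \<rho>^3 * norm (x - y)"
        using \<rho> by (simp add: divide_right_mono)
      from mult_left_mono[OF this less_imp_le[OF m[rule_format, of j]]] show "norm (m j *\<^sub>R ((1 / norm (x$j - x$i)^3) *\<^sub>R (x$j - x$i) - (1 / norm (y$j - y$i)^3) *\<^sub>R (y$j - y$i))) \<le> m j * (8 / \<rho>^3 * norm (x - y))"
        using m[rule_format, of j] by (simp only: norm_scaleR abs_of_pos)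
    qed
    also have "\<dots> \<le> (\<Sum>j\<in>UNIV. m j * (8 / \<rho>^3 * norm (x - y)))"
      using m \<rho> by (intro sum_mono2) (auto intro!: mult_nonneg_nonneg divide_nonneg_nonneg simp: less_imp_le)
    finally show ?thesis unfolding sum_distrib_right .
  qed
  then have "norm (force m x - force m y) \<le> real CARD('n) * ((\<Sum>j\<in>UNIV. m j) * (8 / \<rho>^3 * norm (x - y)))"
    by (intro norm_le_card_mult) simp
  then show ?thesis unfolding force_const_def by (simp add: mult_ac)
qed

lemma continuous_on_force:
  assumes m: "\<forall>i. m i > 0" and \<rho>: "0 < \<rho>" and g: "continuous_on A g" "\<And>t. t \<in> A \<Longrightarrow> separated \<rho> (g t)"
  shows "continuous_on A (\<lambda>t. force m (g t))"
proof -
  have L: "(force_const m / \<rho>^3)-lipschitz_on {y. separated \<rho> y} (force m)"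
    using force_lipschitz[OF m \<rho>] force_const_nonneg[OF m] \<rho> by (intro lipschitz_onI) (auto simp: dist_norm)
  show ?thesis
    by (rule continuous_on_compose2[OF lipschitz_on_continuous_on[OF L] g(1)]) (use g(2) in auto)
qed

lemma separated_mono: "separated \<rho> x \<Longrightarrow> \<rho>' \<le> \<rho> \<Longrightarrow> separated \<rho>' x"
  unfolding separated_def by (meson order_trans)

lemma force_bound:
  fixes x :: "(real^'d)^'n::finite"
  assumes m: "\<forall>i. m i > 0" and \<rho>: "0 < \<rho>" and x: "separated \<rho> x"
  shows "norm (force m x) \<le> force_const m / \<rho>^2"
proof -
  have "norm (force m x $ i) \<le> (\<Sum>j\<in>UNIV. m j) * (8 / \<rho>^2)" for i
  proof -
    have "norm (force m x $ i) \<le> (\<Sum>j\<in>UNIV - {i}. m j * (8 / \<rho>^2))"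
      unfolding force_def vec_lambda_beta
    proof (rule sum_norm_le)
      fix j assume "j \<in> UNIV - {i}"
      then have s: "\<rho> \<le> norm (x$j - x$i)" using x unfolding separated_def by auto
      have "norm ((m j / norm (x$j - x$i)^3) *\<^sub>R (x$j - x$i)) = m j * (1 / norm (x$j - x$i)^2)"
        using s \<rho> m[rule_format, of j] by (simp add: power3_eq_cube power2_eq_square)
      also have "\<dots> \<le> m j * (8 / \<rho>^2)"
        using s \<rho> m[rule_format, of j] by (intro mult_left_mono frac_le power_mono) auto
      finally show "norm ((m j / norm (x$j - x$i)^3) *\<^sub>R (x$j - x$i)) \<le> m j * (8 / \<rho>^2)" .
    qed
    also have "\<dots> \<le> (\<Sum>j\<in>UNIV. m j * (8 / \<rho>^2))"
      using m \<rho> by (intro sum_mono2) (auto intro!: mult_nonneg_nonneg divide_nonneg_nonneg simp: less_imp_le)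
    finally show ?thesis unfolding sum_distrib_right .
  qed
  then have "norm (force m x) \<le> real CARD('n) * ((\<Sum>j\<in>UNIV. m j) * (8 / \<rho>^2))"
    by (intro norm_le_card_mult) simp
  then show ?thesis unfolding force_const_def by (simp add: mult_ac)
qed

text \<open>With \<open>s = norm z / norm p\<close> this is \<open>1 / s \<ge> 3 / 2 - s\<^sup>2 / 2\<close>, i.e. \<open>(s - 1)\<^sup>2 * (s + 2) \<ge> 0\<close>.\<close>

lemma inverse_norm_quadratic_lower_bound:
  fixes p z :: "'a::real_inner"
  assumes "p \<noteq> 0" "z \<noteq> 0"
  shows "1 / norm p - (p \<bullet> (z - p)) / norm p ^ 3 - (norm (z - p))\<^sup>2 / (2 * norm p ^ 3) \<le> 1 / norm z"
proof -
  define r s where "r = norm p" and "s = norm z"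
  have rs: "0 < r" "0 < s" using assms unfolding r_def s_def by auto
  have n: "(norm (z - p))\<^sup>2 = s\<^sup>2 - 2 * (p \<bullet> z) + r\<^sup>2"
    unfolding r_def s_def power2_norm_eq_inner by (simp add: inner_diff inner_commute)
  have i: "p \<bullet> (z - p) = p \<bullet> z - r\<^sup>2" unfolding r_def power2_norm_eq_inner by (simp add: inner_diff_right)
  have "0 \<le> (s - r)\<^sup>2 * (s + 2 * r)" using rs by simp
  then have "3 * r\<^sup>2 * s - s ^ 3 \<le> 2 * r ^ 3" by (simp add: power2_eq_square power3_eq_cube algebra_simps)
  then have "(3 * r\<^sup>2 - s\<^sup>2) / (2 * r ^ 3) \<le> 1 / s"
    using rs by (simp add: field_simps power2_eq_square power3_eq_cube)
  moreover have "1 / r - (p \<bullet> z - r\<^sup>2) / r ^ 3 - (s\<^sup>2 - 2 * (p \<bullet> z) + r\<^sup>2) / (2 * r ^ 3) = (3 * r\<^sup>2 - s\<^sup>2) / (2 * r ^ 3)"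
    using rs by (simp add: field_simps power2_eq_square power3_eq_cube)
  ultimately show ?thesis unfolding n i unfolding r_def[symmetric] s_def[symmetric] by simp
qed

text \<open>The pairwise inequality holds for all nonzero vectors, hence the bound is global in
  \<open>z\<close>. The constant arises from |w_i - w_j|^2 <= 2 (|w_i|^2 + |w_j|^2) and the
  summation of m_i m_j |w_i|^2 over j.\<close>

lemma Upot_quadratic_lower_bound:
  fixes y z :: "(real^'d)^'n::finite"
  assumes m: "\<forall>i. m i > 0" and \<rho>: "0 < \<rho>" and y: "separated \<rho> y" and z: "z \<in> Omega"
  shows "Upot m y + minner m (force m y) (z - y) - (\<Sum>i\<in>UNIV. m i) / \<rho>^3 * minner m (z - y) (z - y) \<le> Upot m z"
proof -
  define w where "w = z - y"
  define M where "M = (\<Sum>i\<in>UNIV. m i)"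
  have mm: "0 \<le> m i * m j" for i j using m by (simp add: less_imp_le)
  have pair: "m i * m j / norm (y$i - y$j) - m i * m j * ((y$i - y$j) \<bullet> (w$i - w$j)) / norm (y$i - y$j)^3
     - m i * m j * (((norm (w$i))\<^sup>2 + (norm (w$j))\<^sup>2) / \<rho>^3) \<le> m i * m j / norm (z$i - z$j)" if "j \<noteq> i" for i j
  proof -
    have s: "\<rho> \<le> norm (y$i - y$j)" using y that unfolding separated_def by auto
    have ne: "y$i - y$j \<noteq> 0" "z$i - z$j \<noteq> 0" using s \<rho> z that unfolding Omega_def by auto
    have wz: "(z$i - z$j) - (y$i - y$j) = w$i - w$j" unfolding w_def by simp
    have "(norm (w$i - w$j))\<^sup>2 \<le> 2 * ((norm (w$i))\<^sup>2 + (norm (w$j))\<^sup>2)"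
    proof -
      have "(norm (w$i - w$j))\<^sup>2 \<le> (norm (w$i) + norm (w$j))\<^sup>2" by (intro power_mono norm_triangle_ineq4) auto
      also have "\<dots> \<le> 2 * ((norm (w$i))\<^sup>2 + (norm (w$j))\<^sup>2)"
        using sum_squares_bound[of "norm (w$i)" "norm (w$j)"] by (simp add: power2_sum)
      finally show ?thesis .
    qed
    then have "(norm (w$i - w$j))\<^sup>2 / (2 * norm (y$i - y$j)^3) \<le> (2 * ((norm (w$i))\<^sup>2 + (norm (w$j))\<^sup>2)) / (2 * \<rho>^3)"
      using s \<rho> by (intro frac_le) (auto intro!: power_mono)
    also have "\<dots> = ((norm (w$i))\<^sup>2 + (norm (w$j))\<^sup>2) / \<rho>^3" by (rule mult_divide_mult_cancel_left) simp
    finally have "(norm (w$i - w$j))\<^sup>2 / (2 * norm (y$i - y$j)^3) \<le> ((norm (w$i))\<^sup>2 + (norm (w$j))\<^sup>2) / \<rho>^3" .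
    then have "1 / norm (y$i - y$j) - ((y$i - y$j) \<bullet> (w$i - w$j)) / norm (y$i - y$j) ^ 3 - ((norm (w$i))\<^sup>2 + (norm (w$j))\<^sup>2) / \<rho>^3 \<le> 1 / norm (z$i - z$j)"
      using inverse_norm_quadratic_lower_bound[OF ne, unfolded wz] by linarith
    from mult_left_mono[OF this mm[of i j]] show ?thesis by (simp add: right_diff_distrib)
  qed
  have "(\<Sum>i\<in>UNIV. \<Sum>j\<in>UNIV - {i}. m i * m j / norm (y$i - y$j) - m i * m j * ((y$i - y$j) \<bullet> (w$i - w$j)) / norm (y$i - y$j)^3
     - m i * m j * (((norm (w$i))\<^sup>2 + (norm (w$j))\<^sup>2) / \<rho>^3)) \<le> (\<Sum>i\<in>UNIV. \<Sum>j\<in>UNIV - {i}. m i * m j / norm (z$i - z$j))"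
    by (intro sum_mono pair) auto
  then have "2 * Upot m y + 2 * minner m (force m y) w - (\<Sum>i\<in>UNIV. \<Sum>j\<in>UNIV - {i}. m i * m j * (((norm (w$i))\<^sup>2 + (norm (w$j))\<^sup>2) / \<rho>^3)) \<le> 2 * Upot m z"
    unfolding minner_force Upot_def by (simp add: sum_subtractf)
  moreover have "(\<Sum>i\<in>UNIV. \<Sum>j\<in>UNIV - {i}. m i * m j * (((norm (w$i))\<^sup>2 + (norm (w$j))\<^sup>2) / \<rho>^3)) \<le> 2 * (M / \<rho>^3 * minner m w w)"
  proof -
    have "(\<Sum>i\<in>UNIV. \<Sum>j\<in>UNIV - {i}. m i * m j * (((norm (w$i))\<^sup>2 + (norm (w$j))\<^sup>2) / \<rho>^3))
      \<le> (\<Sum>i\<in>UNIV. \<Sum>j\<in>UNIV. m i * m j * (((norm (w$i))\<^sup>2 + (norm (w$j))\<^sup>2) / \<rho>^3))"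
      using mm \<rho> by (intro sum_mono sum_mono2) auto
    also have "\<dots> = (\<Sum>i\<in>UNIV. \<Sum>j\<in>UNIV. m i * m j * ((norm (w$i))\<^sup>2 / \<rho>^3)) + (\<Sum>i\<in>UNIV. \<Sum>j\<in>UNIV. m i * m j * ((norm (w$j))\<^sup>2 / \<rho>^3))"
      by (simp add: sum.distrib[symmetric] add_divide_distrib distrib_left)
    also have "(\<Sum>i\<in>UNIV. \<Sum>j\<in>UNIV. m i * m j * ((norm (w$j))\<^sup>2 / \<rho>^3)) = (\<Sum>i\<in>UNIV. \<Sum>j\<in>UNIV. m i * m j * ((norm (w$i))\<^sup>2 / \<rho>^3))"
      by (subst sum.swap) (simp add: mult.commute)
    also have "(\<Sum>i\<in>UNIV. \<Sum>j\<in>UNIV. m i * m j * ((norm (w$i))\<^sup>2 / \<rho>^3)) = M / \<rho>^3 * minner m w w"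
    proof -
      have "(\<Sum>j\<in>UNIV. m i * m j * ((norm (w$i))\<^sup>2 / \<rho>^3)) = M / \<rho>^3 * (m i * (w$i \<bullet> w$i))" for i
        unfolding M_def power2_norm_eq_inner by (simp add: sum_distrib_left sum_distrib_right sum_divide_distrib algebra_simps)
      then show ?thesis unfolding minner_def by (simp add: sum_distrib_left)
    qed
    finally show ?thesis by simp
  qed
  ultimately show ?thesis unfolding w_def M_def by linarith
qed

section \<open>Rectifiability of the set of hyperbolic rays\<close>

lemma at_within_Ici_pos: "0 < t \<Longrightarrow> at t within {0::real..} = at t"
  by (rule at_within_interior) (simp add: interior_real_atLeast)

text \<open>Let M be the supremum of |w| / t for t >= n, finite by the bound with \<open>B\<close>.
  Integrating |w2| <= K M / t^2 bounds the change of \<open>w1\<close> after t by K M / t, and w =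
  o(t) turns this into |w1 t| <= K M / t. Integrating again gives M <= |w n| / n + K M / n, where
  the last term is at most M / 2. So M <= 2 |w n| / n, and this controls
  \<open>w1 n\<close>.\<close>

lemma decaying_second_order:
  fixes w w1 w2 :: "real \<Rightarrow> 'a::real_normed_vector"
  assumes n: "0 < n" and K: "0 \<le> K" "2 * K \<le> n"
    and d1: "\<And>t. n \<le> t \<Longrightarrow> (w has_vector_derivative w1 t) (at t within {0..})"
    and d2: "\<And>t. n \<le> t \<Longrightarrow> (w1 has_vector_derivative w2 t) (at t within {0..})"
    and bd: "\<And>t. n \<le> t \<Longrightarrow> norm (w2 t) \<le> K / t^3 * norm (w t)"
    and lim: "((\<lambda>t. norm (w t) / t) \<longlongrightarrow> 0) at_top"
    and B: "\<And>t. n \<le> t \<Longrightarrow> norm (w t) \<le> B * t"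
  shows "norm (w1 n) \<le> 2 * K / n^2 * norm (w n)"
proof -
  have d1': "(w has_vector_derivative w1 t) (at t)" and d2': "(w1 has_vector_derivative w2 t) (at t)" if "n \<le> t" for t
    using d1[OF that] d2[OF that] at_within_Ici_pos[of t] n that by auto
  have cw: "continuous_on {s..t} w" and cw1: "continuous_on {s..t} w1" if "n \<le> s" for s t
    using that by (auto intro!: continuous_at_imp_continuous_on has_vector_derivative_continuous[OF d1'] has_vector_derivative_continuous[OF d2'])
  define M where "M = Sup ((\<lambda>t. norm (w t) / t) ` {n..})"
  have bdd: "bdd_above ((\<lambda>t. norm (w t) / t) ` {n..})"
    using B n by (intro bdd_aboveI2[of _ _ B]) (auto simp: divide_le_eq)
  have M: "norm (w t) \<le> M * t" if "n \<le> t" for t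
  proof -
    have "norm (w t) / t \<le> M" unfolding M_def using that by (intro cSup_upper bdd) auto
    then show ?thesis using n that by (simp add: divide_le_eq)
  qed
  have M0: "0 \<le> M"
  proof -
    have "0 \<le> M * n" using M[of n] norm_ge_zero[of "w n"] by linarith
    then show ?thesis using n by (simp add: zero_le_mult_iff)
  qed
  have KM: "0 \<le> K * M" using K M0 by simp
  have step1: "norm (w1 T - w1 t) \<le> K * M / t" if "n \<le> t" "t \<le> T" for t T
  proof (cases "t < T")
    case True
    have "norm (w1 T - w1 t) \<le> (- (K * M / T)) - (- (K * M / t))"
    proof (rule differentiable_bound_general[OF True cw1])
      show "continuous_on {t..T} (\<lambda>s. - (K * M / s))" using n that by (intro continuous_intros) auto
      fix s assume s: "t < s" "s < T"
      then have ns: "n \<le> s" "0 < s" using that n by auto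
      show "(w1 has_vector_derivative w2 s) (at s)" using d2'[OF ns(1)] .
      have "((\<lambda>s. - (K * M / s)) has_real_derivative (K * M / s^2)) (at s)"
        using ns by (auto intro!: derivative_eq_intros simp: power2_eq_square)
      then show "((\<lambda>s. - (K * M / s)) has_vector_derivative (K * M / s^2)) (at s)"
        unfolding has_real_derivative_iff_has_vector_derivative .
      have "norm (w2 s) \<le> K / s^3 * (M * s)"
        using order_trans[OF bd[OF ns(1)] mult_left_mono[OF M[OF ns(1)]]] K ns by simp
      also have "\<dots> = K * M / s^2" using ns by (simp add: power3_eq_cube power2_eq_square)
      finally show "norm (w2 s) \<le> K * M / s^2" .
    qed (use that in auto)
    moreover have "0 \<le> K * M / T" using KM n that by simp
    ultimately show ?thesis by linarith
  qed (use that KM n in auto)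
  \<comment> \<open>If |w1 t| exceeded K M / t by \<eta> > 0, then by \<open>step1\<close> the curve
    \<open>w\<close> would move away at rate at least \<eta>, contradicting w = o(t).\<close>
  have step2: "norm (w1 t) \<le> K * M / t" if t: "n \<le> t" for t
  proof (rule ccontr)
    define \<beta> where "\<beta> = K * M / t"
    define \<eta> where "\<eta> = norm (w1 t) - K * M / t"
    assume "\<not> ?thesis"
    then have \<eta>: "\<eta> > 0" unfolding \<eta>_def by simp
    have ev1: "eventually (\<lambda>T. norm (w T) / T < \<eta> / 2) at_top"
      using order_tendstoD(2)[OF lim, of "\<eta>/2"] \<eta> by simp
    have ev2: "eventually (\<lambda>T. max t (2 * (t * \<eta> + norm (w t)) / \<eta>) < T) at_top"
      by (rule eventually_gt_at_top)
    obtain T where T: "norm (w T) / T < \<eta> / 2" "t < T" "2 * (t * \<eta> + norm (w t)) / \<eta> < T"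
      using eventually_happens[OF eventually_conj[OF ev1 ev2]] by auto
    have "norm ((w T - T *\<^sub>R w1 t) - (w t - t *\<^sub>R w1 t)) \<le> K * M / t * T - K * M / t * t"
    proof (rule differentiable_bound_general[OF T(2)])
      show "continuous_on {t..T} (\<lambda>s. w s - s *\<^sub>R w1 t)" by (intro continuous_intros cw t)
      show "continuous_on {t..T} (\<lambda>s. K * M / t * s)" by (intro continuous_intros)
      fix s assume s: "t < s" "s < T"
      show "((\<lambda>s. w s - s *\<^sub>R w1 t) has_vector_derivative (w1 s - w1 t)) (at s)"
        using d1'[of s] s t by (auto intro!: derivative_eq_intros)
      have "((\<lambda>s. K * M / t * s) has_real_derivative (K * M / t)) (at s)" by (rule DERIV_cmult_Id)
      then show "((\<lambda>s. K * M / t * s) has_vector_derivative (K * M / t)) (at s)"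
        unfolding has_real_derivative_iff_has_vector_derivative .
      show "norm (w1 s - w1 t) \<le> K * M / t" using step1[of t s] s t by simp
    qed
    moreover have "(T - t) * norm (w1 t) - (norm (w T) + norm (w t)) \<le> norm ((w T - T *\<^sub>R w1 t) - (w t - t *\<^sub>R w1 t))"
    proof -
      have "norm ((T - t) *\<^sub>R w1 t) \<le> norm ((w T - T *\<^sub>R w1 t) - (w t - t *\<^sub>R w1 t)) + norm (w T - w t)"
        using norm_triangle_ineq4[of "w T - w t" "(w T - T *\<^sub>R w1 t) - (w t - t *\<^sub>R w1 t)"] by (simp add: algebra_simps)
      moreover have "norm (w T - w t) \<le> norm (w T) + norm (w t)" by (rule norm_triangle_ineq4)
      ultimately show ?thesis using T by simp
    qed
    moreover have "(T - t) * \<eta> = (T - t) * norm (w1 t) - (\<beta> * T - \<beta> * t)"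
      unfolding \<eta>_def \<beta>_def[symmetric] by (simp add: algebra_simps)
    ultimately have "(T - t) * \<eta> \<le> norm (w T) + norm (w t)" unfolding \<beta>_def by linarith
    moreover have "norm (w T) < \<eta> / 2 * T" using T n t by (simp add: divide_less_eq)
    moreover have "2 * (t * \<eta> + norm (w t)) < T * \<eta>" using T(3) \<eta> by (simp add: divide_less_eq)
    ultimately show False by (simp add: algebra_simps)
  qed
  have step3: "norm (w t) / t \<le> norm (w n) / n + K * M / n" if t: "n \<le> t" for t
  proof -
    have "norm (w t - w n) \<le> K * M / n * t - K * M / n * n"
    proof (cases "n < t")
      case True
      show ?thesis
      proof (rule differentiable_bound_general[OF True cw])
        show "continuous_on {n..t} (\<lambda>s. K * M / n * s)" by (intro continuous_intros)
        fix s assume s: "n < s" "s < t"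
        show "(w has_vector_derivative w1 s) (at s)" using d1' s by simp
        have "((\<lambda>s. K * M / n * s) has_real_derivative (K * M / n)) (at s)" by (rule DERIV_cmult_Id)
        then show "((\<lambda>s. K * M / n * s) has_vector_derivative (K * M / n)) (at s)"
          unfolding has_real_derivative_iff_has_vector_derivative .
        have "K * M / s \<le> K * M / n" using KM s n by (intro divide_left_mono) auto
        then show "norm (w1 s) \<le> K * M / n" using step2[of s] s by simp
      qed auto
    qed (use t in auto)
    moreover have "norm (w t) \<le> norm (w n) + norm (w t - w n)" using norm_triangle_sub by blast
    moreover have "0 \<le> K * M / n * n" using KM n by simp
    ultimately have "norm (w t) \<le> norm (w n) + K * M / n * t" by linarith
    also have "norm (w n) = norm (w n) / n * n" using n by simp
    also have "\<dots> \<le> norm (w n) / n * t" using n t by (intro mult_left_mono) auto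
    finally have "norm (w t) \<le> (norm (w n) / n + K * M / n) * t" by (simp add: algebra_simps)
    then show ?thesis using n t by (simp add: divide_le_eq)
  qed
  have "M \<le> norm (w n) / n + K * M / n"
    unfolding M_def using step3 unfolding M_def by (intro cSup_least) auto
  moreover have "K * M / n \<le> M / 2"
  proof -
    have "2 * K * M \<le> n * M" using K M0 by (intro mult_right_mono) auto
    then show ?thesis using n by (simp add: field_simps)
  qed
  ultimately have "M \<le> 2 * (norm (w n) / n)" by linarith
  then have "K * M \<le> K * (2 * (norm (w n) / n))" using K by (intro mult_left_mono) auto
  then have "K * M / n \<le> K * (2 * (norm (w n) / n)) / n" using n by (intro divide_right_mono) auto
  also have "\<dots> = 2 * K / n^2 * norm (w n)" by (simp add: power2_eq_square)
  finally show ?thesis using step2[of n] by linarith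
qed

text \<open>Gronwall backwards in time: with the weight exp ((1 + K) t) the squared size of (w, w1)
  is nondecreasing, since its derivative without the weight is at least - (1 + K) times
  itself.\<close>

lemma second_order_gronwall:
  fixes w w1 w2 :: "real \<Rightarrow> 'a::real_inner"
  assumes T: "0 \<le> T" and K: "0 \<le> K"
    and d1: "\<And>t. 0 \<le> t \<Longrightarrow> t \<le> T \<Longrightarrow> (w has_vector_derivative w1 t) (at t within {0..})"
    and d2: "\<And>t. 0 \<le> t \<Longrightarrow> t \<le> T \<Longrightarrow> (w1 has_vector_derivative w2 t) (at t within {0..})"
    and bd: "\<And>t. 0 \<le> t \<Longrightarrow> t \<le> T \<Longrightarrow> norm (w2 t) \<le> K * norm (w t)"
  shows "(norm (w 0))\<^sup>2 + (norm (w1 0))\<^sup>2 \<le> exp ((1 + K) * T) * ((norm (w T))\<^sup>2 + (norm (w1 T))\<^sup>2)"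
proof -
  define E where "E t = exp ((1 + K) * t) * (w t \<bullet> w t + w1 t \<bullet> w1 t)" for t
  have "E 0 \<le> E T"
  proof (rule DERIV_nonneg_imp_increasing_open[OF T])
    have cw: "continuous_on {0..T} w"
      by (rule continuous_on_vector_derivative[of _ _ w1]) (auto intro!: has_vector_derivative_within_subset[OF d1])
    have cw1: "continuous_on {0..T} w1"
      by (rule continuous_on_vector_derivative[of _ _ w2]) (auto intro!: has_vector_derivative_within_subset[OF d2])
    show "continuous_on {0..T} E" unfolding E_def by (intro continuous_intros cw cw1)
    fix t assume t: "0 < t" "t < T"
    have D1: "(w has_vector_derivative w1 t) (at t)" using d1[of t] t at_within_Ici_pos[of t] by auto
    have D2: "(w1 has_vector_derivative w2 t) (at t)" using d2[of t] t at_within_Ici_pos[of t] by auto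
    have A: "((\<lambda>t. w t \<bullet> w t) has_real_derivative (2 * (w t \<bullet> w1 t))) (at t)"
      unfolding has_real_derivative_iff_has_vector_derivative
      using bounded_bilinear.has_vector_derivative[OF bounded_bilinear_inner D1 D1] by (simp add: inner_commute)
    have B: "((\<lambda>t. w1 t \<bullet> w1 t) has_real_derivative (2 * (w1 t \<bullet> w2 t))) (at t)"
      unfolding has_real_derivative_iff_has_vector_derivative
      using bounded_bilinear.has_vector_derivative[OF bounded_bilinear_inner D2 D2] by (simp add: inner_commute)
    define D where "D = (1 + K) * (w t \<bullet> w t + w1 t \<bullet> w1 t) + 2 * (w t \<bullet> w1 t) + 2 * (w1 t \<bullet> w2 t)"
    have "(E has_real_derivative (exp ((1 + K) * t) * D)) (at t)"
      unfolding E_def D_def by (auto intro!: derivative_eq_intros A B simp: algebra_simps)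
    moreover have "0 \<le> D"
    proof -
      define a b where "a = norm (w t)" and "b = norm (w1 t)"
      have "\<bar>w t \<bullet> w1 t\<bar> \<le> a * b" unfolding a_def b_def by (rule Cauchy_Schwarz_ineq2)
      moreover have "\<bar>w1 t \<bullet> w2 t\<bar> \<le> b * (K * a)"
        using Cauchy_Schwarz_ineq2[of "w1 t" "w2 t"] mult_left_mono[OF bd[of t], of b] t unfolding a_def b_def by auto
      moreover have "2 * (a * b) \<le> a^2 + b^2" using sum_squares_bound[of a b] by simp
      moreover from mult_left_mono[OF this K] have "2 * (b * (K * a)) \<le> K * (a^2 + b^2)" by (simp add: algebra_simps)
      moreover have "D = (1 + K) * (a^2 + b^2) + 2 * (w t \<bullet> w1 t) + 2 * (w1 t \<bullet> w2 t)"
        unfolding D_def a_def b_def power2_norm_eq_inner ..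
      ultimately show ?thesis by (simp add: algebra_simps abs_le_iff)
    qed
    ultimately show "\<exists>y. (E has_real_derivative y) (at t) \<and> 0 \<le> y" by (intro exI[of _ "exp ((1 + K) * t) * D"]) simp
  qed
  then show ?thesis unfolding E_def by (simp add: power2_norm_eq_inner)
qed

text \<open>The centre of mass condition expresses the body \<open>i0\<close> through the others, so
  their bound extends to it with a factor M / m_i0, M being the total mass.\<close>

lemma Xc_norm_bound:
  fixes m :: "'n::finite \<Rightarrow> real" and w :: "(real^'d)^'n"
  assumes m: "\<forall>i. m i > 0" and w: "w \<in> Xc m" and b: "0 \<le> b" "\<And>i. i \<noteq> i0 \<Longrightarrow> norm (w $ i) \<le> b"
  shows "norm w \<le> real CARD('n) * ((1 + (\<Sum>i\<in>UNIV. m i) / m i0) * b)"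
proof -
  define M where "M = (\<Sum>i\<in>UNIV. m i)"
  have M: "M \<ge> 0" unfolding M_def using m by (auto intro!: sum_nonneg simp: less_imp_le)
  have mi0: "0 < m i0" using m by simp
  have wi0: "norm (w $ i0) \<le> M / m i0 * b"
  proof -
    have "(\<Sum>i\<in>UNIV. m i *\<^sub>R w $ i) = 0" using w unfolding Xc_def by simp
    then have "m i0 *\<^sub>R w $ i0 = - (\<Sum>i\<in>UNIV - {i0}. m i *\<^sub>R w $ i)"
      by (subst (asm) sum.remove[of _ i0]) (auto simp: eq_neg_iff_add_eq_0)
    then have "norm (m i0 *\<^sub>R w $ i0) = norm (\<Sum>i\<in>UNIV - {i0}. m i *\<^sub>R w $ i)" by simp
    also have "\<dots> \<le> (\<Sum>i\<in>UNIV - {i0}. m i * b)"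
    proof (rule sum_norm_le)
      fix i assume "i \<in> UNIV - {i0}"
      then have "norm (w $ i) \<le> b" using b by auto
      then show "norm (m i *\<^sub>R w $ i) \<le> m i * b"
        using m[rule_format, of i] by (simp add: mult_left_mono)
    qed
    also have "\<dots> \<le> (\<Sum>i\<in>UNIV. m i * b)"
      using m b by (intro sum_mono2) (auto intro!: mult_nonneg_nonneg simp: less_imp_le)
    also have "\<dots> = M * b" unfolding M_def by (simp add: sum_distrib_right)
    finally show ?thesis using mi0 by (simp add: field_simps)
  qed
  have "norm (w $ i) \<le> (1 + M / m i0) * b" for i
  proof (cases "i = i0")
    case True
    then show ?thesis using wi0 b(1) by (simp add: algebra_simps)
  next
    case False
    have "0 \<le> M / m i0 * b" using b(1) M mi0 by simp
    then show ?thesis using b(2)[OF False] by (simp add: algebra_simps)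
  qed
  then show ?thesis unfolding M_def[symmetric] by (rule norm_le_card_mult)
qed

text \<open>The coordinates are the entries of all bodies except \<open>i0\<close>, d (N - 1) of
  them, enumerated by the bijection \<open>\<beta>\<close>.\<close>

lemma Xc_coordinates:
  fixes m :: "'n::finite \<Rightarrow> real"
  assumes m: "\<forall>i. m i > 0"
  shows "\<exists>(\<pi> :: (real^'d)^'n \<Rightarrow> nat \<Rightarrow> real) C. (\<forall>x. \<pi> x \<in> Rk (CARD('d) * (CARD('n) - 1))) \<and>
    (\<forall>x\<in>Xc m. \<forall>y\<in>Xc m. norm (x - y) \<le> C * edist_k (CARD('d) * (CARD('n) - 1)) (\<pi> x) (\<pi> y))"
proof -
  define k where "k = CARD('d) * (CARD('n) - 1)"
  obtain i0 :: 'n where True by blast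
  define S where "S = (UNIV - {i0}) \<times> (UNIV :: 'd set)"
  have "card S = k" unfolding S_def k_def by (simp add: card_cartesian_product card_Diff_singleton)
  then obtain \<beta> where \<beta>: "bij_betw \<beta> {..<k} S"
    using ex_bij_betw_nat_finite[of S] by (metis atLeast0LessThan finite)
  define \<pi> where "\<pi> x l = (if l < k then x $ fst (\<beta> l) $ snd (\<beta> l) else 0)" for x :: "(real^'d)^'n" and l
  define M where "M = (\<Sum>i\<in>UNIV. m i)"
  define C where "C = real CARD('n) * ((1 + M / m i0) * real CARD('d))"
  have "norm (x - y) \<le> C * edist_k k (\<pi> x) (\<pi> y)" if xy: "x \<in> Xc m" "y \<in> Xc m" for x y
  proof -
    define e where "e = edist_k k (\<pi> x) (\<pi> y)"
    define w where "w = x - y"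
    have e0: "0 \<le> e" unfolding e_def by (rule edist_k_nonneg)
    have ent: "\<bar>w $ i $ j\<bar> \<le> e" if ij: "i \<noteq> i0" for i j
    proof -
      have "(i, j) \<in> S" using ij unfolding S_def by simp
      then obtain l where l: "l < k" "\<beta> l = (i, j)" using \<beta> by (metis bij_betw_iff_bijections lessThan_iff)
      have "\<bar>\<pi> x l - \<pi> y l\<bar> \<le> e"
        unfolding e_def edist_k_eq_L2_set using member_le_L2_set[of "{..<k}" l "\<lambda>i. \<bar>\<pi> x i - \<pi> y i\<bar>"] l
        by (simp add: L2_set_def)
      then show ?thesis unfolding \<pi>_def w_def using l by simp
    qed
    have wi: "norm (w $ i) \<le> real CARD('d) * e" if "i \<noteq> i0" for i
    proof -
      have "norm (w $ i) \<le> (\<Sum>j\<in>UNIV. \<bar>w $ i $ j\<bar>)" by (rule norm_le_l1_cart)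
      also have "\<dots> \<le> (\<Sum>j\<in>(UNIV::'d set). e)" by (intro sum_mono ent that)
      finally show ?thesis by simp
    qed
    have "w \<in> Xc m"
      using xy unfolding Xc_def w_def by (simp add: scaleR_diff_right sum_subtractf)
    then have "norm w \<le> real CARD('n) * ((1 + M / m i0) * (real CARD('d) * e))"
      unfolding M_def by (rule Xc_norm_bound[OF m]) (use e0 wi in auto)
    then show ?thesis unfolding w_def[symmetric] e_def[symmetric] C_def by (simp add: mult.assoc)
  qed
  moreover have "\<pi> x \<in> Rk k" for x unfolding Rk_def \<pi>_def by auto
  ultimately show ?thesis unfolding k_def[symmetric] by blast
qed

lemma Omega_separated:
  assumes "a \<in> Omega"
  obtains \<delta> where "0 < \<delta>" "separated \<delta> a"
proof
  \<comment> \<open>The inserted 1 keeps \<open>D\<close> nonempty when there is a single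
    body.\<close>
  define D where "D = insert 1 ((\<lambda>(i,j). norm (a$i - a$j)) ` {(i,j). i \<noteq> j})"
  have fin: "finite D" unfolding D_def by simp
  show "0 < Min D" using assms fin by (subst Min_gr_iff) (auto simp: D_def Omega_def)
  show "separated (Min D) a" unfolding separated_def
    by (intro allI impI Min_le fin) (auto simp: D_def)
qed

text \<open>Each of two bodies is displaced by at most \<delta> r / 8, so the distance \<delta> r
  shrinks to no less than 3 \<delta> r / 4. Both the rectifiability argument and the construction of
  solutions work in this cone, where the force has Lipschitz constant of order 1 / r^3.\<close>

lemma cone_separated:
  fixes a y :: "(real^'d)^'n::finite"
  assumes a: "separated \<delta> a" and y: "norm (y - r *\<^sub>R a) \<le> \<delta> / 8 * r" and r: "0 \<le> r" and \<delta>: "0 < \<delta>"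
  shows "separated (\<delta> / 2 * r) y"
  unfolding separated_def
proof (intro allI impI)
  fix i j :: 'n assume "i \<noteq> j"
  then have "\<delta> * r \<le> norm (a$i - a$j) * r" using a r unfolding separated_def by (intro mult_right_mono) auto
  also have "\<dots> = norm (r *\<^sub>R a$i - r *\<^sub>R a$j)" using r by (simp add: scaleR_diff_right[symmetric])
  also have "\<dots> \<le> norm (y$i - y$j) + norm ((y - r *\<^sub>R a)$i) + norm ((y - r *\<^sub>R a)$j)"
    using norm_triangle_ineq4[of "y$i - y$j" "(y - r *\<^sub>R a)$i - (y - r *\<^sub>R a)$j"]
      norm_triangle_ineq4[of "(y - r *\<^sub>R a)$i" "(y - r *\<^sub>R a)$j"] by (simp add: algebra_simps)
  also have "\<dots> \<le> norm (y$i - y$j) + \<delta> / 8 * r + \<delta> / 8 * r"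
    using Finite_Cartesian_Product.norm_nth_le[of "y - r *\<^sub>R a" i] Finite_Cartesian_Product.norm_nth_le[of "y - r *\<^sub>R a" j] y by linarith
  finally have "\<delta> * r - 2 * (\<delta> / 8 * r) \<le> norm (y$i - y$j)" by simp
  moreover have "0 \<le> \<delta> * r" using \<delta> r by simp
  ultimately show "\<delta> / 2 * r \<le> norm (y$i - y$j)" by simp
qed

text \<open>Total momentum is conserved and vanishes, hence the centre of mass stays at 0. This
  makes the coordinates of \<open>Xc\<close> available at positive times.\<close>

lemma newton_sol_Xc:
  assumes sol: "newton_sol m g vel" and m: "\<forall>i. m i > 0" and "g 0 \<in> Xc m" "vel 0 \<in> Xc m" "0 \<le> t"
  shows "g t \<in> Xc m"
proof -
  note bl = bounded_linear.has_vector_derivative[OF bounded_linear_mass_sum[of m]]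
  have "((\<lambda>t. mass_sum m (vel t)) has_vector_derivative 0) (at t within {0..})" if "t \<in> {0..}" for t
    using bl[OF newton_solD(3)[OF sol m, of t]] that by (simp add: mass_sum_force)
  then obtain c where c: "\<And>t. t \<in> {0..} \<Longrightarrow> mass_sum m (vel t) = c"
    using has_vector_derivative_zero_constant[of "{0..}" "\<lambda>t. mass_sum m (vel t)"] by (metis convex_real_interval(1))
  have v: "mass_sum m (vel t) = 0" if "t \<in> {0..}" for t
    using c[OF that] c[of 0] assms(4) unfolding Xc_iff by simp
  have "((\<lambda>t. mass_sum m (g t)) has_vector_derivative 0) (at t within {0..})" if "t \<in> {0..}" for t
    using bl[OF newton_solD(2)[OF sol m, of t]] that v by simp
  then obtain c where c: "\<And>t. t \<in> {0..} \<Longrightarrow> mass_sum m (g t) = c"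
    using has_vector_derivative_zero_constant[of "{0..}" "\<lambda>t. mass_sum m (g t)"] by (metis convex_real_interval(1))
  then show ?thesis using c[of 0] c[of t] assms(3,5) unfolding Xc_iff by simp
qed

text \<open>The potential with unit masses is bounded on the compact curve, and twice this potential
  dominates each inverse distance. The bound has the form 1 / (p + 1) so that countably many values
  suffice.\<close>

lemma continuous_curve_separated:
  fixes g :: "real \<Rightarrow> (real^'d)^'n::finite"
  assumes g: "continuous_on {0..T} g" "\<And>t. t \<in> {0..T} \<Longrightarrow> g t \<in> Omega"
  shows "\<exists>p::nat. \<forall>t\<in>{0..T}. separated (1 / (real p + 1)) (g t)"
proof -
  have cpt: "compact ((\<lambda>t. Upot (\<lambda>_. 1) (g t)) ` {0..T})"
    unfolding Upot_def using g
    by (intro compact_continuous_image continuous_intros) (auto simp: Omega_def)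
  then obtain B where B: "\<And>t. t \<in> {0..T} \<Longrightarrow> Upot (\<lambda>_. 1) (g t) \<le> B"
    using compact_imp_bounded bounded_imp_bdd_above by (metis bdd_above.unfold imageI)
  obtain p :: nat where p: "2 * B \<le> real p" using real_arch_simple by blast
  have "1 / (real p + 1) \<le> norm (g t $ i - g t $ j)" if t: "t \<in> {0..T}" and ij: "i \<noteq> j" for t i j
  proof -
    have ne: "0 < norm (g t $ i - g t $ j)" using g(2)[OF t] ij unfolding Omega_def by auto
    have "1 / norm (g t $ i - g t $ j) \<le> (\<Sum>j\<in>UNIV - {i}. 1 / norm (g t $ i - g t $ j))"
      using ij by (intro member_le_sum) auto
    also have "\<dots> \<le> (\<Sum>i\<in>UNIV. \<Sum>j\<in>UNIV - {i}. 1 / norm (g t $ i - g t $ j))"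
      by (rule member_le_sum[of i UNIV "\<lambda>i. \<Sum>j\<in>UNIV - {i}. 1 / norm (g t $ i - g t $ j)"]) (auto intro!: sum_nonneg)
    also have "\<dots> \<le> 2 * B" using B[OF t] unfolding Upot_def by simp
    finally have "1 / norm (g t $ i - g t $ j) \<le> real p + 1" using p by simp
    then have "1 \<le> (real p + 1) * norm (g t $ i - g t $ j)" using ne by (simp add: divide_le_eq)
    then show ?thesis by (simp add: divide_le_eq mult.commute)
  qed
  then show ?thesis unfolding separated_def by blast
qed

text \<open>On a piece \<open>Z n p\<close> the parameter of an initial datum is the position at
  time \<open>n\<close>, not at time 0. \<open>decaying_second_order\<close> recovers the velocity
  at time \<open>n\<close> from it, and \<open>second_order_gronwall\<close> carries the estimate
  back to time 0.\<close>

lemma GR_countably_rectifiable: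
  fixes m :: "'n::finite \<Rightarrow> real" and a :: "(real^'d)^'n"
  assumes m: "\<forall>i. m i > 0" and a: "a \<in> Omega"
  shows "countably_rectifiable (CARD('d) * (CARD('n) - 1)) (GR m a)"
proof -
  define k where "k = CARD('d) * (CARD('n) - 1)"
  obtain \<delta> where \<delta>: "0 < \<delta>" "separated \<delta> a" using Omega_separated[OF a] .
  obtain \<pi> :: "(real^'d)^'n \<Rightarrow> nat \<Rightarrow> real" and C where \<pi>: "\<And>x. \<pi> x \<in> Rk k"
    "\<And>x y. x \<in> Xc m \<Longrightarrow> y \<in> Xc m \<Longrightarrow> norm (x - y) \<le> C * edist_k k (\<pi> x) (\<pi> y)"
    using Xc_coordinates[OF m, where 'd='d] unfolding k_def by blast
  define K where "K = force_const m / (\<delta> / 2)^3"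
  have K: "0 \<le> K" unfolding K_def using \<delta> force_const_nonneg[OF m] by simp
  obtain N0 :: nat where N0: "max 1 (2 * K) \<le> N0" using real_arch_simple by blast
  have "\<forall>z\<in>GR m a. \<exists>g vel. g 0 = fst z \<and> vel 0 = snd z \<and> newton_sol m g vel \<and> hyperbolic_limit g a"
    unfolding GR_def geodesic_ray_def by force
  then obtain G V where GV: "\<And>z. z \<in> GR m a \<Longrightarrow> G z 0 = fst z \<and> V z 0 = snd z \<and> newton_sol m (G z) (V z) \<and> hyperbolic_limit (G z) a"
    by metis
  have GRX: "fst z \<in> Xc m" "snd z \<in> Xc m" if "z \<in> GR m a" for z using that unfolding GR_def by auto
  note sol = GV[THEN conjunct2, THEN conjunct2, THEN conjunct1]
  \<comment> \<open>\<open>n\<close> is a time after which the motion stays in the cone,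
    \<open>p\<close> measures its distance from collisions up to then. The bound by
    \<open>N0\<close> ensures 1 <= n and 2 K <= n.\<close>
  define Z where "Z n p = {z \<in> GR m a. N0 \<le> n \<and> (\<forall>t\<ge>real n. norm (G z t - t *\<^sub>R a) \<le> \<delta> / 8 * t) \<and>
     (\<forall>t\<in>{0..real n}. separated (1 / (real p + 1)) (G z t))}" for n p :: nat
  have cover: "GR m a \<subseteq> (\<Union>l. case_prod Z (prod_decode l))"
  proof
    fix z assume z: "z \<in> GR m a"
    have "((\<lambda>t. norm (G z t - t *\<^sub>R a) / t) \<longlongrightarrow> 0) at_top" using GV[OF z] unfolding hyperbolic_limit_def by simp
    then have "eventually (\<lambda>t. norm (G z t - t *\<^sub>R a) / t < \<delta> / 8) at_top"
      using \<delta> by (intro order_tendstoD(2)) auto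
    then obtain T where T: "\<And>t. T \<le> t \<Longrightarrow> norm (G z t - t *\<^sub>R a) / t < \<delta> / 8" unfolding eventually_at_top_linorder by blast
    obtain n0 :: nat where n0: "T \<le> n0" using real_arch_simple by blast
    define n where "n = max N0 n0"
    have n: "N0 \<le> n" "T \<le> n" "0 < n" using n0 N0 unfolding n_def by auto
    have c1: "norm (G z t - t *\<^sub>R a) \<le> \<delta> / 8 * t" if "real n \<le> t" for t
      using T[of t] n that by (simp add: divide_less_eq)
    have "continuous_on {0..real n} (G z)"
      by (rule continuous_on_vector_derivative[of _ _ "V z"])
        (auto intro!: has_vector_derivative_within_subset[OF newton_solD(2)[OF sol[OF z] m]])
    then obtain p where p: "\<forall>t\<in>{0..real n}. separated (1 / (real p + 1)) (G z t)"
      using continuous_curve_separated[of "real n" "G z"] newton_solD(1)[OF sol[OF z] m] by auto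
    have "z \<in> Z n p" unfolding Z_def using z n c1 p by auto
    then have "z \<in> case_prod Z (prod_decode (prod_encode (n, p)))" by simp
    then show "z \<in> (\<Union>l. case_prod Z (prod_decode l))" by (rule UN_I[OF UNIV_I])
  qed
  show ?thesis unfolding k_def[symmetric]
  proof (rule countably_rectifiableI[OF cover])
    fix l
    obtain n p where np: "prod_decode l = (n, p)" by fastforce
    define K' where "K' = force_const m / (1 / (real p + 1))^3"
    have K': "0 \<le> K'" unfolding K'_def using force_const_nonneg[OF m] by simp
    define Q where "Q = exp ((1 + K') * real n) * (1 + (2 * K)\<^sup>2)"
    have "dist z z' \<le> (sqrt Q * C) * edist_k k (\<pi> (G z n)) (\<pi> (G z' n))" if z: "z \<in> Z n p" and z': "z' \<in> Z n p" for z z'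
    proof -
      have zG: "z \<in> GR m a" "z' \<in> GR m a" and n: "N0 \<le> n" using z z' unfolding Z_def by auto
      have n1: "1 \<le> real n" "2 * K \<le> real n" using N0 n by (auto intro: order_trans)
      define w w1 w2 where "w t = G z t - G z' t" and "w1 t = V z t - V z' t" and "w2 t = force m (G z t) - force m (G z' t)" for t
      have d1: "(w has_vector_derivative w1 t) (at t within {0..})" if "0 \<le> t" for t
        unfolding w_def[abs_def] w1_def using newton_solD(2)[OF sol[OF zG(1)] m that] newton_solD(2)[OF sol[OF zG(2)] m that]
        by (rule has_vector_derivative_diff)
      have d2: "(w1 has_vector_derivative w2 t) (at t within {0..})" if "0 \<le> t" for t
        unfolding w1_def[abs_def] w2_def using newton_solD(3)[OF sol[OF zG(1)] m that] newton_solD(3)[OF sol[OF zG(2)] m that]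
        by (rule has_vector_derivative_diff)
      have far: "norm (G z t - t *\<^sub>R a) \<le> \<delta> / 8 * t" "norm (G z' t - t *\<^sub>R a) \<le> \<delta> / 8 * t" if "real n \<le> t" for t
        using z z' that unfolding Z_def by auto
      have "norm (w1 n) \<le> 2 * K / (real n)^2 * norm (w n)"
      proof (rule decaying_second_order[where B="\<delta> / 4" and ?w2.0 = w2])
        fix t assume t: "real n \<le> t"
        then have t0: "0 < t" using n1 by simp
        have "norm (w2 t) \<le> force_const m / (\<delta> / 2 * t)^3 * norm (w t)"
          unfolding w2_def w_def using t0 \<delta>(1)
          by (intro force_lipschitz[OF m] cone_separated[OF \<delta>(2) far(1)[OF t]] cone_separated[OF \<delta>(2) far(2)[OF t]]) auto
        also have "force_const m / (\<delta> / 2 * t)^3 = K / t^3" unfolding K_def power_mult_distrib by simp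
        finally show "norm (w2 t) \<le> K / t^3 * norm (w t)" .
        have "norm (w t) \<le> norm (G z t - t *\<^sub>R a) + norm (G z' t - t *\<^sub>R a)"
          unfolding w_def using norm_triangle_ineq4[of "G z t - t *\<^sub>R a" "G z' t - t *\<^sub>R a"] by simp
        then show "norm (w t) \<le> \<delta> / 4 * t" using far[OF t] by simp
      next
        have l: "((\<lambda>t. norm (G z t - t *\<^sub>R a) / t + norm (G z' t - t *\<^sub>R a) / t) \<longlongrightarrow> 0 + 0) at_top"
          using GV[OF zG(1)] GV[OF zG(2)] unfolding hyperbolic_limit_def by (intro tendsto_add) auto
        show "((\<lambda>t. norm (w t) / t) \<longlongrightarrow> 0) at_top"
        proof (rule Lim_null_comparison)
          show "eventually (\<lambda>t. norm (norm (w t) / t) \<le> norm (G z t - t *\<^sub>R a) / t + norm (G z' t - t *\<^sub>R a) / t) at_top"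
            using eventually_gt_at_top[of 0]
          proof eventually_elim
            fix t :: real assume "0 < t"
            then show "norm (norm (w t) / t) \<le> norm (G z t - t *\<^sub>R a) / t + norm (G z' t - t *\<^sub>R a) / t"
              unfolding w_def using norm_triangle_ineq4[of "G z t - t *\<^sub>R a" "G z' t - t *\<^sub>R a"]
              by (simp add: add_divide_distrib[symmetric] divide_right_mono)
          qed
        qed (use l in simp)
      qed (use n1 K d1 d2 in auto)
      also have "\<dots> \<le> 2 * K * norm (w n)"
      proof -
        have "1 \<le> (real n)^2" using n1 by (simp add: one_le_power)
        then have "2 * K / (real n)^2 \<le> 2 * K / 1" using K n1 by (intro divide_left_mono) auto
        then show ?thesis by (intro mult_right_mono) auto
      qed
      finally have w1n: "(norm (w1 n))\<^sup>2 \<le> (2 * K)\<^sup>2 * (norm (w n))\<^sup>2"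
        by (metis norm_ge_zero power_mono power_mult_distrib)
      have "(norm (w 0))\<^sup>2 + (norm (w1 0))\<^sup>2 \<le> exp ((1 + K') * real n) * ((norm (w n))\<^sup>2 + (norm (w1 n))\<^sup>2)"
      proof (rule second_order_gronwall[OF _ K'])
        fix t assume t: "0 \<le> t" "t \<le> real n"
        then have "separated (1 / (real p + 1)) (G z t)" "separated (1 / (real p + 1)) (G z' t)"
          using z z' unfolding Z_def by auto
        then show "norm (w2 t) \<le> K' * norm (w t)" unfolding w2_def w_def K'_def
          by (intro force_lipschitz[OF m]) auto
      qed (use d1 d2 in auto)
      also have "\<dots> \<le> exp ((1 + K') * real n) * ((norm (w n))\<^sup>2 + (2 * K)\<^sup>2 * (norm (w n))\<^sup>2)"
        using w1n by (intro mult_left_mono add_left_mono) auto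
      also have "\<dots> = Q * (norm (w n))\<^sup>2" unfolding Q_def by (simp add: algebra_simps)
      finally have "sqrt ((norm (w 0))\<^sup>2 + (norm (w1 0))\<^sup>2) \<le> sqrt (Q * (norm (w n))\<^sup>2)" by (rule real_sqrt_le_mono)
      also have "\<dots> = sqrt Q * norm (w n)" by (simp add: real_sqrt_mult)
      finally have "dist z z' \<le> sqrt Q * norm (w n)"
        using GV[OF zG(1)] GV[OF zG(2)] unfolding w_def w1_def dist_norm norm_prod_def by simp
      also have "\<dots> \<le> sqrt Q * (C * edist_k k (\<pi> (G z n)) (\<pi> (G z' n)))"
      proof (rule mult_left_mono)
        have "G z n \<in> Xc m" "G z' n \<in> Xc m"
          using newton_sol_Xc[OF sol[OF zG(1)] m, of "real n"] newton_sol_Xc[OF sol[OF zG(2)] m, of "real n"]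
            GV[OF zG(1)] GV[OF zG(2)] GRX[OF zG(1)] GRX[OF zG(2)] by auto
        then show "norm (w n) \<le> C * edist_k k (\<pi> (G z n)) (\<pi> (G z' n))" unfolding w_def by (rule \<pi>(2))
        show "0 \<le> sqrt Q" unfolding Q_def by (intro real_sqrt_ge_zero mult_nonneg_nonneg) auto
      qed
      finally show ?thesis by simp
    qed
    then show "\<exists>\<pi> L. (\<forall>z\<in>case_prod Z (prod_decode l). \<pi> z \<in> Rk k) \<and>
      (\<forall>z\<in>case_prod Z (prod_decode l). \<forall>w\<in>case_prod Z (prod_decode l). dist z w \<le> L * edist_k k (\<pi> z) (\<pi> w))"
      unfolding np using \<pi>(1) by (intro exI[of _ "\<lambda>z. \<pi> (G z n)"] exI[of _ "sqrt Q * C"]) auto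
  qed
qed

section \<open>Solutions with prescribed asymptotic velocity\<close>

lemma at_within_Icc_Ici: "at t within {0..t+1} = at t within {0::real..}"
  by (rule at_within_nhd[of t "{..<t+1}"]) auto

lemma integral_has_vector_derivative_Ici:
  fixes f :: "real \<Rightarrow> 'a::banach"
  assumes "continuous_on {0..} f" "0 \<le> t"
  shows "((\<lambda>s. integral {0..s} f) has_vector_derivative f t) (at t within {0..})"
proof -
  have "((\<lambda>s. integral {0..s} f) has_vector_derivative f t) (at t within {0..t+1})"
    by (rule integral_has_vector_derivative[OF continuous_on_subset[OF assms(1)]]) (use assms(2) in auto)
  then show ?thesis by (simp only: at_within_Icc_Ici)
qed

lemma inverse_square_has_integral:
  fixes R C t :: real
  assumes "0 < R" "0 \<le> C" "0 \<le> t"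
  shows "((\<lambda>s. C / (R + s)^2) has_integral (C / (R + t))) {t..}"
proof (rule has_integral_to_inf)
  have hi: "((\<lambda>s. C / (R + s)^2) has_integral (- (C / (R + y)) - - (C / (R + t)))) {t..y}" if "t \<le> y" for y
  proof (rule fundamental_theorem_of_calculus[OF that])
    fix s assume "s \<in> {t..y}"
    then have "((\<lambda>s. - (C / (R + s))) has_real_derivative (C / (R + s)^2)) (at s within {t..y})"
      using assms by (auto intro!: derivative_eq_intros simp: power2_eq_square)
    then show "((\<lambda>s. - (C / (R + s))) has_vector_derivative (C / (R + s)^2)) (at s within {t..y})"
      unfolding has_real_derivative_iff_has_vector_derivative .
  qed
  show "(\<lambda>s. C / (R + s)^2) integrable_on {t..y}" for y
    using hi[of y] by (cases "t \<le> y") (auto simp: integrable_on_def)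
  have "((\<lambda>y. - (C / (R + y)) - - (C / (R + t))) \<longlongrightarrow> - 0 - - (C / (R + t))) at_top"
    by (intro tendsto_intros tendsto_divide_0[OF tendsto_const] filterlim_at_top_imp_at_infinity
        filterlim_tendsto_add_at_top[OF tendsto_const] filterlim_ident)
  moreover have "eventually (\<lambda>y. - (C / (R + y)) - - (C / (R + t)) = integral {t..y} (\<lambda>s. C / (R + s)^2)) at_top"
    using eventually_ge_at_top[of t] by eventually_elim (rule integral_unique[OF hi, symmetric])
  ultimately show "((\<lambda>y. integral {t..y} (\<lambda>s. C / (R + s)^2)) \<longlongrightarrow> C / (R + t)) at_top"
    by (simp add: filterlim_cong[OF refl refl])
qed (use assms in auto)

text \<open>Comparison with C / (R + s)^2, whose tail is C / (R + t). Applied to the force along a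
  curve, the tail is the amount by which the velocity still differs from its limit.\<close>

lemma tail_integral:
  fixes G :: "real \<Rightarrow> 'a::euclidean_space"
  assumes R: "0 < R" and C: "0 \<le> C" and G: "continuous_on {0..} G" "\<And>t. 0 \<le> t \<Longrightarrow> norm (G t) \<le> C / (R + t)^2"
  shows tail_integrable: "\<And>t. 0 \<le> t \<Longrightarrow> G integrable_on {t..}"
    and tail_bound: "\<And>t. 0 \<le> t \<Longrightarrow> norm (integral {t..} G) \<le> C / (R + t)"
    and tail_derivative: "\<And>t. 0 \<le> t \<Longrightarrow> ((\<lambda>t. integral {t..} G) has_vector_derivative - G t) (at t within {0..})"
proof -
  show int: "G integrable_on {t..}" if "0 \<le> t" for t
  proof (rule measurable_bounded_by_integrable_imp_integrable)
    show "(\<lambda>s. C / (R + s)^2) integrable_on {t..}" using inverse_square_has_integral[OF R C that] by (auto simp: integrable_on_def)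
    show "G \<in> borel_measurable (lebesgue_on {t..})"
      by (rule continuous_imp_measurable_on_sets_lebesgue[OF continuous_on_subset[OF G(1)]]) (use that in auto)
    show "{t..} \<in> sets lebesgue" by simp
  qed (use G(2) that in auto)
  show "norm (integral {t..} G) \<le> C / (R + t)" if "0 \<le> t" for t
  proof -
    have "norm (integral {t..} G) \<le> integral {t..} (\<lambda>s. C / (R + s)^2)"
      using inverse_square_has_integral[OF R C that] int[OF that] G(2) that
      by (intro integral_norm_bound_integral) (auto simp: integrable_on_def)
    also have "\<dots> = C / (R + t)" using inverse_square_has_integral[OF R C that] by (rule integral_unique)
    finally show ?thesis .
  qed
  show "((\<lambda>t. integral {t..} G) has_vector_derivative - G t) (at t within {0..})" if t: "0 \<le> t" for t
  proof -
    have eq: "integral {s..} G = integral {0..} G - integral {0..s} G" if s: "s \<in> {0..}" for s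
    proof -
      have i1: "(G has_integral integral {0..s} G) {0..s}"
        using integrable_continuous_real[OF continuous_on_subset[OF G(1), of "{0..s}"]] by auto
      have i2: "(G has_integral integral {s..} G) {s..}" using int[of s] s by auto
      have n: "negligible ({0..s} \<inter> {s..})" by (rule negligible_subset[of "{s}"]) auto
      have "{0..s} \<union> {s..} = {0..}" using s by auto
      then have "(G has_integral (integral {0..s} G + integral {s..} G)) {0..}"
        using has_integral_Un[OF i1 i2 n] by simp
      then have "integral {0..} G = integral {0..s} G + integral {s..} G" by (rule integral_unique)
      then show ?thesis by simp
    qed
    have "((\<lambda>s. integral {0..s} G) has_vector_derivative G t) (at t within {0..})"
      by (rule integral_has_vector_derivative_Ici[OF G(1) t])
    then have dd: "((\<lambda>s. integral {0..} G - integral {0..s} G) has_vector_derivative - G t) (at t within {0..})"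
      by (auto intro!: derivative_eq_intros)
    show ?thesis
      by (rule has_vector_derivative_transform[OF _ eq dd]) (use t in auto)
  qed
qed

text \<open>The solution leaving \<open>x\<close> with asymptotic velocity \<open>a\<close> is \<open>x + t a + (R + t) b(t)\<close>, where \<open>b\<close> is
  the fixed point of \<open>b(t) = - (1 / (R + t)) \<integral>\<^sub>0\<^sup>t \<integral>\<^sub>\<tau>\<^sup>\<infinity> force (x + s a + (R + s) b(s)) ds d\<tau>\<close>,
  a contraction in the sup norm when \<open>R\<close> is large.\<close>

lemma hyperbolic_solution_exists:
  fixes m :: "'n::finite \<Rightarrow> real" and a x :: "(real^'d)^'n"
  assumes m: "\<forall>i. m i > 0" and \<delta>: "0 < \<delta>" "separated \<delta> a"
    and R: "0 < R" "force_const m / (\<delta> / 2)^2 / R \<le> \<delta> / 16" "force_const m / (\<delta> / 2)^3 / R \<le> 1 / 2"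
    and x: "norm (x - R *\<^sub>R a) \<le> \<delta> / 16 * R"
  obtains y v where "y 0 = x"
    "\<And>t. 0 \<le> t \<Longrightarrow> (y has_vector_derivative v t) (at t within {0..})"
    "\<And>t. 0 \<le> t \<Longrightarrow> (v has_vector_derivative force m (y t)) (at t within {0..})"
    "\<And>t. 0 \<le> t \<Longrightarrow> norm (y t - (R + t) *\<^sub>R a) \<le> \<delta> / 8 * (R + t)"
    "\<And>t. 0 \<le> t \<Longrightarrow> norm (v t - a) \<le> force_const m / (\<delta> / 2)^2 / (R + t)"
    "mass_sum m (v 0) = mass_sum m a"
proof -
  define C1 where "C1 = force_const m / (\<delta> / 2)^2"
  define C2 where "C2 = force_const m / (\<delta> / 2)^3"
  have C1: "0 \<le> C1" "C1 / R \<le> \<delta> / 16" and C2: "0 \<le> C2" "C2 / R \<le> 1 / 2"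
    using force_const_nonneg[OF m] \<delta> R unfolding C1_def C2_def by auto
  define Y where "Y b t = x + t *\<^sub>R a + (R + t) *\<^sub>R apply_bcontfun b t" for b :: "real \<Rightarrow>\<^sub>C ((real^'d)^'n)" and t
  define G where "G b t = force m (Y b t)" for b t
  define P where "P b t = integral {t..} (G b)" for b t
  define H where "H b t = - (1 / (R + t)) *\<^sub>R integral {0..t} (P b)" for b t
  \<comment> \<open>Bounded continuous functions live on the whole real line; \<open>max 0 t\<close>
    extends the values constantly to negative times.\<close>
  define \<Phi> where "\<Phi> b = Bcontfun (\<lambda>t. H b (max 0 t))" for b
  \<comment> \<open>The radius \<delta> / 16 and the deviation \<delta> / 16 allowed for
    \<open>x\<close> add up to the opening \<delta> / 8 of the cone in
    \<open>cone_separated\<close>.\<close>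
  define S where "S = cball (0 :: real \<Rightarrow>\<^sub>C ((real^'d)^'n)) (\<delta> / 16)"
  have bS: "norm (apply_bcontfun b t) \<le> \<delta> / 16" if "b \<in> S" for b t
    using that norm_bounded[of b t] unfolding S_def by auto
  have near: "norm (Y b t - (R + t) *\<^sub>R a) \<le> \<delta> / 8 * (R + t)" if b: "b \<in> S" and t: "0 \<le> t" for b t
  proof -
    have "Y b t - (R + t) *\<^sub>R a = (x - R *\<^sub>R a) + (R + t) *\<^sub>R apply_bcontfun b t"
      unfolding Y_def by (simp add: algebra_simps)
    also have "norm \<dots> \<le> \<delta> / 16 * R + (R + t) * (\<delta> / 16)"
      using x bS[OF b, of t] R(1) t by (intro norm_triangle_le add_mono) (auto intro!: mult_left_mono)
    also have "\<dots> \<le> \<delta> / 16 * (R + t) + (R + t) * (\<delta> / 16)"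
      using \<delta>(1) t by (intro add_right_mono mult_left_mono) auto
    also have "\<dots> = \<delta> / 8 * (R + t)" by (simp add: field_simps)
    finally show ?thesis .
  qed
  have sep: "separated (\<delta> / 2 * (R + t)) (Y b t)" if "b \<in> S" "0 \<le> t" for b t
    using cone_separated[OF \<delta>(2) near[OF that] _ \<delta>(1)] R(1) that by simp
  have contG: "continuous_on {0..} (G b)" if "b \<in> S" for b
    unfolding G_def
  proof (rule continuous_on_force[OF m, of "\<delta> / 2 * R"])
    show "continuous_on {0..} (Y b)" unfolding Y_def by (intro continuous_intros continuous_on_apply_bcontfun)
  qed (use \<delta>(1) R(1) in \<open>auto intro!: separated_mono[OF sep[OF that]]\<close>)
  have boundG: "norm (G b t) \<le> C1 / (R + t)^2" if "b \<in> S" "0 \<le> t" for b t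
  proof -
    have "norm (G b t) \<le> force_const m / (\<delta> / 2 * (R + t))^2"
      unfolding G_def using \<delta>(1) R(1) that by (intro force_bound[OF m _ sep]) auto
    also have "\<dots> = C1 / (R + t)^2" unfolding C1_def power_mult_distrib by simp
    finally show ?thesis .
  qed
  have tail1: "G b integrable_on {t..}" and tail2: "norm (P b t) \<le> C1 / (R + t)"
    and tail3: "(P b has_vector_derivative - G b t) (at t within {0..})" if "b \<in> S" "0 \<le> t" for b t
    unfolding P_def using tail_integral[OF R(1) C1(1) contG[OF that(1)] boundG[OF that(1)] that(2)] by auto
  have contP: "continuous_on {0..} (P b)" if "b \<in> S" for b
    by (rule continuous_on_vector_derivative[of _ _ "\<lambda>t. - G b t"])
      (use tail3[OF that] in auto)
  have Pint: "P b integrable_on {0..t}" if "b \<in> S" for b t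
    by (rule integrable_continuous_real[OF continuous_on_subset[OF contP[OF that]]]) auto
  have R_le: "C / (R + t) \<le> C / R" if "0 \<le> C" "0 \<le> t" for C t
    using that R(1) by (intro divide_left_mono) auto
  have Pbound: "norm (P b t) \<le> C1 / R" if "b \<in> S" "0 \<le> t" for b t
    using tail2[OF that] R_le[OF C1(1) that(2)] by linarith
  have iP: "norm (integral {0..t} f) \<le> D * t" if "continuous_on {0..} f" "\<And>s. 0 \<le> s \<Longrightarrow> norm (f s) \<le> D" "0 \<le> t" for f :: "real \<Rightarrow> (real^'d)^'n" and D t
  proof -
    have "norm (integral {0..t} f) \<le> D * (t - 0)"
      using that by (intro integral_bound) (auto intro: continuous_on_subset)
    then show ?thesis by simp
  qed
  have frac: "(1 / (R + t)) * (D * t) \<le> D" if "0 \<le> D" "0 \<le> t" for D t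
  proof -
    have "D * t \<le> D * (R + t)" using that R(1) by (intro mult_left_mono) auto
    then show ?thesis using that R(1) by (simp add: divide_le_eq)
  qed
  have Hbound: "norm (H b t) \<le> C1 / R" if "b \<in> S" "0 \<le> t" for b t
  proof -
    have "norm (H b t) = (1 / (R + t)) * norm (integral {0..t} (P b))" unfolding H_def using R(1) that by simp
    also have "\<dots> \<le> (1 / (R + t)) * (C1 / R * t)"
      using iP[OF contP[OF that(1)] Pbound[OF that(1)] that(2)] R(1) that by (intro mult_left_mono) auto
    also have "\<dots> \<le> C1 / R" using frac[of "C1 / R" t] C1 R(1) that by simp
    finally show ?thesis .
  qed
  have contH: "continuous_on {0..} (H b)" if b: "b \<in> S" for b
  proof -
    have "continuous_on {0..} (\<lambda>t. integral {0..t} (P b))"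
      by (rule continuous_on_vector_derivative[OF integral_has_vector_derivative_Ici[OF contP[OF b]]]) simp
    then show ?thesis unfolding H_def by (intro continuous_intros) (use R(1) in auto)
  qed
  have app: "apply_bcontfun (\<Phi> b) t = H b (max 0 t)" if b: "b \<in> S" for b t
  proof -
    have "(\<lambda>t. H b (max 0 t)) \<in> bcontfun"
    proof (rule bcontfun_normI[where b="C1 / R"])
      show "continuous_on UNIV (\<lambda>t. H b (max 0 t))"
        by (rule continuous_on_compose2[OF contH[OF b]]) (auto intro!: continuous_intros)
    qed (use Hbound[OF b] in auto)
    then show ?thesis unfolding \<Phi>_def by (simp add: Bcontfun_inverse)
  qed
  have maps: "\<Phi> ` S \<subseteq> S"
  proof safe
    fix b assume b: "b \<in> S"
    have "norm (\<Phi> b) \<le> \<delta> / 16"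
    proof (rule norm_bound)
      fix t show "norm (apply_bcontfun (\<Phi> b) t) \<le> \<delta> / 16"
        unfolding app[OF b] using Hbound[OF b max.cobounded1[of 0 t]] C1(2) by linarith
    qed
    then show "\<Phi> b \<in> S" unfolding S_def by simp
  qed
  have contr: "dist (\<Phi> b) (\<Phi> c) \<le> 1 / 2 * dist b c" if b: "b \<in> S" and c: "c \<in> S" for b c
  proof -
    define D where "D = dist b c"
    have D: "0 \<le> D" unfolding D_def by simp
    \<comment> \<open>The Lipschitz constant of the force decays like (R + t)^-3; the weight R + t
      in \<open>Y\<close> uses up one power, and an integrable inverse square remains.\<close>
    have diffG: "norm (G b t - G c t) \<le> C2 * D / (R + t)^2" if t: "0 \<le> t" for t
    proof -
      have pos: "0 < \<delta> / 2 * (R + t)" using \<delta>(1) R(1) t by simp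
      have "norm (Y b t - Y c t) = (R + t) * norm (apply_bcontfun b t - apply_bcontfun c t)"
        unfolding Y_def using R(1) t by (simp add: scaleR_diff_right[symmetric])
      also have "\<dots> \<le> (R + t) * D"
        using dist_bounded[of b t c] R(1) t unfolding D_def dist_norm[symmetric] by (intro mult_left_mono) auto
      finally have Yd: "norm (Y b t - Y c t) \<le> (R + t) * D" .
      have "norm (G b t - G c t) \<le> force_const m / (\<delta> / 2 * (R + t))^3 * norm (Y b t - Y c t)"
        unfolding G_def by (rule force_lipschitz[OF m pos sep[OF b t] sep[OF c t]])
      also have "\<dots> \<le> force_const m / (\<delta> / 2 * (R + t))^3 * ((R + t) * D)"
        using force_const_nonneg[OF m] pos by (intro mult_left_mono Yd divide_nonneg_nonneg) auto
      also have "\<dots> = C2 * D / (R + t)^2"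
        unfolding C2_def power_mult_distrib using R(1) t by (simp add: power3_eq_cube power2_eq_square)
      finally show ?thesis .
    qed
    have cG: "continuous_on {0..} (\<lambda>t. G b t - G c t)" by (intro continuous_intros contG b c)
    have diffP: "norm (P b t - P c t) \<le> C2 * D / R" if t: "0 \<le> t" for t
    proof -
      have "P b t - P c t = integral {t..} (\<lambda>t. G b t - G c t)"
        unfolding P_def by (rule integral_diff[symmetric]) (use tail1 b c t in auto)
      also have "norm \<dots> \<le> C2 * D / (R + t)"
        by (rule tail_integral(2)[OF R(1) _ cG diffG t]) (use C2 D in auto)
      also have "\<dots> \<le> C2 * D / R" using R_le[of "C2 * D" t] C2 D t by simp
      finally show ?thesis .
    qed
    have diffH: "norm (H b t - H c t) \<le> 1 / 2 * D" if t: "0 \<le> t" for t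
    proof -
      have "H b t - H c t = - (1 / (R + t)) *\<^sub>R integral {0..t} (\<lambda>s. P b s - P c s)"
        unfolding H_def using Pint b c by (simp add: integral_diff algebra_simps)
      then have "norm (H b t - H c t) = (1 / (R + t)) * norm (integral {0..t} (\<lambda>s. P b s - P c s))" using R(1) t by simp
      also have "\<dots> \<le> (1 / (R + t)) * (C2 * D / R * t)"
        by (rule mult_left_mono[OF iP[OF _ diffP t]]) (use contP b c R(1) t in \<open>auto intro!: continuous_intros\<close>)
      also have "\<dots> \<le> C2 * D / R" using frac[of "C2 * D / R" t] C2 D R(1) t by simp
      also have "\<dots> = C2 / R * D" by simp
      also have "\<dots> \<le> 1 / 2 * D" using C2(2) D by (intro mult_right_mono)
      finally show ?thesis .
    qed
    show ?thesis unfolding D_def[symmetric]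
    proof (rule dist_bound)
      fix t show "dist (apply_bcontfun (\<Phi> b) t) (apply_bcontfun (\<Phi> c) t) \<le> 1 / 2 * D"
        unfolding app[OF b] app[OF c] dist_norm by (rule diffH) simp
    qed
  qed
  have "\<exists>!b\<in>S. \<Phi> b = b"
    by (rule Banach_fix[where c="1/2"]) (use maps contr \<delta>(1) in \<open>auto simp: S_def complete_eq_closed\<close>)
  then obtain b where b: "b \<in> S" "\<Phi> b = b" by blast
  have fixb: "apply_bcontfun b t = H b t" if "0 \<le> t" for t
    using app[OF b(1), of t] b(2) that by simp
  have Yeq: "Y b t = x + t *\<^sub>R a - integral {0..t} (P b)" if "0 \<le> t" for t
    unfolding Y_def fixb[OF that] H_def using R(1) that by simp
  show ?thesis
  proof (rule that[of "Y b" "\<lambda>t. a - P b t"])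
    show "Y b 0 = x" using Yeq[of 0] by simp
    fix t :: real assume t: "0 \<le> t"
    have "((\<lambda>s. integral {0..s} (P b)) has_vector_derivative P b t) (at t within {0..})"
      by (rule integral_has_vector_derivative_Ici[OF contP[OF b(1)] t])
    then have "((\<lambda>t. x + t *\<^sub>R a - integral {0..t} (P b)) has_vector_derivative (a - P b t)) (at t within {0..})"
      by (auto intro!: derivative_eq_intros)
    then show "(Y b has_vector_derivative (a - P b t)) (at t within {0..})"
      by (rule has_vector_derivative_transform[rotated 2]) (use t Yeq in auto)
    have "((\<lambda>t. a - P b t) has_vector_derivative (0 - - G b t)) (at t within {0..})"
      by (intro has_vector_derivative_diff has_vector_derivative_const tail3 b(1) t)
    then show "((\<lambda>t. a - P b t) has_vector_derivative force m (Y b t)) (at t within {0..})" unfolding G_def by simp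
    show "norm (Y b t - (R + t) *\<^sub>R a) \<le> \<delta> / 8 * (R + t)" by (rule near[OF b(1) t])
    show "norm ((a - P b t) - a) \<le> force_const m / (\<delta> / 2)^2 / (R + t)"
      using tail2[OF b(1) t] unfolding C1_def by simp
  next
    have "mass_sum m (P b 0) = integral {0..} (mass_sum m \<circ> G b)"
      unfolding P_def by (rule integral_linear[symmetric]) (use tail1 b(1) bounded_linear_mass_sum in auto)
    also have "mass_sum m \<circ> G b = (\<lambda>_. 0)" unfolding G_def by (auto simp: mass_sum_force)
    finally show "mass_sum m (a - P b 0) = mass_sum m a"
      by (simp add: linear_diff[OF bounded_linear.linear[OF bounded_linear_mass_sum]])
  qed
qed

section \<open>Minimality of the far solutions\<close>

lemma has_vector_derivative_shift:
  fixes g :: "real \<Rightarrow> 'a::real_normed_vector"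
  assumes "(g has_vector_derivative D) (at (u + c) within {0..})" "0 \<le> s + c" "u \<in> {s..t}"
  shows "((\<lambda>u. g (u + c)) has_vector_derivative D) (at u within {s..t})"
proof -
  have 1: "((\<lambda>u. u + c) has_vector_derivative 1) (at u within {s..t})" by (auto intro!: derivative_eq_intros)
  have 2: "(g has_vector_derivative D) (at (u + c) within (\<lambda>u. u + c) ` {s..t})"
    by (rule has_vector_derivative_within_subset[OF assms(1)]) (use assms(2) in auto)
  show ?thesis using vector_diff_chain_within[OF 1 2] by (simp add: o_def)
qed

lemma continuous_on_shift:
  assumes "continuous_on {0::real..} g" "0 \<le> s + c"
  shows "continuous_on {s..t} (\<lambda>u. g (u + c))"
  by (rule continuous_on_compose2[OF assms(1)]) (use assms(2) in \<open>auto intro!: continuous_intros\<close>)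

lemma Upot_nonneg: "\<forall>i. m i > 0 \<Longrightarrow> 0 \<le> Upot m x"
  unfolding Upot_def by (intro divide_nonneg_nonneg sum_nonneg mult_nonneg_nonneg) (auto simp: less_imp_le)

lemma Upot_le:
  fixes x :: "(real^'d)^'n::finite"
  assumes m: "\<forall>i. m i > 0" and "0 < \<rho>" "separated \<rho> x"
  shows "Upot m x \<le> (\<Sum>i\<in>UNIV. \<Sum>j\<in>UNIV - {i}. m i * m j) / 2 / \<rho>"
proof -
  have "(\<Sum>i\<in>UNIV. \<Sum>j\<in>UNIV - {i}. m i * m j / norm (x$i - x$j)) \<le> (\<Sum>i\<in>UNIV. \<Sum>j\<in>UNIV - {i}. m i * m j / \<rho>)"
  proof (intro sum_mono)
    fix i j :: 'n assume "j \<in> UNIV - {i}"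
    then have "\<rho> \<le> norm (x$i - x$j)" using assms(3) unfolding separated_def by auto
    moreover have "0 \<le> m i * m j" using m by (simp add: less_imp_le)
    ultimately show "m i * m j / norm (x$i - x$j) \<le> m i * m j / \<rho>"
      using \<open>0 < \<rho>\<close> by (intro frac_le) auto
  qed
  also have "\<dots> = (\<Sum>i\<in>UNIV. \<Sum>j\<in>UNIV - {i}. m i * m j) / \<rho>" by (simp add: sum_divide_distrib)
  finally show ?thesis unfolding Upot_def
    using divide_right_mono[of _ "(\<Sum>i\<in>UNIV. \<Sum>j\<in>UNIV - {i}. m i * m j) / \<rho>" 2] by (simp only: divide_divide_eq_left mult.commute)
qed

lemma power2_mnorm: "\<forall>i. m i > 0 \<Longrightarrow> (mnorm m x)\<^sup>2 = minner m x x"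
  unfolding mnorm_def by (simp add: minner_nonneg)

text \<open>The perturbation terms cost at most 1/4 + 1/4 + 1/16 of |p|^2.\<close>

lemma inner_perturbed_nonneg:
  fixes p f g :: "'a::real_inner"
  assumes "norm f \<le> norm p / 4" "norm g \<le> norm p / 4"
  shows "0 \<le> (p + f) \<bullet> (p + g)"
proof -
  have a: "\<bar>p \<bullet> g\<bar> \<le> norm p * (norm p / 4)"
    using Cauchy_Schwarz_ineq2[of p g] mult_left_mono[OF assms(2), of "norm p"] by simp
  have b: "\<bar>f \<bullet> p\<bar> \<le> (norm p / 4) * norm p"
    using Cauchy_Schwarz_ineq2[of f p] mult_right_mono[OF assms(1), of "norm p"] by simp
  have c: "\<bar>f \<bullet> g\<bar> \<le> (norm p / 4) * (norm p / 4)"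
    using Cauchy_Schwarz_ineq2[of f g] mult_mono[OF assms] by (auto intro: order_trans)
  have "(p + f) \<bullet> (p + g) = norm p * norm p + p \<bullet> g + f \<bullet> p + f \<bullet> g"
    by (simp add: inner_add_left inner_add_right flip: power2_norm_eq_inner power2_eq_square)
  moreover have "0 \<le> norm p * norm p" by simp
  ultimately show ?thesis using a b c by (simp add: abs_le_iff)
qed

text \<open>The two thresholds for \<open>R\<close> have separate tasks: C / R <= \<delta> / 16
  keeps the relative velocities aligned with those of \<open>a\<close>, and the bound with the total
  mass, 2 K <= R below, lets kinetic energy absorb the error of the potential.\<close>

locale far_solution =
  fixes m :: "'n::finite \<Rightarrow> real" and a :: "(real^'d)^'n" and y v :: "real \<Rightarrow> (real^'d)^'n" and \<delta> R C :: real
  assumes m: "\<forall>i. m i > 0" and \<delta>: "0 < \<delta>" "separated \<delta> a" and R: "0 < R" "2 * ((\<Sum>i\<in>UNIV. m i) / (\<delta> / 2)^3) \<le> R"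
    and C: "0 \<le> C" "C / R \<le> \<delta> / 16"
    and y': "\<And>t. 0 \<le> t \<Longrightarrow> (y has_vector_derivative v t) (at t within {0..})"
    and v': "\<And>t. 0 \<le> t \<Longrightarrow> (v has_vector_derivative force m (y t)) (at t within {0..})"
    and near: "\<And>t. 0 \<le> t \<Longrightarrow> norm (y t - (R + t) *\<^sub>R a) \<le> \<delta> / 8 * (R + t)"
    and vel: "\<And>t. 0 \<le> t \<Longrightarrow> norm (v t - a) \<le> C / (R + t)"
begin

definition "K = (\<Sum>i\<in>UNIV. m i) / (\<delta> / 2)^3"

lemma K_nonneg: "0 \<le> K"
  unfolding K_def using m \<delta> by (intro divide_nonneg_nonneg sum_nonneg) (auto simp: less_imp_le)

lemma sep: "0 \<le> t \<Longrightarrow> separated (\<delta> / 2 * (R + t)) (y t)"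
  using cone_separated[OF \<delta>(2) near _ \<delta>(1)] R(1) by simp

lemma in_Omega: "0 \<le> t \<Longrightarrow> y t \<in> Omega"
  using separated_Omega[OF sep] \<delta>(1) R(1) by simp

lemma y_at: "0 < t \<Longrightarrow> (y has_vector_derivative v t) (at t)"
  using y'[of t] at_within_Ici_pos[of t] by simp

lemma v_at: "0 < t \<Longrightarrow> (v has_vector_derivative force m (y t)) (at t)"
  using v'[of t] at_within_Ici_pos[of t] by simp

lemma continuous_y: "continuous_on {0..} y"
  by (rule continuous_on_vector_derivative[of _ _ v]) (use y' in auto)

lemma continuous_v: "continuous_on {0..} v"
  by (rule continuous_on_vector_derivative[of _ _ "\<lambda>t. force m (y t)"]) (use v' in auto)

text \<open>For every pair of bodies the relative position, rescaled by R + s, and the relative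
  velocity are both within a quarter of |a_i - a_j| of a_i - a_j, so their inner product is
  nonnegative; attraction supplies the sign. The two times may differ, which the monotonicity of
  \<open>minner m (v t) (v x)\<close> in \<open>t\<close> requires.\<close>

lemma force_v_nonpos:
  assumes "0 \<le> s" "0 \<le> t"
  shows "minner m (force m (y s)) (v t) \<le> 0"
proof -
  have "0 \<le> m i * m j * ((y s$i - y s$j) \<bullet> (v t$i - v t$j)) / norm (y s$i - y s$j)^3" if "i \<noteq> j" for i j
  proof -
    define p where "p = a$i - a$j"
    define f where "f = (1 / (R + s)) *\<^sub>R ((y s - (R + s) *\<^sub>R a)$i - (y s - (R + s) *\<^sub>R a)$j)"
    define g where "g = (v t - a)$i - (v t - a)$j"
    have p: "\<delta> \<le> norm p" using \<delta>(2) that unfolding separated_def p_def by auto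
    have Rs: "0 < R + s" "0 < R + t" using R(1) assms by auto
    have two: "norm (x$i - x$j) \<le> 2 * norm x" for x :: "(real^'d)^'n"
      using norm_triangle_ineq4[of "x$i" "x$j"] Finite_Cartesian_Product.norm_nth_le[of x i] Finite_Cartesian_Product.norm_nth_le[of x j] by linarith
    have "norm f \<le> (1 / (R + s)) * (2 * (\<delta> / 8 * (R + s)))"
      unfolding f_def norm_scaleR using two[of "y s - (R + s) *\<^sub>R a"] near[OF assms(1)] Rs by (intro mult_mono) auto
    then have f: "norm f \<le> norm p / 4" using p Rs by simp
    have "C / (R + t) \<le> C / R" using C R(1) assms by (intro divide_left_mono) auto
    then have "norm (v t - a) \<le> \<delta> / 16" using vel[OF assms(2)] C by linarith
    then have g: "norm g \<le> norm p / 4" unfolding g_def using two[of "v t - a"] p norm_ge_zero[of "v t - a"] by linarith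
    have "(R + s) *\<^sub>R f = (y s - (R + s) *\<^sub>R a)$i - (y s - (R + s) *\<^sub>R a)$j" unfolding f_def using Rs by simp
    then have ys: "y s$i - y s$j = (R + s) *\<^sub>R (p + f)"
      unfolding p_def scaleR_add_right by (simp add: scaleR_diff_right)
    have vt: "v t$i - v t$j = p + g" unfolding p_def g_def by simp
    have "0 \<le> (y s$i - y s$j) \<bullet> (v t$i - v t$j)"
      unfolding ys vt using inner_perturbed_nonneg[OF f g] Rs by simp
    moreover have "0 \<le> m i * m j" using m by (simp add: less_imp_le)
    ultimately show ?thesis by simp
  qed
  then have "0 \<le> (\<Sum>i\<in>UNIV. \<Sum>j\<in>UNIV - {i}. m i * m j * ((y s$i - y s$j) \<bullet> (v t$i - v t$j)) / norm (y s$i - y s$j)^3)"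
    by (intro sum_nonneg) auto
  then show ?thesis unfolding minner_force by simp
qed

lemma minner_v_antimono:
  assumes "0 \<le> s" "s \<le> t" "0 \<le> x"
  shows "minner m (v t) (v x) \<le> minner m (v s) (v x)"
proof (rule DERIV_nonpos_imp_decreasing_open[OF assms(2)])
  have bl: "bounded_linear (\<lambda>z. minner m z (v x))" by (rule bounded_bilinear.bounded_linear_left[OF bounded_bilinear_minner])
  show "continuous_on {s..t} (\<lambda>z. minner m (v z) (v x))"
    by (rule bounded_linear.continuous_on[OF bl continuous_on_subset[OF continuous_v]]) (use assms in auto)
  fix z assume "s < z" "z < t"
  then have z: "0 < z" using assms by simp
  have "((\<lambda>z. minner m (v z) (v x)) has_real_derivative minner m (force m (y z)) (v x)) (at z)"
    unfolding has_real_derivative_iff_has_vector_derivative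
    by (rule bounded_linear.has_vector_derivative[OF bl v_at[OF z]])
  then show "\<exists>D. ((\<lambda>z. minner m (v z) (v x)) has_real_derivative D) (at z) \<and> D \<le> 0"
    using force_v_nonpos[of z x] z assms by auto
qed

definition "energy = minner m a a / 2"

lemma energy_nonneg: "0 \<le> energy"
  unfolding energy_def using minner_nonneg[OF m] by simp

text \<open>The conserved quantity is evaluated at infinity, where the velocity tends to
  \<open>a\<close> and the potential to 0.\<close>

lemma energy_conservation:
  assumes "0 \<le> t"
  shows "minner m (v t) (v t) / 2 = Upot m (y t) + energy"
proof -
  define E where "E t = minner m (v t) (v t) / 2 - Upot m (y t)" for t
  have "(E has_vector_derivative 0) (at t within {0..})" if t: "t \<in> {0..}" for t
  proof -
    have t0: "0 \<le> t" using t by simp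
    have vv: "((\<lambda>t. minner m (v t) (v t)) has_vector_derivative (minner m (v t) (force m (y t)) + minner m (force m (y t)) (v t))) (at t within {0..})"
      by (rule bounded_bilinear.has_vector_derivative[OF bounded_bilinear_minner v'[OF t0] v'[OF t0]])
    have 1: "((\<lambda>t. minner m (v t) (v t) / 2) has_vector_derivative minner m (force m (y t)) (v t)) (at t within {0..})"
      using has_vector_derivative_divide[OF vv, of 2] by (simp add: minner_commute)
    have "((\<lambda>t. Upot m (y t)) has_derivative (\<lambda>h. minner m (force m (y t)) (h *\<^sub>R v t))) (at t within {0..})"
      by (rule has_derivative_compose[OF y'[OF t0, unfolded has_vector_derivative_def] Upot_has_derivative[OF in_Omega[OF t0]]])
    then have 2: "((\<lambda>t. Upot m (y t)) has_vector_derivative minner m (force m (y t)) (v t)) (at t within {0..})"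
      unfolding has_vector_derivative_def by (simp add: bounded_bilinear.scaleR_right[OF bounded_bilinear_minner])
    show ?thesis unfolding E_def using has_vector_derivative_diff[OF 1 2] by simp
  qed
  then obtain c where c: "\<And>t. t \<in> {0..} \<Longrightarrow> E t = c"
    using has_vector_derivative_zero_constant[of "{0..}" E] by (metis convex_real_interval(1))
  have tend0: "((\<lambda>t. B / (R + t)) \<longlongrightarrow> 0) at_top" for B
    by (intro tendsto_divide_0[OF tendsto_const] filterlim_at_top_imp_at_infinity
        filterlim_tendsto_add_at_top[OF tendsto_const] filterlim_ident)
  have "((\<lambda>t. v t - a) \<longlongrightarrow> 0) at_top"
    by (rule Lim_null_comparison[OF eventually_mono[OF eventually_ge_at_top[of 0] vel] tend0[of C]])
  then have va: "(v \<longlongrightarrow> a) at_top" by (simp add: LIM_zero_iff)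
  define B where "B = (\<Sum>i\<in>UNIV. \<Sum>j\<in>UNIV - {i}. m i * m j) / 2 / (\<delta> / 2)"
  have "((\<lambda>t. Upot m (y t)) \<longlongrightarrow> 0) at_top"
  proof (rule Lim_null_comparison[OF _ tend0[of B]])
    have "norm (Upot m (y t)) \<le> B / (R + t)" if "0 \<le> t" for t
      using Upot_le[OF m _ sep[OF that]] Upot_nonneg[OF m, of "y t"] \<delta>(1) R(1) that unfolding B_def by simp
    then show "eventually (\<lambda>t. norm (Upot m (y t)) \<le> B / (R + t)) at_top"
      by (intro eventually_mono[OF eventually_ge_at_top[of 0]])
  qed
  then have "(E \<longlongrightarrow> energy - 0) at_top"
    unfolding E_def energy_def
    by (intro tendsto_diff tendsto_divide bounded_bilinear.tendsto[OF bounded_bilinear_minner va va] tendsto_const) auto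
  moreover have "(E \<longlongrightarrow> c) at_top"
    by (rule tendsto_eventually, rule eventually_mono[OF eventually_ge_at_top[of 0]]) (simp add: c)
  ultimately have "c = energy" using tendsto_unique[of at_top E] by simp
  then show ?thesis using c[of t] assms unfolding E_def by simp
qed

text \<open>By conservation of energy the Lagrangian plus \<open>energy\<close> along
  \<open>y\<close> equals the integrand, so increments of \<open>S\<close> are actions of pieces of
  \<open>y\<close>.\<close>

definition "S t = integral {0..t} (\<lambda>\<tau>. minner m (v \<tau>) (v \<tau>))"

lemma continuous_vv: "continuous_on {0..} (\<lambda>\<tau>. minner m (v \<tau>) (v \<tau>))"
  by (rule bounded_bilinear.continuous_on[OF bounded_bilinear_minner continuous_v continuous_v])

lemma S_derivative: "0 \<le> t \<Longrightarrow> (S has_vector_derivative minner m (v t) (v t)) (at t within {0..})"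
  unfolding S_def[abs_def] by (rule integral_has_vector_derivative_Ici[OF continuous_vv])

lemma S_at: "0 < t \<Longrightarrow> (S has_real_derivative minner m (v t) (v t)) (at t)"
  using S_derivative[of t] at_within_Ici_pos[of t] unfolding has_real_derivative_iff_has_vector_derivative by simp

lemma continuous_S: "continuous_on {0..} S"
  by (rule continuous_on_vector_derivative[of _ _ "\<lambda>t. minner m (v t) (v t)"]) (use S_derivative in auto)

text \<open>The function S x - <v r, y x> has derivative <v x - v r, v x>, nonnegative before
  \<open>r\<close> and nonpositive after it, so it is largest at \<open>r\<close>. This handles
  competitors whose duration differs from that of \<open>y\<close>.\<close>

lemma S_le_linearization:
  assumes "0 \<le> t" "0 \<le> r"
  shows "S t \<le> S r + minner m (v r) (y t - y r)"
proof -
  define q where "q x = S x - minner m (v r) (y x)" for x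
  have bl: "bounded_linear (minner m (v r))" by (rule bounded_bilinear.bounded_linear_right[OF bounded_bilinear_minner])
  have cq: "continuous_on {s..t} q" if "0 \<le> s" for s t
    unfolding q_def by (intro continuous_on_diff continuous_on_subset[OF continuous_S]
        bounded_linear.continuous_on[OF bl continuous_on_subset[OF continuous_y]]) (use that in auto)
  have dq: "(q has_real_derivative (minner m (v x) (v x) - minner m (v r) (v x))) (at x)" if "0 < x" for x
    unfolding q_def using bounded_linear.has_vector_derivative[OF bl y_at[OF that]]
    by (intro DERIV_diff S_at that) (simp add: has_real_derivative_iff_has_vector_derivative)
  have "q t \<le> q r"
  proof (cases "r \<le> t")
    case True
    show ?thesis
    proof (rule DERIV_nonpos_imp_decreasing_open[OF True _ cq[OF assms(2)]])
      fix x assume x: "r < x" "x < t"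
      then show "\<exists>D. (q has_real_derivative D) (at x) \<and> D \<le> 0"
        using dq[of x] minner_v_antimono[of r x x] assms by fastforce
    qed
  next
    case False
    show ?thesis
    proof (rule DERIV_nonneg_imp_increasing_open[OF _ _ cq[OF assms(1)]])
      fix x assume x: "t < x" "x < r"
      then show "\<exists>D. (q has_real_derivative D) (at x) \<and> 0 \<le> D"
        using dq[of x] minner_v_antimono[of x r x] assms by fastforce
    qed (use False in simp)
  qed
  then show ?thesis unfolding q_def by (simp add: minner_diff_right)
qed

text \<open>The left-hand side is the derivative of the comparison function along a curve at
  \<open>z\<close> with velocity \<open>p\<close>. After the linear terms cancel, W = p - v and w =
  z - y remain in |W|^2 / 2 - 2 K <w, W> / r^2 + K |w|^2 / r^3, which has to be nonnegative.\<close>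

lemma lagrangian_lower_bound:
  assumes \<tau>: "0 \<le> \<tau>" and z: "z \<in> Omega"
  shows "minner m (v \<tau>) (v \<tau>) + (minner m (v \<tau>) (p - v \<tau>) + minner m (force m (y \<tau>)) (z - y \<tau>))
     + (K / (R + \<tau>)^2 * (2 * minner m (z - y \<tau>) (p - v \<tau>)) - 2 * K / (R + \<tau>)^3 * minner m (z - y \<tau>) (z - y \<tau>))
     \<le> minner m p p / 2 + Upot m z + energy"
proof -
  define w W r where "w = z - y \<tau>" and "W = p - v \<tau>" and "r = R + \<tau>"
  have r: "0 < r" "2 * K \<le> r" using R \<tau> unfolding r_def K_def by auto
  have pp: "minner m p p = minner m (v \<tau>) (v \<tau>) + 2 * minner m (v \<tau>) W + minner m W W"
    unfolding W_def by (simp add: minner_diff_left minner_diff_right minner_commute)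
  have "(\<Sum>i\<in>UNIV. m i) / (\<delta> / 2 * r)^3 = K / r^3" unfolding K_def power_mult_distrib by simp
  then have U: "Upot m (y \<tau>) + minner m (force m (y \<tau>)) w - K / r^3 * minner m w w \<le> Upot m z"
    using Upot_quadratic_lower_bound[OF m _ sep[OF \<tau>] z] \<delta>(1) r unfolding w_def r_def by simp
  \<comment> \<open>Completing the square with this \<open>b\<close> leaves the condition b^2 <= 2 K
    / r^3, which is implied by 2 K <= r.\<close>
  define b where "b = 2 * K / r^2"
  have "0 \<le> minner m (W - b *\<^sub>R w) (W - b *\<^sub>R w)" by (rule minner_nonneg[OF m])
  also have "\<dots> = minner m W W - 2 * b * minner m w W + b^2 * minner m w w"
    by (simp add: minner_diff_left minner_diff_right bounded_bilinear.scaleR_left[OF bounded_bilinear_minner]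
        bounded_bilinear.scaleR_right[OF bounded_bilinear_minner] minner_commute power2_eq_square algebra_simps)
  also have "b^2 * minner m w w \<le> 2 * K / r^3 * minner m w w"
  proof (rule mult_right_mono)
    have "b^2 = (2 * K) * (2 * K) / r^4" unfolding b_def by (simp add: power2_eq_square power4_eq_xxxx)
    also have "\<dots> \<le> (2 * K) * r / r^4" using K_nonneg r by (intro divide_right_mono mult_left_mono) auto
    also have "\<dots> = 2 * K / r^3" using r by (simp add: power4_eq_xxxx power3_eq_cube)
    finally show "b^2 \<le> 2 * K / r^3" .
  qed (rule minner_nonneg[OF m])
  finally have "0 \<le> minner m W W / 2 - 2 * (K / r^2) * minner m w W + K / r^3 * minner m w w"
    unfolding b_def by (simp add: field_simps)
  moreover have "2 * (K / r^2) * minner m w W = K / r^2 * (2 * minner m w W)" by simp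
  moreover have "2 * K / r^3 * minner m w w = K / r^3 * minner m w w + K / r^3 * minner m w w" by simp
  ultimately show ?thesis
    using pp U energy_conservation[OF \<tau>] unfolding w_def[symmetric] W_def[symmetric] r_def[symmetric] by linarith
qed

lemma action_lower_bound:
  assumes st: "0 \<le> s" "0 \<le> t" and "s' < t'" and ac: "abs_cont_on \<eta> s' t'" and ends: "\<eta> s' = y s" "\<eta> t' = y t"
  shows "ennreal (S t - S s) \<le> action m energy \<eta> s' t'"
proof -
  \<comment> \<open>The competitor is compared with \<open>y\<close> shifted so that both start at
    time \<open>s\<close> of \<open>y\<close>; it then ends at time t' + c of \<open>y\<close>, in
    general different from \<open>t\<close>.\<close>
  define c where "c = s - s'"
  define w where "w u = \<eta> u - y (u + c)" for u
  define \<kappa> where "\<kappa> t = K / (R + t)^2" for t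
  \<comment> \<open>The comparison function along the competitor: \<open>w\<close> vanishes at
    \<open>s'\<close>, so it starts at \<open>S s\<close>, and its derivative is the left-hand side
    of \<open>lagrangian_lower_bound\<close>.\<close>
  define \<psi> where "\<psi> u = S (u + c) + minner m (v (u + c)) (w u) + \<kappa> (u + c) * minner m (w u) (w u)" for u
  have c0: "0 \<le> s' + c" unfolding c_def using st by simp
  have pos: "0 \<le> u + c" if "u \<in> {s'..t'}" for u using that c0 by simp
  have \<kappa>': "(\<kappa> has_vector_derivative (- 2 * K / (R + t)^3)) (at t within {0..})" if "0 \<le> t" for t
  proof -
    have "(\<kappa> has_real_derivative (- 2 * K / (R + t)^3)) (at t within {0..})"
    proof -
      have u: "(0 * u^2 - K * (2 * u)) / (u^2 * u^2) = - 2 * K / u^3" if "0 < u" for u :: real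
        using that by (simp add: divide_simps power2_eq_square power3_eq_cube)
      have "((\<lambda>t. (R + t)^2) has_real_derivative 2 * (R + t)) (at t within {0..})" by (auto intro!: derivative_eq_intros)
      from DERIV_divide[OF DERIV_const[of K] this] show ?thesis
        unfolding \<kappa>_def u[symmetric, OF add_pos_nonneg[OF R(1) that]] using R(1) that by auto
    qed
    then show ?thesis unfolding has_real_derivative_iff_has_vector_derivative .
  qed
  note sh = has_vector_derivative_shift[OF _ c0] and shc = continuous_on_shift[OF _ c0]
  have cF: "continuous_on {0..} (\<lambda>t. force m (y t))"
    by (rule continuous_on_force[OF m, of "\<delta> / 2 * R", OF _ continuous_y])
      (use \<delta>(1) R(1) in \<open>auto intro!: separated_mono[OF sep]\<close>)
  have acS: "abs_cont_on (\<lambda>u. S (u + c)) s' t'"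
    by (rule abs_cont_on_C1[OF sh[OF S_derivative[OF pos]] shc[OF continuous_vv]])
  have acv: "abs_cont_on (\<lambda>u. v (u + c)) s' t'"
    by (rule abs_cont_on_C1[OF sh[OF v'[OF pos]] shc[OF cF]])
  have acy: "abs_cont_on (\<lambda>u. y (u + c)) s' t'"
    by (rule abs_cont_on_C1[OF sh[OF y'[OF pos]] shc[OF continuous_v]])
  have ac\<kappa>: "abs_cont_on (\<lambda>u. \<kappa> (u + c)) s' t'"
    by (rule abs_cont_on_C1[OF sh[OF \<kappa>'[OF pos]] shc]) (use R(1) in \<open>auto intro!: continuous_intros\<close>)
  have acw: "abs_cont_on w s' t'"
    using abs_cont_on_add[OF ac abs_cont_on_uminus[OF acy]] unfolding w_def[abs_def] by simp
  have ac\<psi>: "abs_cont_on \<psi> s' t'"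
    unfolding \<psi>_def[abs_def]
    using \<open>s' < t'\<close>
    by (intro abs_cont_on_add acS abs_cont_on_bilinear[OF bounded_bilinear_minner]
        abs_cont_on_bilinear[OF bounded_bilinear_mult] acv acw ac\<kappa>) auto
  define N where "N = {u \<in> {s'<..<t'}. \<not> \<eta> differentiable (at u)}"
  have "ennreal (\<psi> t' - \<psi> s') \<le> action m energy \<eta> s' t'"
    unfolding action_def
  proof (rule abs_cont_on_le_nn_integral[OF ac\<psi> \<open>s' < t'\<close>, of N])
    show "negligible N" unfolding N_def by (rule abs_cont_on_differentiable_ae[OF ac \<open>s' < t'\<close>])
    fix u assume u: "u \<in> {s'<..<t'} - N"
    define p where "p = vector_derivative \<eta> (at u)"
    have \<eta>': "(\<eta> has_vector_derivative p) (at u)"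
      using u unfolding N_def p_def by (auto simp: vector_derivative_works[symmetric])
    have u': "u \<in> {s'..t'}" using u by auto
    have at: "at u within {s'..t'} = at u" by (rule at_within_interior) (use u in auto)
    have uc: "0 \<le> u + c" using pos[OF u'] .
    have dv: "((\<lambda>u. v (u + c)) has_vector_derivative force m (y (u + c))) (at u)"
      using sh[OF v'[OF uc] u'] unfolding at by simp
    have dw: "(w has_vector_derivative (p - v (u + c))) (at u)"
      unfolding w_def[abs_def] using has_vector_derivative_diff[OF \<eta>' sh[OF y'[OF uc] u', unfolded at]] by simp
    have dS: "((\<lambda>u. S (u + c)) has_vector_derivative minner m (v (u + c)) (v (u + c))) (at u)"
      using sh[OF S_derivative[OF uc] u'] unfolding at by simp
    have d\<kappa>: "((\<lambda>u. \<kappa> (u + c)) has_vector_derivative (- 2 * K / (R + (u + c))^3)) (at u)"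
      using sh[OF \<kappa>'[OF uc] u'] unfolding at by simp
    note bm = bounded_bilinear.has_vector_derivative[OF bounded_bilinear_minner[of m]]
    define D where "D = minner m (v (u + c)) (v (u + c)) + (minner m (v (u + c)) (p - v (u + c)) + minner m (force m (y (u + c))) (w u))
     + (\<kappa> (u + c) * (minner m (w u) (p - v (u + c)) + minner m (p - v (u + c)) (w u)) + (- 2 * K / (R + (u + c))^3) * minner m (w u) (w u))"
    have "(\<psi> has_vector_derivative D) (at u)"
      unfolding \<psi>_def[abs_def] D_def
      by (intro has_vector_derivative_add dS bm[OF dv dw] bounded_bilinear.has_vector_derivative[OF bounded_bilinear_mult d\<kappa> bm[OF dw dw]])
    then have \<psi>': "(\<psi> has_real_derivative D) (at u)" unfolding has_real_derivative_iff_has_vector_derivative .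
    \<comment> \<open>At a collision \<open>Uext\<close> is infinite and the inequality is
      trivial.\<close>
    have "ennreal D \<le> ennreal ((mnorm m p)\<^sup>2 / 2) + Uext m (\<eta> u) + ennreal energy"
    proof (cases "\<eta> u \<in> Omega")
      case True
      have "D \<le> minner m p p / 2 + Upot m (\<eta> u) + energy"
        using lagrangian_lower_bound[OF uc True, of p] unfolding D_def w_def \<kappa>_def
        by (simp add: minner_commute[of m "p - v (u + c)"])
      then have "ennreal D \<le> ennreal (minner m p p / 2 + Upot m (\<eta> u) + energy)" by (rule ennreal_leI)
      also have "\<dots> = ennreal ((mnorm m p)\<^sup>2 / 2) + Uext m (\<eta> u) + ennreal energy"
        using True minner_nonneg[OF m, of p] Upot_nonneg[OF m, of "\<eta> u"] energy_nonneg
        by (simp add: Uext_def power2_mnorm[OF m] ennreal_plus)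
      finally show ?thesis .
    qed (simp add: Uext_def)
    then show "\<exists>D. (\<psi> has_real_derivative D) (at u) \<and> ennreal D \<le> ennreal ((mnorm m (vector_derivative \<eta> (at u)))\<^sup>2 / 2) + Uext m (\<eta> u) + ennreal energy"
      using \<psi>' unfolding p_def by blast
  qed
  moreover have "\<psi> s' = S s" unfolding \<psi>_def w_def c_def using ends by simp
  \<comment> \<open>At the end w = y t - y (t' + c), so the linear part of \<psi> is exactly the
    tangent bound at time t' + c, and the quadratic part only adds to it.\<close>
  moreover have "S t \<le> \<psi> t'"
  proof -
    have tc: "0 \<le> t' + c" using pos[of t'] \<open>s' < t'\<close> by auto
    have "0 \<le> \<kappa> (t' + c) * minner m (w t') (w t')"
      unfolding \<kappa>_def using K_nonneg minner_nonneg[OF m] by (intro mult_nonneg_nonneg divide_nonneg_nonneg) auto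
    then show ?thesis using S_le_linearization[OF st(2) tc] unfolding \<psi>_def w_def ends by simp
  qed
  ultimately show ?thesis by (metis diff_right_mono ennreal_leI order_trans)
qed

lemma action_eq:
  assumes st: "0 \<le> s" "s < t"
  shows "action m energy y s t = ennreal (S t - S s)"
proof -
  have I: "((\<lambda>\<tau>. minner m (v \<tau>) (v \<tau>)) has_integral (S t - S s)) {s..t}"
    by (rule fundamental_theorem_of_calculus)
      (use st in \<open>auto intro!: has_vector_derivative_within_subset[OF S_derivative]\<close>)
  have "action m energy y s t = integral\<^sup>N lborel (\<lambda>\<tau>. ennreal (indicator {s..t} \<tau> * minner m (v \<tau>) (v \<tau>)))"
    unfolding action_def
  proof (rule nn_integral_cong_AE)
    show "AE \<tau> in lborel. indicator {s..t} \<tau> * (ennreal ((mnorm m (vector_derivative y (at \<tau>)))\<^sup>2 / 2) + Uext m (y \<tau>) + ennreal energy) =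
      ennreal (indicator {s..t} \<tau> * minner m (v \<tau>) (v \<tau>))"
      \<comment> \<open>Time 0 is discarded: \<open>action\<close> uses the two-sided derivative,
        while only the one-sided derivative of \<open>y\<close> is known there.\<close>
      using AE_lborel_singleton[of "0::real"]
    proof eventually_elim
      fix \<tau> :: real assume "\<tau> \<noteq> 0"
      show "indicator {s..t} \<tau> * (ennreal ((mnorm m (vector_derivative y (at \<tau>)))\<^sup>2 / 2) + Uext m (y \<tau>) + ennreal energy) =
        ennreal (indicator {s..t} \<tau> * minner m (v \<tau>) (v \<tau>))"
      proof (cases "\<tau> \<in> {s..t}")
        case True
        then have \<tau>: "0 < \<tau>" using \<open>\<tau> \<noteq> 0\<close> st by auto
        have vd: "vector_derivative y (at \<tau>) = v \<tau>" by (rule vector_derivative_at[OF y_at[OF \<tau>]])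
        have "ennreal (minner m (v \<tau>) (v \<tau>) / 2) + ennreal (Upot m (y \<tau>)) + ennreal energy = ennreal (minner m (v \<tau>) (v \<tau>) / 2 + Upot m (y \<tau>) + energy)"
          using minner_nonneg[OF m, of "v \<tau>"] Upot_nonneg[OF m, of "y \<tau>"] energy_nonneg by (simp add: ennreal_plus)
        also have "minner m (v \<tau>) (v \<tau>) / 2 + Upot m (y \<tau>) + energy = minner m (v \<tau>) (v \<tau>)"
          using energy_conservation[of \<tau>] \<tau> by simp
        finally show ?thesis using True in_Omega[of \<tau>] \<tau> by (simp add: vd Uext_def power2_mnorm[OF m])
      qed simp
    qed
  qed
  also have "\<dots> = ennreal (S t - S s)"
    by (rule nn_integral_has_integral_lebesgue[OF _ I]) (simp add: minner_nonneg[OF m])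
  finally show ?thesis .
qed

lemma geodesic: "geodesic_ray m energy y v"
  unfolding geodesic_ray_def
proof (intro conjI allI impI)
  show "0 \<le> energy" by (rule energy_nonneg)
  show "newton_sol m y v" by (rule newton_solI[OF in_Omega y' v'])
  fix s t :: real assume st: "0 \<le> s" "s < t"
  have acy: "abs_cont_on y s t"
    by (rule abs_cont_on_C1[of _ _ _ v])
      (use st in \<open>auto intro!: has_vector_derivative_within_subset[OF y'] continuous_on_subset[OF continuous_v]\<close>)
  show "action m energy y s t = phi m energy (y s) (y t)"
  proof (rule antisym)
    show "phi m energy (y s) (y t) \<le> action m energy y s t"
      unfolding phi_def by (rule INF_lower2[of "(y, s, t)"]) (use st acy in auto)
    show "action m energy y s t \<le> phi m energy (y s) (y t)"
      unfolding phi_def action_eq[OF st]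
    proof (rule INF_greatest)
      fix g assume "g \<in> {(g, s', t'). s' < t' \<and> abs_cont_on g s' t' \<and> g s' = y s \<and> g t' = y t}"
      then obtain \<eta> s' t' where "g = (\<eta>, s', t')" "s' < t'" "abs_cont_on \<eta> s' t'" "\<eta> s' = y s" "\<eta> t' = y t" by auto
      then show "ennreal (S t - S s) \<le> (case g of (g, s, t) \<Rightarrow> action m energy g s t)"
        using action_lower_bound[of s t s' t' \<eta>] st by simp
    qed
  qed
qed

text \<open>Integrating |v - a| <= C / (R + s) gives a deviation of logarithmic size, which is o(t);
  for t >= R the argument R + t is replaced by 2 t.\<close>

lemma hyperbolic: "hyperbolic_limit y a"
  unfolding hyperbolic_limit_def
proof
  show "a \<in> Omega" using separated_Omega[OF \<delta>(2,1)] .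
  define B where "B = norm (y 0) - C * ln R"
  have bound: "norm (y t - t *\<^sub>R a) \<le> B + C * ln (R + t)" if t: "0 < t" for t
  proof -
    have "norm ((y t - t *\<^sub>R a) - (y 0 - 0 *\<^sub>R a)) \<le> C * ln (R + t) - C * ln (R + 0)"
    proof (rule differentiable_bound_general[OF t])
      show "continuous_on {0..t} (\<lambda>s. y s - s *\<^sub>R a)"
        by (intro continuous_intros continuous_on_subset[OF continuous_y]) auto
      show "continuous_on {0..t} (\<lambda>s. C * ln (R + s))" using R(1) by (intro continuous_intros) auto
      fix s assume s: "0 < s" "s < t"
      show "((\<lambda>s. y s - s *\<^sub>R a) has_vector_derivative (v s - a)) (at s)"
        using y_at[OF s(1)] by (auto intro!: derivative_eq_intros)
      have "((\<lambda>s. C * ln (R + s)) has_real_derivative (C / (R + s))) (at s)"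
        using s R(1) by (auto intro!: derivative_eq_intros)
      then show "((\<lambda>s. C * ln (R + s)) has_vector_derivative (C / (R + s))) (at s)"
        unfolding has_real_derivative_iff_has_vector_derivative .
      show "norm (v s - a) \<le> C / (R + s)" using vel[of s] s by simp
    qed
    then show ?thesis using norm_triangle_sub[of "y t - t *\<^sub>R a" "y 0"] unfolding B_def by simp
  qed
  have "((\<lambda>t::real. ln (2 * t) / (2 * t)) \<longlongrightarrow> 0) at_top"
    by (rule filterlim_compose[OF ln_x_over_x_tendsto_0]) (rule filterlim_tendsto_pos_mult_at_top[OF tendsto_const], auto intro: filterlim_ident)
  then have "((\<lambda>t. B / t + 2 * C * (ln (2 * t) / (2 * t))) \<longlongrightarrow> 0 + 2 * C * 0) at_top"
    by (intro tendsto_intros tendsto_divide_0[OF tendsto_const] filterlim_at_top_imp_at_infinity filterlim_ident)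
  then have lim: "((\<lambda>t. B / t + 2 * C * (ln (2 * t) / (2 * t))) \<longlongrightarrow> 0) at_top" by simp
  show "((\<lambda>t. norm (y t - t *\<^sub>R a) / t) \<longlongrightarrow> 0) at_top"
  proof (rule Lim_null_comparison[OF _ lim])
    show "eventually (\<lambda>t. norm (norm (y t - t *\<^sub>R a) / t) \<le> B / t + 2 * C * (ln (2 * t) / (2 * t))) at_top"
      using eventually_ge_at_top[of R]
    proof eventually_elim
      fix t assume t: "R \<le> t"
      have t0: "0 < t" using t R(1) by simp
      have "C * ln (R + t) \<le> C * ln (2 * t)" using C(1) t R(1) by (intro mult_left_mono) auto
      then have "norm (y t - t *\<^sub>R a) \<le> B + C * ln (2 * t)" using bound[OF t0] by simp
      then have "norm (y t - t *\<^sub>R a) / t \<le> (B + C * ln (2 * t)) / t" using t0 by (intro divide_right_mono) auto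
      also have "\<dots> = B / t + 2 * C * (ln (2 * t) / (2 * t))" using t0 by (simp add: add_divide_distrib)
      finally show "norm (norm (y t - t *\<^sub>R a) / t) \<le> B / t + 2 * C * (ln (2 * t) / (2 * t))" using t0 by simp
    qed
  qed
qed

end

section \<open>The dimension\<close>

lemma GR_projection_contains_cone:
  fixes m :: "'n::finite \<Rightarrow> real" and a :: "(real^'d)^'n"
  assumes m: "\<forall>i. m i > 0" and a: "a \<in> Omega \<inter> Xc m"
  obtains R e where "0 < e" "\<And>x. x \<in> Xc m \<Longrightarrow> norm (x - R *\<^sub>R a) \<le> e \<Longrightarrow> \<exists>v. (x, v) \<in> GR m a"
proof -
  obtain \<delta> where \<delta>: "0 < \<delta>" "separated \<delta> a" using Omega_separated a by blast
  define C1 where "C1 = force_const m / (\<delta> / 2)^2"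
  define C2 where "C2 = force_const m / (\<delta> / 2)^3"
  define K where "K = (\<Sum>i\<in>UNIV. m i) / (\<delta> / 2)^3"
  \<comment> \<open>Each summand is one threshold required later; as all are nonnegative, their sum
    meets them simultaneously, and the 1 makes \<open>R\<close> positive.\<close>
  define R where "R = 1 + 16 * C1 / \<delta> + 2 * C2 + 2 * K"
  have nn: "0 \<le> C1" "0 \<le> C2" "0 \<le> K" "0 \<le> 16 * C1 / \<delta>"
    using force_const_nonneg[OF m] \<delta>(1) m unfolding C1_def C2_def K_def
    by (auto intro!: divide_nonneg_nonneg sum_nonneg simp: less_imp_le)
  have R: "0 < R" "16 * C1 / \<delta> \<le> R" "2 * C2 \<le> R" "2 * K \<le> R" unfolding R_def using nn by linarith+
  have R1: "C1 / R \<le> \<delta> / 16" using R(1,2) \<delta>(1) by (simp add: field_simps)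
  have R2: "C2 / R \<le> 1 / 2" using R(1,3) by (simp add: field_simps)
  show ?thesis
  proof (rule that[of "\<delta> / 16 * R" R])
    show "0 < \<delta> / 16 * R" using \<delta>(1) R(1) by simp
    fix x assume x: "x \<in> Xc m" "norm (x - R *\<^sub>R a) \<le> \<delta> / 16 * R"
    obtain y v where y: "y 0 = x"
      "\<And>t. 0 \<le> t \<Longrightarrow> (y has_vector_derivative v t) (at t within {0..})"
      "\<And>t. 0 \<le> t \<Longrightarrow> (v has_vector_derivative force m (y t)) (at t within {0..})"
      "\<And>t. 0 \<le> t \<Longrightarrow> norm (y t - (R + t) *\<^sub>R a) \<le> \<delta> / 8 * (R + t)"
      "\<And>t. 0 \<le> t \<Longrightarrow> norm (v t - a) \<le> C1 / (R + t)"
      "mass_sum m (v 0) = mass_sum m a"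
      using hyperbolic_solution_exists[OF m \<delta> R(1) R1[unfolded C1_def] R2[unfolded C2_def] x(2)]
      unfolding C1_def[symmetric] by blast
    interpret far_solution m a y v \<delta> R C1
      by unfold_locales (use m \<delta> R nn R1 y K_def in auto)
    have "x \<in> Omega" using in_Omega[of 0] y(1) by simp
    moreover have "v 0 \<in> Xc m" using y(6) a by (simp add: Xc_iff)
    ultimately have "(x, v 0) \<in> GR m a"
      unfolding GR_def using x(1) y(1) geodesic hyperbolic by blast
    then show "\<exists>v. (x, v) \<in> GR m a" by blast
  qed
qed

text \<open>\<open>q\<close> reads off the positions of the bodies other than \<open>i0\<close>.
  They can be prescribed freely near \<open>R *\<^sub>R a\<close>, the body \<open>i0\<close> being
  determined by the centre of mass, so the image contains a box of dimension d (N - 1).\<close>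

lemma GR_hausdorff_measure_nonzero:
  fixes m :: "'n::finite \<Rightarrow> real" and a :: "(real^'d)^'n"
  assumes m: "\<forall>i. m i > 0" and a: "a \<in> Omega \<inter> Xc m"
    and s: "0 \<le> s" "s < real (CARD('d) * (CARD('n) - 1))"
  shows "hausdorff_measure s (GR m a) \<noteq> 0"
proof -
  obtain R e where e: "0 < e" "\<And>x. x \<in> Xc m \<Longrightarrow> norm (x - R *\<^sub>R a) \<le> e \<Longrightarrow> \<exists>v. (x, v) \<in> GR m a"
    using GR_projection_contains_cone[OF m a] by blast
  obtain i0 :: 'n where True by blast
  define I where "I = UNIV - {i0}"
  define M where "M = (\<Sum>i\<in>UNIV. m i)"
  have M: "0 \<le> M" unfolding M_def using m by (auto intro!: sum_nonneg simp: less_imp_le)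
  \<comment> \<open>\<open>Q\<close> is the factor of \<open>Xc_norm_bound\<close>, enlarged for the
    passage from entries to norms of bodies; with r = e / Q every point of the box lies within
    \<open>e\<close> of \<open>R *\<^sub>R a\<close>.\<close>
  define Q where "Q = real CARD('n) * (1 + M / m i0) * real CARD('d)"
  have mi0: "0 < m i0" using m by simp
  have Q: "0 < Q" unfolding Q_def using M mi0 by (intro mult_pos_pos add_pos_nonneg divide_nonneg_pos) auto
  define r where "r = e / Q"
  have r: "0 < r" unfolding r_def using e Q by simp
  define q where "q z i = fst z $ i" for z :: "((real^'d)^'n) \<times> ((real^'d)^'n)" and i
  show ?thesis
  proof (rule hausdorff_measure_nonzero[where q=q and I=I and r=r and c="\<lambda>i. (R *\<^sub>R a) $ i"])
    fix z w :: "((real^'d)^'n) \<times> ((real^'d)^'n)" and i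
    show "dist (q z i) (q w i) \<le> dist z w"
      unfolding q_def using dist_vec_nth_le[of "fst z" i "fst w"] dist_fst_le[of z w] by linarith
  next
    show "PiE I (\<lambda>i. cbox ((R *\<^sub>R a) $ i - vec r) ((R *\<^sub>R a) $ i + vec r)) \<subseteq> (\<lambda>z. restrict (q z) I) ` GR m a"
    proof
      fix f assume f: "f \<in> PiE I (\<lambda>i. cbox ((R *\<^sub>R a) $ i - vec r) ((R *\<^sub>R a) $ i + vec r))"
      define x where "x = (\<chi> i. if i = i0 then - (1 / m i0) *\<^sub>R (\<Sum>i\<in>I. m i *\<^sub>R f i) else f i)"
      have xI: "x $ i = f i" if "i \<in> I" for i using that unfolding x_def I_def by simp
      have "(\<Sum>i\<in>UNIV. m i *\<^sub>R x $ i) = m i0 *\<^sub>R x $ i0 + (\<Sum>i\<in>I. m i *\<^sub>R x $ i)"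
        unfolding I_def by (rule sum.remove) auto
      also have "(\<Sum>i\<in>I. m i *\<^sub>R x $ i) = (\<Sum>i\<in>I. m i *\<^sub>R f i)" using xI by simp
      also have "m i0 *\<^sub>R x $ i0 = - (\<Sum>i\<in>I. m i *\<^sub>R f i)" unfolding x_def using mi0 by simp
      finally have xX: "x \<in> Xc m" unfolding Xc_def by simp
      have wX: "x - R *\<^sub>R a \<in> Xc m"
        using xX a by (simp add: Xc_iff linear_diff[OF bounded_linear.linear[OF bounded_linear_mass_sum]]
            linear_scale[OF bounded_linear.linear[OF bounded_linear_mass_sum]])
      have "norm ((x - R *\<^sub>R a) $ i) \<le> real CARD('d) * r" if i: "i \<noteq> i0" for i
      proof -
        have "f i \<in> cbox ((R *\<^sub>R a) $ i - vec r) ((R *\<^sub>R a) $ i + vec r)" using f i unfolding I_def by auto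
        then have "\<bar>(x - R *\<^sub>R a) $ i $ j\<bar> \<le> r" for j
          using xI[of i] i unfolding I_def mem_box_cart by (auto simp: abs_le_iff algebra_simps dest!: spec[of _ j])
        then have "(\<Sum>j\<in>UNIV. \<bar>(x - R *\<^sub>R a) $ i $ j\<bar>) \<le> (\<Sum>j\<in>(UNIV::'d set). r)" by (intro sum_mono)
        then show ?thesis using norm_le_l1_cart[of "(x - R *\<^sub>R a) $ i"] by simp
      qed
      then have "norm (x - R *\<^sub>R a) \<le> real CARD('n) * ((1 + M / m i0) * (real CARD('d) * r))"
        unfolding M_def by (intro Xc_norm_bound[OF m wX]) (use r in auto)
      also have "\<dots> = Q * r" unfolding Q_def by simp
      also have "\<dots> = e" unfolding r_def using Q by simp
      finally obtain v where v: "(x, v) \<in> GR m a" using e(2)[OF xX] by blast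
      have "restrict (q (x, v)) I = f"
        using f xI unfolding q_def by (auto simp: fun_eq_iff PiE_def extensional_def)
      then show "f \<in> (\<lambda>z. restrict (q z) I) ` GR m a" using v by (metis image_eqI)
    qed
  qed (use r s in \<open>auto simp: I_def card_Diff_singleton\<close>)
qed

theorem theorem1p2:
  fixes m :: "'n::finite \<Rightarrow> real" and a :: "(real^'d)^'n"
  assumes "CARD('d) \<ge> 2"
    and "\<forall>i. m i > 0"
    and "a \<in> Omega \<inter> Xc m"
  shows "countably_rectifiable (CARD('d) * (CARD('n) - 1)) (GR m a) \<and>
         hausdorff_dim (GR m a) = ereal (real (CARD('d) * (CARD('n) - 1)))"
proof
  show rect: "countably_rectifiable (CARD('d) * (CARD('n) - 1)) (GR m a)"
    using GR_countably_rectifiable[OF assms(2)] assms(3) by blast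
  show "hausdorff_dim (GR m a) = ereal (real (CARD('d) * (CARD('n) - 1)))"
    \<comment> \<open>For a single body the dimension is 0 and the lower estimate is empty, since
      exponents are nonnegative by definition.\<close>
    by (rule hausdorff_dim_eqI)
      (use hausdorff_null_imp_measure_zero[OF countably_rectifiable_hausdorff_null[OF rect]]
        GR_hausdorff_measure_nonzero[OF assms(2,3)] in auto)
qed

end
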